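(* Let $x=(2(n+c_G))^{1/2}+2^{-1/2}n^{-1/6}X$ and $y=(2(n+c_G))^{1/2}+2^{-1/2}n^{-1/6}Y$ with $X$, $Y$ and $c_G$ bounded. Then, as $n\to\infty$, $$K_n(x,y)\,dx=\Big\{K_{\mathrm{Ai}}(X,Y)-c_G\,\mathrm{Ai}(X)\mathrm{Ai}(Y)\,n^{-\frac13}+\frac1{20}\Big[(X+Y)\mathrm{Ai}'(X)\mathrm{Ai}'(Y)-(X^2+XY+Y^2)\mathrm{Ai}(X)\mathrm{Ai}(Y)$$ $$+\frac{-20c_G^2+3}{2}\big(\mathrm{Ai}'(X)\mathrm{Ai}(Y)+\mathrm{Ai}(X)\mathrm{Ai}'(Y)\big)\Big]n^{-\frac23}+O(n^{-1})\,E(X,Y)\Big\}\,dX .$$ The error term $E(X,Y)$ is the kernel of an integral operator on $L^2(J)$ which is trace class for any Borel subset $J$ of the reals that is bounded away from minus infinity.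
   Context: Let $H_n$ be the Hermite polynomials (orthogonal with respect to $e^{-x^2}$ on $\mathbb{R}$, leading coefficient $2^n$) and $\varphi_n(x)=(2^n n!\sqrt{\pi})^{-1/2}H_n(x)e^{-x^2/2}$. The Hermite kernel is $K_n(x,y)=\sum_{k=0}^{n-1}\varphi_k(x)\varphi_k(y)$. $\mathrm{Ai}$ is the Airy function, and the Airy kernel is $$K_{\mathrm{Ai}}(x,y)=\frac{\mathrm{Ai}(x)\mathrm{Ai}'(y)-\mathrm{Ai}(y)\mathrm{Ai}'(x)}{x-y}=\int_0^\infty \mathrm{Ai}(x+z)\mathrm{Ai}(y+z)\,dz.$$ The differentials are related by $dx=2^{-1/2}n^{-1/6}\,dX$, so the left-hand side means $2^{-1/2}n^{-1/6}K_n(x,y)\,dX$. *)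

theory Defs
  imports "HOL-Analysis.Analysis" "HOL-Computational_Algebra.Polynomial"
begin

section \<open>Hermite polynomials and the Hermite kernel\<close>

text \<open>
  The Hermite polynomials are the unique family of polynomials of degree \<open>n\<close> with leading
  coefficient \<open>2 ^ n\<close> that is orthogonal for the weight \<open>exp (- x\<^sup>2)\<close> on the real line.
\<close>

definition hermite_family :: "(nat \<Rightarrow> real poly) \<Rightarrow> bool" where
  "hermite_family H \<longleftrightarrow>
     (\<forall>n. degree (H n) = n \<and> lead_coeff (H n) = 2 ^ n) \<and>
     (\<forall>m n. m \<noteq> n \<longrightarrow> (LBINT x. poly (H m) x * poly (H n) x * exp (- x\<^sup>2)) = 0)"

definition hermite_poly :: "nat \<Rightarrow> real poly" where
  "hermite_poly = (THE H. hermite_family H)"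

definition hermite_fun :: "nat \<Rightarrow> real \<Rightarrow> real" where
  "hermite_fun n x =
     (2 ^ n * fact n * sqrt pi) powr (- 1 / 2) * poly (hermite_poly n) x * exp (- x\<^sup>2 / 2)"

definition hermite_kernel :: "nat \<Rightarrow> real \<Rightarrow> real \<Rightarrow> real" where
  "hermite_kernel n x y = (\<Sum>k<n. hermite_fun k x * hermite_fun k y)"

text \<open>The edge scaling \<open>X \<mapsto> x\<close> and its constant Jacobian \<open>dx / dX\<close>.\<close>

definition edge_jacobian :: "nat \<Rightarrow> real" where
  "edge_jacobian n = 2 powr (- 1 / 2) * real n powr (- 1 / 6)"

definition edge_point :: "real \<Rightarrow> nat \<Rightarrow> real \<Rightarrow> real" where
  "edge_point c n X = sqrt (2 * (real n + c)) + edge_jacobian n * X"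


section \<open>Airy function and Airy kernel\<close>

text \<open>
  The integral defining the Airy function converges only conditionally. The
  Henstock--Kurzweil integral over \<open>{0..}\<close> is the improper integral
  \<open>lim\<^bsub>R \<rightarrow> \<infinity>\<^esub> \<integral>\<^bsub>[0,R]\<^esub>\<close>; the Lebesgue integral would be the junk value 0 here.
\<close>

definition Airy :: "real \<Rightarrow> real" where
  "Airy x = 1 / pi * integral {0..} (\<lambda>t. cos (t ^ 3 / 3 + x * t))"

abbreviation Airy' :: "real \<Rightarrow> real" where
  "Airy' \<equiv> deriv Airy"

text \<open>
  The integral form is used because, unlike the quotient
  \<open>(Ai X Ai' Y - Ai Y Ai' X) / (X - Y)\<close>, it also covers the diagonal \<open>X = Y\<close>.
\<close>

definition Airy_kernel :: "real \<Rightarrow> real \<Rightarrow> real" where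
  "Airy_kernel X Y = (LBINT z:{0..}. Airy (X + z) * Airy (Y + z))"


section \<open>Trace class integral operators on \<open>L\<^sup>2\<close>\<close>

text \<open>
  Elements of the (real) space \<open>L\<^sup>2(M)\<close> are represented by functions; equality of classes
  is expressed through \<open>AE\<close> or through the seminorm \<open>L2_norm\<close>.
\<close>

definition L2_space :: "'a measure \<Rightarrow> ('a \<Rightarrow> real) set" where
  "L2_space M = {f \<in> borel_measurable M. integrable M (\<lambda>x. (f x)\<^sup>2)}"

definition L2_inner :: "'a measure \<Rightarrow> ('a \<Rightarrow> real) \<Rightarrow> ('a \<Rightarrow> real) \<Rightarrow> real" where
  "L2_inner M f g = (\<integral>x. f x * g x \<partial>M)"

definition L2_norm :: "'a measure \<Rightarrow> ('a \<Rightarrow> real) \<Rightarrow> real" where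
  "L2_norm M f = sqrt (L2_inner M f f)"

definition integral_operator ::
    "'a measure \<Rightarrow> ('a \<Rightarrow> 'a \<Rightarrow> real) \<Rightarrow> ('a \<Rightarrow> real) \<Rightarrow> 'a \<Rightarrow> real" where
  "integral_operator M E f x = (\<integral>y. E x y * f y \<partial>M)"

text \<open>
  The integrability clause excludes kernels for which the Bochner integral above is only
  the default value 0.
\<close>

definition L2_operator_kernel :: "'a measure \<Rightarrow> ('a \<Rightarrow> 'a \<Rightarrow> real) \<Rightarrow> bool" where
  "L2_operator_kernel M E \<longleftrightarrow>
     (\<forall>f \<in> L2_space M.
        (AE x in M. integrable M (\<lambda>y. E x y * f y)) \<and>
        integral_operator M E f \<in> L2_space M)"

text \<open>
  Trace class operators on a Hilbert space are the nuclear operators,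
  \<open>T f = (\<Sum>k. \<langle>u\<^sub>k, f\<rangle> v\<^sub>k)\<close> with \<open>(\<Sum>k. \<parallel>u\<^sub>k\<parallel> \<parallel>v\<^sub>k\<parallel>) < \<infinity>\<close>, and the trace norm is the
  infimum of these sums over all such representations.
\<close>

definition nuclear_representation ::
    "'a measure \<Rightarrow> (('a \<Rightarrow> real) \<Rightarrow> 'a \<Rightarrow> real) \<Rightarrow>
     (nat \<Rightarrow> 'a \<Rightarrow> real) \<Rightarrow> (nat \<Rightarrow> 'a \<Rightarrow> real) \<Rightarrow> bool" where
  "nuclear_representation M T u v \<longleftrightarrow>
     range u \<subseteq> L2_space M \<and> range v \<subseteq> L2_space M \<and>
     summable (\<lambda>k. L2_norm M (u k) * L2_norm M (v k)) \<and>
     (\<forall>f \<in> L2_space M.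
        (\<lambda>N. L2_norm M (\<lambda>x. T f x - (\<Sum>k<N. L2_inner M (u k) f * v k x))) \<longlonglongrightarrow> 0)"

definition trace_class_operator ::
    "'a measure \<Rightarrow> (('a \<Rightarrow> real) \<Rightarrow> 'a \<Rightarrow> real) \<Rightarrow> bool" where
  "trace_class_operator M T \<longleftrightarrow>
     (\<forall>f \<in> L2_space M. T f \<in> L2_space M) \<and> (\<exists>u v. nuclear_representation M T u v)"

definition trace_norm :: "'a measure \<Rightarrow> (('a \<Rightarrow> real) \<Rightarrow> 'a \<Rightarrow> real) \<Rightarrow> real" where
  "trace_norm M T =
     Inf {(\<Sum>k. L2_norm M (u k) * L2_norm M (v k)) | u v. nuclear_representation M T u v}"

end

theory Submission
  imports Defs "HOL-Probability.Probability" "HOL-Complex_Analysis.Complex_Analysis" "HOL-Real_Asymp.Real_Asymp"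
begin

text \<open>
  Put \<open>h = n\<^sup>-\<^sup>1\<^sup>/\<^sup>3\<close>. The operator \<open>\<partial>\<^sub>X + \<partial>\<^sub>Y\<close> turns the Hermite kernel into a rank two
  expression in \<open>\<phi>\<^sub>n\<close> and \<open>\<phi>\<^sub>n'\<close>, and the Airy kernel and its corrections into an explicit polynomial
  expression in Airy functions. Hence, as everything vanishes at \<open>+\<infinity>\<close>, the error \<open>E (X, Y)\<close> is recovered by
  integrating along the diagonal direction, and it suffices to know \<open>\<phi>\<^sub>n\<close> and \<open>\<phi>\<^sub>n'\<close> at the edge up to
  \<open>O (h\<^sup>3 exp (- m X))\<close>, uniformly on half lines \<open>X \<ge> s\<close>. This follows from the contour integral
  \<open>H\<^sub>n (x) = 2\<^sup>n \<pi>\<^sup>-\<^sup>1\<^sup>/\<^sup>2 \<integral> u\<^sup>n exp ((u - x)\<^sup>2) dt\<close>, \<open>u = \<sigma> + i t\<close>, which is valid for every real \<open>\<sigma>\<close>: near the critical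
  point it becomes the Airy integral, and far to the right another choice of \<open>\<sigma>\<close> gives Gaussian decay.
  A nonzero \<open>c\<close> amounts to the shift \<open>X \<mapsto> X + c h + O (h\<^sup>4)\<close>.

  The same argument applied to differences in \<open>X\<close> gives \<open>\<bar>E (X', Y) - E (X, Y)\<bar> \<le> C (X' - X) exp (- X - Y)\<close>.
  Telescoping the dyadic step function approximations of \<open>E\<close> in \<open>X\<close> then writes the operator as a
  sum of rank one operators with summable norms.
\<close>

section \<open>Gaussian integrals and the Airy function\<close>

text \<open>Working along the diagonal avoids the quotient by X - Y of the Christoffel-Darboux
  formula, so no cancellation near X = Y has to be controlled.

  The obstacle is uniformity on the unbounded half line: the contour formula carries the prefactor
  exp (h X^2 / 4), which no fixed contour compensates. On Re w = 8 the integral decays like exp (- 8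
  X). A factor X reduces the rate to 7; the prefactor, of order exp (4 X) at most while h X \<le>
  16, leaves 3; further powers of X leave 2 and finally 1. Beyond h X = 16 a contour moving with X
  takes over.

  An exponential bound on the kernel alone would only give a Hilbert-Schmidt operator. The Lipschitz
  bound in X supplies what is missing: at dyadic level j there are about 2^j cells per unit length,
  each with a difference of size 2^-j and an indicator of norm 2^(-j/2), so the level contributes
  2^(-j/2) to the trace norm.\<close>

lemma integrable_abs_power_gaussian:
  assumes "c > 0"
  shows "integrable lborel (\<lambda>t::real. \<bar>t\<bar> ^ k * exp (- (c * t\<^sup>2)))"
proof -
  define \<sigma> where "\<sigma> = sqrt (1 / (2 * c))"
  have \<sigma>: "\<sigma>\<^sup>2 = 1 / (2 * c)" "\<sigma> > 0" using assms by (auto simp: \<sigma>_def)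
  have "integrable lborel (\<lambda>x. sqrt (2 * pi * \<sigma>\<^sup>2) * (normal_density 0 \<sigma> x * \<bar>x - 0\<bar> ^ k))"
    using integrable_normal_moment_abs[OF \<sigma>(2), of 0 k] by simp
  moreover have "sqrt (2 * pi * \<sigma>\<^sup>2) * (normal_density 0 \<sigma> x * \<bar>x - 0\<bar> ^ k) = \<bar>x\<bar> ^ k * exp (- (c * x\<^sup>2))" for x
    using assms by (simp add: normal_density_def \<sigma>)
  ultimately show ?thesis by (simp only:)
qed

lemma integrable_poly_gaussian:
  assumes "c > 0"
  shows "integrable lborel (\<lambda>t::real. (a + \<bar>t\<bar>) ^ k * exp (- (c * t\<^sup>2)))"
proof -
  have "(a + \<bar>t\<bar>) ^ k * exp (- (c * t\<^sup>2)) = (\<Sum>i\<le>k. (of_nat (k choose i) * a ^ (k - i)) * (\<bar>t\<bar> ^ i * exp (- (c * t\<^sup>2))))" for t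
    unfolding add.commute[of a] binomial_ring sum_distrib_right
    by (intro sum.cong) (auto simp: mult_ac)
  then show ?thesis
    using integrable_abs_power_gaussian[OF assms] by simp
qed

text \<open>Shared majorant for the contour integrals below: \<open>a\<close> depends on the contour
  and \<open>k\<close> takes up polynomial factors. The sign of \<open>C\<close> is left open, hence
  the absolute value in the comparison.\<close>

lemma integrable_gaussian_bound:
  fixes f :: "real \<Rightarrow> 'b::{banach, second_countable_topology}"
  assumes "c > 0" "f \<in> borel_measurable lborel" "\<And>t. norm (f t) \<le> C * ((a + \<bar>t\<bar>) ^ k * exp (- (c * t\<^sup>2)))"
  shows "integrable lborel f"
proof (rule Bochner_Integration.integrable_bound)
  show "integrable lborel (\<lambda>t. C * ((a + \<bar>t\<bar>) ^ k * exp (- (c * t\<^sup>2))))"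
    using integrable_poly_gaussian[OF assms(1)] by simp
  show "AE x in lborel. norm (f x) \<le> norm (C * ((a + \<bar>x\<bar>) ^ k * exp (- (c * x\<^sup>2))))"
  proof (intro always_eventually allI)
    fix t show "norm (f t) \<le> norm (C * ((a + \<bar>t\<bar>) ^ k * exp (- (c * t\<^sup>2))))"
      by (rule order_trans[OF assms(3)]) (simp only: real_norm_def abs_ge_self)
  qed
qed (use assms in auto)

lemma norm_integral_gaussian_bound:
  fixes f :: "real \<Rightarrow> complex"
  assumes "c > 0" "f \<in> borel_measurable lborel" "\<And>t. norm (f t) \<le> C * ((a + \<bar>t\<bar>) ^ k * exp (- (c * t\<^sup>2)))"
  shows "norm (integral\<^sup>L lborel f) \<le> C * (\<integral>t. (a + \<bar>t\<bar>) ^ k * exp (- (c * t\<^sup>2)) \<partial>lborel)"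
proof -
  have "norm (integral\<^sup>L lborel f) \<le> (\<integral>t. C * ((a + \<bar>t\<bar>) ^ k * exp (- (c * t\<^sup>2))) \<partial>lborel)"
    by (rule Bochner_Integration.integral_norm_bound_integral[OF integrable_gaussian_bound[OF assms] integrable_mult_right[OF
        integrable_poly_gaussian[OF assms(1)]] assms(3)])
  then show ?thesis by simp
qed

lemma poly_gaussian_tendsto_0:
  assumes "c > 0"
  shows "((\<lambda>t::real. (a + \<bar>t\<bar>) ^ k * exp (- (c * t\<^sup>2))) \<longlongrightarrow> 0) at_top"
    and "((\<lambda>t::real. (a + \<bar>t\<bar>) ^ k * exp (- (c * t\<^sup>2))) \<longlongrightarrow> 0) at_bot"
proof -
  have "filterlim (\<lambda>t. a + t) at_top at_top" by real_asymp
  from filterlim_compose[OF tendsto_power_div_exp_0 this]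
  have "((\<lambda>t::real. (a + t) ^ k / exp (a + t)) \<longlongrightarrow> 0) at_top" .
  moreover have "((\<lambda>t. exp (a + t - c * t\<^sup>2)) \<longlongrightarrow> 0) at_top" using assms by real_asymp
  ultimately have "((\<lambda>t. (a + t) ^ k / exp (a + t) * exp (a + t - c * t\<^sup>2)) \<longlongrightarrow> 0 * 0) at_top"
    by (rule tendsto_mult)
  moreover have "(a + t) ^ k / exp (a + t) * exp (a + t - c * t\<^sup>2) = (a + t) ^ k * exp (- (c * t\<^sup>2))" for t
    by (simp add: exp_add exp_diff exp_minus field_simps)
  ultimately have "((\<lambda>t::real. (a + t) ^ k * exp (- (c * t\<^sup>2))) \<longlongrightarrow> 0) at_top" by simp
  moreover have "\<forall>\<^sub>F t::real in at_top. (a + t) ^ k * exp (- (c * t\<^sup>2)) = (a + \<bar>t\<bar>) ^ k * exp (- (c * t\<^sup>2))"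
    using eventually_ge_at_top[of 0] by eventually_elim simp
  ultimately show *: "((\<lambda>t::real. (a + \<bar>t\<bar>) ^ k * exp (- (c * t\<^sup>2))) \<longlongrightarrow> 0) at_top"
    by (rule Lim_transform_eventually)
  show "((\<lambda>t::real. (a + \<bar>t\<bar>) ^ k * exp (- (c * t\<^sup>2))) \<longlongrightarrow> 0) at_bot"
    using * by (subst at_bot_mirror) (simp add: filterlim_filtermap)
qed

text \<open>Integration by parts on the whole line: an antiderivative under a Gaussian majorant has
  zero boundary values. Along vertical lines this yields the recurrences of the Airy and Hermite
  contour integrals, and with p(x) exp (- x^2) the orthogonality of the Hermite polynomials.\<close>

lemma integral_derivative_eq_0:
  fixes F f :: "real \<Rightarrow> 'b::euclidean_space"
  assumes F: "\<And>t. (F has_vector_derivative f t) (at t)"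
    and f: "continuous_on UNIV f" "integrable lborel f"
    and c: "c > 0" and bd: "\<And>t. norm (F t) \<le> C * ((a + \<bar>t\<bar>) ^ k * exp (- (c * t\<^sup>2)))"
  shows "(\<integral>t. f t \<partial>lborel) = 0"
proof -
  have lim: "(F \<longlongrightarrow> 0) at_top" "(F \<longlongrightarrow> 0) at_bot"
    by (rule Lim_null_comparison[OF always_eventually tendsto_mult_right_zero[OF poly_gaussian_tendsto_0(1)[OF c]]] Lim_null_comparison[OF always_eventually tendsto_mult_right_zero[OF poly_gaussian_tendsto_0(2)[OF c]]]; use bd in blast)+
  have "(LBINT x=-\<infinity>..\<infinity>. f x) = 0 - 0"
  proof (rule interval_integral_FTC_integrable[of _ _ F])
    show "isCont f x" for x using f(1) by (simp add: continuous_on_eq_continuous_at)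
    show "set_integrable lborel (einterval (- \<infinity>) \<infinity>) f"
      using f(2) by (simp add: einterval_def set_integrable_def)
    show "((F \<circ> real_of_ereal) \<longlongrightarrow> 0) (at_right (- \<infinity>))" "((F \<circ> real_of_ereal) \<longlongrightarrow> 0) (at_left \<infinity>)"
      using lim by (auto simp: ereal_tendsto_simps1)
  qed (use F in auto)
  then show ?thesis by (simp add: interval_lebesgue_integral_def einterval_def set_lebesgue_integral_def)
qed

text \<open>For \<eta> > 0 this is (-1)^k times the k-th derivative of Ai, as an integral over the
  vertical line Re w = \<eta>. Leaving the imaginary axis makes the integral absolutely convergent.
  The powers of w are kept because the corrections in h appear as such powers under the
  integral.\<close>

definition airy_int :: "real \<Rightarrow> nat \<Rightarrow> real \<Rightarrow> complex" where
  "airy_int \<eta> k X = (1 / (2 * pi)) *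
     (\<integral>t. Complex \<eta> t ^ k * exp (Complex \<eta> t ^ 3 / 3 - Complex \<eta> t * X) \<partial>lborel)"

lemma Complex_line_eq: "Complex a t = of_real a + \<i> * of_real t"
  by (simp add: complex_eq_iff)

lemma continuous_on_Complex_line [continuous_intros]:
  "continuous_on S f \<Longrightarrow> continuous_on S (\<lambda>t. Complex a (f t))"
  unfolding Complex_line_eq by (intro continuous_intros)

lemma has_vector_derivative_Complex_line:
  "((\<lambda>t. Complex a t) has_vector_derivative \<i>) (at t)"
  unfolding Complex_line_eq by (auto intro!: derivative_eq_intros)

lemma norm_Complex_line_le: "a \<ge> 0 \<Longrightarrow> norm (Complex a t) \<le> a + \<bar>t\<bar>"
  using complex_abs_le_norm cmod_le[of "Complex a t"] by simp

lemma borel_measurable_continuous_lborel: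
  fixes f :: "real \<Rightarrow> 'b::topological_space"
  shows "continuous_on UNIV f \<Longrightarrow> f \<in> borel_measurable lborel"
  using borel_measurable_continuous_onI by simp

lemma Re_Complex_cube: "Re (Complex a t ^ 3) = a ^ 3 - 3 * a * t\<^sup>2"
  by (simp add: power3_eq_cube power2_eq_square algebra_simps)

text \<open>On the line Re w = \<eta> the real part of w^3 / 3 is \<eta>^3 / 3 - \<eta> t^2: the
  cubic phase supplies a Gaussian of rate \<eta>, and X enters only through exp (- \<eta>
  X).\<close>

lemma norm_airy_exp:
  "norm (exp (Complex \<eta> t ^ 3 / 3 - Complex \<eta> t * of_real X)) = exp (\<eta> ^ 3 / 3 - \<eta> * X) * exp (- (\<eta> * t\<^sup>2))"
  by (simp add: Re_Complex_cube exp_add[symmetric] diff_divide_distrib)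

lemma norm_airy_integrand:
  assumes "\<eta> > 0"
  shows "norm (Complex \<eta> t ^ k * exp (Complex \<eta> t ^ 3 / 3 - Complex \<eta> t * of_real X))
    \<le> exp (\<eta> ^ 3 / 3 - \<eta> * X) * ((\<eta> + \<bar>t\<bar>) ^ k * exp (- (\<eta> * t\<^sup>2)))"
proof -
  have "norm (Complex \<eta> t) ^ k \<le> (\<eta> + \<bar>t\<bar>) ^ k"
    using assms by (intro power_mono norm_Complex_line_le) auto
  then show ?thesis unfolding norm_mult norm_airy_exp norm_power
    by (simp add: mult_ac mult_right_mono)
qed

lemma airy_integrand_continuous:
  "continuous_on UNIV (\<lambda>t. Complex \<eta> t ^ k * exp (Complex \<eta> t ^ 3 / 3 - Complex \<eta> t * of_real X))"
  by (intro continuous_intros) auto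

lemma airy_integrand_integrable:
  assumes "\<eta> > 0"
  shows "integrable lborel (\<lambda>t. Complex \<eta> t ^ k * exp (Complex \<eta> t ^ 3 / 3 - Complex \<eta> t * of_real X))"
  by (rule integrable_gaussian_bound[OF assms borel_measurable_continuous_lborel[OF airy_integrand_continuous] norm_airy_integrand[OF assms]])

lemma airy_int_bound:
  assumes "\<eta> > 0"
  obtains C where "\<And>X. norm (airy_int \<eta> k X) \<le> C * exp (- (\<eta> * X))" "C \<ge> 0"
proof
  let ?I = "\<integral>t. (\<eta> + \<bar>t\<bar>) ^ k * exp (- (\<eta> * t\<^sup>2)) \<partial>lborel"
  have I: "?I \<ge> 0" using assms by (intro integral_nonneg_AE) auto
  show "norm (airy_int \<eta> k X) \<le> (exp (\<eta> ^ 3 / 3) * ?I) * exp (- (\<eta> * X))" for X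
  proof -
    have "norm (airy_int \<eta> k X) \<le> norm (\<integral>t. Complex \<eta> t ^ k * exp (Complex \<eta> t ^ 3 / 3 - Complex \<eta> t * X) \<partial>lborel)"
      using pi_gt3 unfolding airy_int_def norm_mult
      by (intro mult_left_le_one_le) (auto simp: norm_mult norm_divide divide_le_eq)
    also have "\<dots> \<le> exp (\<eta> ^ 3 / 3 - \<eta> * X) * ?I"
      by (rule norm_integral_gaussian_bound[OF assms borel_measurable_continuous_lborel[OF airy_integrand_continuous] norm_airy_integrand[OF assms]])
    also have "exp (\<eta> ^ 3 / 3 - \<eta> * X) = exp (\<eta> ^ 3 / 3) * exp (- (\<eta> * X))"
      by (simp add: exp_add[symmetric])
    finally show ?thesis by (simp only: mult_ac)
  qed
  show "exp (\<eta> ^ 3 / 3) * ?I \<ge> 0" using I by simp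
qed

text \<open>The derivative of w^k exp (w^3 / 3 - w X) has integral zero. For k = 0 this is the Airy
  equation; the truncated k - 1 is harmless there because its coefficient vanishes.\<close>

lemma airy_int_rec:
  assumes "\<eta> > 0"
  shows "airy_int \<eta> (k + 2) X = X * airy_int \<eta> k X - of_nat k * airy_int \<eta> (k - 1) X"
proof -
  let ?g = "\<lambda>k t. Complex \<eta> t ^ k * exp (Complex \<eta> t ^ 3 / 3 - Complex \<eta> t * of_real X)"
  let ?f = "\<lambda>t. \<i> * (of_nat k * ?g (k - 1) t + ?g (k + 2) t - X * ?g k t)"
  have int: "integrable lborel ?f"
    by (intro integrable_mult_right Bochner_Integration.integrable_diff Bochner_Integration.integrable_add airy_integrand_integrable assms)
  have "(\<integral>t. ?f t \<partial>lborel) = 0"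
  proof (rule integral_derivative_eq_0[OF _ _ int assms norm_airy_integrand[OF assms, of _ k X]])
    fix t
    have "((\<lambda>z::complex. z ^ k * exp (z ^ 3 / 3 - z * of_real X)) has_field_derivative
       (of_nat k * w ^ (k - 1) + w ^ k * (w\<^sup>2 - X)) * exp (w ^ 3 / 3 - w * of_real X)) (at w)" for w :: complex
      by (auto intro!: derivative_eq_intros simp: algebra_simps power2_eq_square)
    from field_vector_diff_chain_at[OF has_vector_derivative_Complex_line[of \<eta> t] this]
    show "(?g k has_vector_derivative ?f t) (at t)"
      by (simp add: o_def algebra_simps power2_eq_square)
    show "continuous_on UNIV ?f"
      by (intro continuous_on_mult_left continuous_on_add continuous_on_diff airy_integrand_continuous)
  qed
  also have "(\<integral>t. ?f t \<partial>lborel) = \<i> * (of_nat k * (\<integral>t. ?g (k - 1) t \<partial>lborel) + (\<integral>t. ?g (k + 2) t \<partial>lborel) - X * (\<integral>t. ?g k t \<partial>lborel))"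
    by (simp only: integral_mult_right_zero Bochner_Integration.integral_diff Bochner_Integration.integral_add Bochner_Integration.integrable_add integrable_mult_right airy_integrand_integrable[OF assms])
  finally have eq: "\<dots> = 0" .
  have *: "\<i> * (a + b - c) = 0 \<Longrightarrow> b = c - a" for a b c :: complex
    by (simp add: eq_diff_eq add.commute)
  from eq have "(\<integral>t. ?g (k + 2) t \<partial>lborel) = X * (\<integral>t. ?g k t \<partial>lborel) - of_nat k * (\<integral>t. ?g (k - 1) t \<partial>lborel)"
    by (rule *)
  then show ?thesis unfolding airy_int_def by (simp only: right_diff_distrib mult.left_commute)
qed

lemma has_vector_derivative_quadratic_error:
  fixes f :: "real \<Rightarrow> 'b::real_normed_vector"
  assumes "\<And>d. \<bar>d\<bar> \<le> 1 \<Longrightarrow> norm (f (x + d) - f x - d *\<^sub>R f') \<le> C * d\<^sup>2"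
  shows "(f has_vector_derivative f') (at x)"
  unfolding has_vector_derivative_def has_derivative_iff_norm
proof (intro conjI)
  show "bounded_linear (\<lambda>h. h *\<^sub>R f')" by (rule bounded_linear_scaleR_left)
  have "((\<lambda>y. C * \<bar>y - x\<bar>) \<longlongrightarrow> C * \<bar>x - x\<bar>) (at x)" by (intro tendsto_intros)
  then have lim: "((\<lambda>y. C * \<bar>y - x\<bar>) \<longlongrightarrow> 0) (at x)" by simp
  show "((\<lambda>y. norm (f y - f x - (y - x) *\<^sub>R f') / norm (y - x)) \<longlongrightarrow> 0) (at x)"
  proof (rule Lim_null_comparison[OF _ lim])
    have "norm (norm (f y - f x - (y - x) *\<^sub>R f') / norm (y - x)) \<le> C * \<bar>y - x\<bar>" if "dist y x < 1" "y \<noteq> x" for y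
    proof -
      have "norm (f (x + (y - x)) - f x - (y - x) *\<^sub>R f') \<le> C * (y - x)\<^sup>2"
        using that by (intro assms) (auto simp: dist_real_def)
      moreover have "(y - x)\<^sup>2 = \<bar>y - x\<bar> * \<bar>y - x\<bar>" by (simp add: power2_eq_square)
      ultimately show ?thesis using that by (simp add: divide_le_eq mult.assoc)
    qed
    then show "\<forall>\<^sub>F y in at x. norm (norm (f y - f x - (y - x) *\<^sub>R f') / norm (y - x)) \<le> C * \<bar>y - x\<bar>"
      unfolding eventually_at by (intro exI[of _ 1]) auto
  qed
qed

text \<open>Differentiation under the integral sign: the second order remainder of exp (- w d) is
  d^2 times a function with a Gaussian majorant, uniformly for |d| \<le> 1.\<close>

lemma airy_int_has_vector_derivative:
  assumes "\<eta> > 0"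
  shows "(airy_int \<eta> k has_vector_derivative - airy_int \<eta> (Suc k) X) (at X)"
proof (rule has_vector_derivative_quadratic_error)
  define e where "e t = exp (Complex \<eta> t ^ 3 / 3 - Complex \<eta> t * of_real X)" for t
  let ?K = "exp (\<eta> ^ 3 / 3 - \<eta> * X) * exp (\<eta> + 1 / (2 * \<eta>))"
  let ?I = "\<integral>t. (\<eta> + \<bar>t\<bar>) ^ (k + 2) * exp (- (\<eta> / 2 * t\<^sup>2)) \<partial>lborel"
  fix d :: real assume d: "\<bar>d\<bar> \<le> 1"
  let ?R = "\<lambda>t. Complex \<eta> t ^ k * e t * (exp (- (Complex \<eta> t * d)) - 1 + Complex \<eta> t * d)"
  have e': "exp (Complex \<eta> t ^ 3 / 3 - Complex \<eta> t * of_real (X + d)) = e t * exp (- (Complex \<eta> t * d))" for t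
    by (simp add: e_def exp_add[symmetric] algebra_simps)
  have R: "?R t = Complex \<eta> t ^ k * exp (Complex \<eta> t ^ 3 / 3 - Complex \<eta> t * of_real (X + d)) - Complex \<eta> t ^ k * e t + d * (Complex \<eta> t ^ Suc k * e t)" for t
    unfolding e' by (simp add: algebra_simps)
  have int: "integrable lborel (\<lambda>t. Complex \<eta> t ^ j * e t)" for j
    unfolding e_def by (rule airy_integrand_integrable[OF assms])
  have "airy_int \<eta> k (X + d) - airy_int \<eta> k X - d *\<^sub>R - airy_int \<eta> (Suc k) X = 1 / (2 * pi) * (\<integral>t. ?R t \<partial>lborel)"
    unfolding R airy_int_def e_def[symmetric]
    using int airy_integrand_integrable[OF assms, of k "X + d"]
    by (simp add: algebra_simps scaleR_conv_of_real del: of_real_add power_Suc)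
  also have "norm \<dots> \<le> norm (\<integral>t. ?R t \<partial>lborel)"
    using pi_gt3 unfolding norm_mult by (intro mult_left_le_one_le) (auto simp: norm_mult norm_divide divide_le_eq)
  also have "\<dots> \<le> d\<^sup>2 * ?K * ?I"
  proof (rule norm_integral_gaussian_bound)
    show "\<eta> / 2 > 0" using assms by simp
    show "?R \<in> borel_measurable lborel" unfolding e_def
      by (intro borel_measurable_continuous_lborel continuous_intros) auto
    fix t
    define w where "w = Complex \<eta> t"
    have w: "norm w \<le> \<eta> + \<bar>t\<bar>" using norm_Complex_line_le assms by (simp add: w_def)
    have "norm (exp (- (w * d)) - (\<Sum>i\<le>1. (- (w * d)) ^ i / fact i)) \<le> exp \<bar>Re (- (w * d))\<bar> * norm (- (w * d)) ^ Suc 1 / fact 1"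
      by (rule Taylor_exp)
    moreover have "exp (- (w * d)) - (\<Sum>i\<le>1. (- (w * d)) ^ i / fact i) = exp (- (w * d)) - 1 + w * d" by simp
    ultimately have "norm (exp (- (w * d)) - 1 + w * d) \<le> exp \<bar>Re (- (w * d))\<bar> * norm (w * d) ^ 2"
      by (simp only: norm_minus_cancel fact_1 div_by_1 Suc_1 One_nat_def[symmetric])
    also have "\<dots> \<le> exp (\<eta> + \<bar>t\<bar>) * ((\<eta> + \<bar>t\<bar>)\<^sup>2 * d\<^sup>2)"
    proof (intro mult_mono)
      have "\<bar>Re (- (w * d))\<bar> = \<bar>\<eta>\<bar> * \<bar>d\<bar>" by (simp add: w_def abs_mult)
      also have "\<dots> \<le> \<eta> * 1" using d assms by (intro mult_mono) auto
      finally show "exp \<bar>Re (- (w * d))\<bar> \<le> exp (\<eta> + \<bar>t\<bar>)" by simp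
      show "norm (w * d) ^ 2 \<le> (\<eta> + \<bar>t\<bar>)\<^sup>2 * d\<^sup>2"
        using w by (simp add: norm_mult power_mult_distrib mult_right_mono power_mono)
    qed auto
    finally have 1: "norm (exp (- (w * d)) - 1 + w * d) \<le> exp (\<eta> + \<bar>t\<bar>) * ((\<eta> + \<bar>t\<bar>)\<^sup>2 * d\<^sup>2)" .
    have "norm (w ^ k * e t) \<le> exp (\<eta> ^ 3 / 3 - \<eta> * X) * ((\<eta> + \<bar>t\<bar>) ^ k * exp (- (\<eta> * t\<^sup>2)))"
      unfolding w_def e_def by (rule norm_airy_integrand[OF assms])
    from mult_mono[OF this 1] have "norm (?R t) \<le> exp (\<eta> ^ 3 / 3 - \<eta> * X) * ((\<eta> + \<bar>t\<bar>) ^ k * exp (- (\<eta> * t\<^sup>2))) * (exp (\<eta> + \<bar>t\<bar>) * ((\<eta> + \<bar>t\<bar>)\<^sup>2 * d\<^sup>2))"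
      using assms by (simp add: w_def norm_mult)
    also have "\<dots> = d\<^sup>2 * exp (\<eta> ^ 3 / 3 - \<eta> * X) * (\<eta> + \<bar>t\<bar>) ^ (k + 2) * (exp (- (\<eta> * t\<^sup>2)) * exp (\<eta> + \<bar>t\<bar>))"
      by (simp add: power_add power2_eq_square)
    also have "\<dots> \<le> d\<^sup>2 * exp (\<eta> ^ 3 / 3 - \<eta> * X) * (\<eta> + \<bar>t\<bar>) ^ (k + 2) * (exp (\<eta> + 1 / (2 * \<eta>)) * exp (- (\<eta> / 2 * t\<^sup>2)))"
    proof (intro mult_left_mono)
      \<comment> \<open>Half of the Gaussian pays for exp |t|; completing the square gives the
        constant exp (1 / (2 \<eta>)).\<close>
      have "0 \<le> (\<eta> * \<bar>t\<bar> - 1)\<^sup>2 / (2 * \<eta>)" using assms by simp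
      also have "\<dots> = \<eta> / 2 * t\<^sup>2 - \<bar>t\<bar> + 1 / (2 * \<eta>)" using assms
        by (simp add: power2_eq_square field_simps)
      finally show "exp (- (\<eta> * t\<^sup>2)) * exp (\<eta> + \<bar>t\<bar>) \<le> exp (\<eta> + 1 / (2 * \<eta>)) * exp (- (\<eta> / 2 * t\<^sup>2))"
        by (simp add: exp_add[symmetric])
    qed (use assms in auto)
    finally show "norm (?R t) \<le> d\<^sup>2 * ?K * ((\<eta> + \<bar>t\<bar>) ^ (k + 2) * exp (- (\<eta> / 2 * t\<^sup>2)))"
      by (simp only: mult_ac)
  qed
  finally show "norm (airy_int \<eta> k (X + d) - airy_int \<eta> k X - d *\<^sub>R - airy_int \<eta> (Suc k) X) \<le> (?K * ?I) * d\<^sup>2"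
    by (simp only: mult_ac)
qed

section \<open>From the improper Airy integral to the contour integral\<close>

lemma integral_even:
  fixes h :: "real \<Rightarrow> real"
  assumes "integrable lborel h" "\<And>t. h (- t) = h t"
  shows "(\<integral>t. h t \<partial>lborel) = 2 * (LBINT t:{0..}. h t)"
proof -
  have i: "integrable lborel (\<lambda>t. indicator A t * h t)" if "A \<in> sets lborel" for A
    using integrable_mult_indicator[OF that assms(1)] by simp
  have "(\<integral>t. h t \<partial>lborel) = (\<integral>t. indicator {0..} t * h t + indicator {..0} t * h t \<partial>lborel)"
    using AE_lborel_singleton[of 0]
    by (intro integral_cong_AE borel_measurable_integrable[OF assms(1)] borel_measurable_integrable[OF Bochner_Integration.integrable_add[OF i i]])
       (auto elim!: eventually_mono split: split_indicator)
  also have "\<dots> = (\<integral>t. indicator {0..} t * h t \<partial>lborel) + (\<integral>t. indicator {..0} t * h t \<partial>lborel)"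
    by (intro Bochner_Integration.integral_add i) auto
  also have "(\<integral>t. indicator {..0} t * h t \<partial>lborel) = (\<integral>t. indicator {0..} t * h t \<partial>lborel)"
    by (subst lborel_integral_real_affine[of "-1" _ 0])
       (auto intro!: Bochner_Integration.integral_cong simp: assms(2) split: split_indicator)
  finally show ?thesis by (simp add: set_lebesgue_integral_def)
qed

text \<open>One direction of Hake's theorem. Once an interval contains a large ball around 0, its
  intersection with the half line is {0..b} with b \<ge> R, so the gauge integral sees exactly the
  improper limit.\<close>

lemma has_integral_improper_at_top:
  fixes f :: "real \<Rightarrow> real"
  assumes "continuous_on UNIV f" "((\<lambda>R. integral {0..R} f) \<longlongrightarrow> L) at_top"
  shows "(f has_integral L) {0..}"
  unfolding has_integral_alt'
proof (intro conjI allI impI)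
  have int: "f integrable_on {u..v}" for u v
    by (intro integrable_continuous_real continuous_on_subset[OF assms(1)]) auto
  have eq: "{0..} \<inter> {u..v} = {max 0 u..v}" for u v :: real by auto
  show "(\<lambda>x. if x \<in> {0..} then f x else 0) integrable_on cbox a b" for a b
    unfolding integrable_restrict_Int cbox_interval eq by (rule int)
  fix e :: real assume "e > 0"
  with assms(2) obtain R where R: "\<And>x. x \<ge> R \<Longrightarrow> dist (integral {0..x} f) L < e"
    unfolding tendsto_iff eventually_at_top_linorder by blast
  show "\<exists>B>0. \<forall>a b. ball 0 B \<subseteq> cbox a b \<longrightarrow> norm (integral (cbox a b) (\<lambda>x. if x \<in> {0..} then f x else 0) - L) < e"
  proof (intro exI[of _ "2 * (\<bar>R\<bar> + 1)"] conjI allI impI)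
    fix a b :: real assume sub: "ball 0 (2 * (\<bar>R\<bar> + 1)) \<subseteq> cbox a b"
    have "\<bar>R\<bar> + 1 \<in> cbox a b" "- (\<bar>R\<bar> + 1) \<in> cbox a b" by (rule subsetD[OF sub]; simp)+
    then have "a \<le> 0" "b \<ge> R" by auto
    then show "norm (integral (cbox a b) (\<lambda>x. if x \<in> {0..} then f x else 0) - L) < e"
      using R[of b] unfolding integral_restrict_Int cbox_interval eq by (simp add: dist_real_def max_absorb1)
  qed simp
qed

text \<open>Cauchy's theorem on the rectangle with corners 0, R, R + i \<eta>, i \<eta>, expressed
  through a primitive \<Phi> of the entire function \<open>f\<close>. The left side contributes
  nothing to the real part and the right side vanishes as R grows.\<close>

lemma Airy_eq_half_line:
  assumes "\<eta> > 0"
  shows "Airy X = 1 / pi * (LBINT t:{0..}. Re (exp (Complex \<eta> t ^ 3 / 3 - Complex \<eta> t * of_real X)))"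
proof -
  let ?g = "\<lambda>t. exp (Complex \<eta> t ^ 3 / 3 - Complex \<eta> t * of_real X)"
  define f where "f z = exp (\<i> * (z ^ 3 / 3 + X * z))" for z :: complex
  have "f holomorphic_on UNIV" unfolding f_def by (intro holomorphic_intros) auto
  then obtain \<Phi> where \<Phi>: "\<And>z. (\<Phi> has_field_derivative f z) (at z)"
    using holomorphic_convex_primitive'[of UNIV f] by auto
  have line: "((\<lambda>s. d * f (p + s * d)) has_integral \<Phi> (p + b * d) - \<Phi> p) {0..b}" if "b \<ge> 0" for p d :: complex and b :: real
  proof -
    have "((\<lambda>s. d * f (p + s * d)) has_integral \<Phi> (p + of_real b * d) - \<Phi> (p + of_real 0 * d)) {0..b}"
    proof (rule fundamental_theorem_of_calculus[OF that])
      fix s :: real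
      have "((\<lambda>s. p + of_real s * d) has_vector_derivative d) (at s within {0..b})"
        by (auto intro!: derivative_eq_intros)
      from field_vector_diff_chain_within[OF this has_field_derivative_at_within[OF \<Phi>]]
      show "((\<lambda>s. \<Phi> (p + s * d)) has_vector_derivative d * f (p + s * d)) (at s within {0..b})"
        by (simp add: o_def)
    qed
    then show ?thesis by simp
  qed
  \<comment> \<open>The rotation w = - i z turns i (z^3 / 3 + X z) into w^3 / 3 - w X and the
    horizontal line Im z = \<eta> into Re w = \<eta>.\<close>
  have fg: "f (\<i> * \<eta> + of_real s * 1) = ?g (- s)" for s
    unfolding f_def Complex_line_eq by (intro arg_cong[of _ _ exp]) (simp add: power3_eq_cube algebra_simps)
  have Re_g: "Re (?g (- s)) = Re (?g s)" for s
  proof -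
    have "?g (- s) = cnj (?g s)" by (simp add: exp_cnj complex_cnj)
    then show ?thesis by (metis complex_cnj_cnj cnj.simps(1))
  qed
  \<comment> \<open>On the imaginary axis \<open>f\<close> is real, so the path element i ds makes
    the integrand purely imaginary.\<close>
  have left: "Re (\<Phi> (0 + \<eta> * \<i>) - \<Phi> 0) = 0"
  proof -
    have "((\<lambda>s. Re (\<i> * f (0 + of_real s * \<i>))) has_integral Re (\<Phi> (0 + \<eta> * \<i>) - \<Phi> 0)) {0..\<eta>}"
      using has_integral_linear[OF line[of \<eta> \<i> 0] bounded_linear_Re] assms by (simp add: o_def)
    moreover have "Re (\<i> * f (0 + of_real s * \<i>)) = 0" for s
    proof -
      have "f (0 + of_real s * \<i>) = of_real (exp (s ^ 3 / 3 - X * s))"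
        unfolding f_def exp_of_real[symmetric] by (intro arg_cong[of _ _ exp]) (simp add: power3_eq_cube algebra_simps)
      then show ?thesis by simp
    qed
    ultimately show ?thesis by (simp add: has_integral_unique)
  qed
  have right: "((\<lambda>R. Re (\<Phi> (of_real R + \<eta> * \<i>) - \<Phi> R)) \<longlongrightarrow> 0) at_top"
  proof -
    obtain M where M: "\<And>s. s \<in> {0..\<eta>} \<Longrightarrow> exp (s ^ 3 / 3 - X * s) \<le> M"
      using compact_attains_sup[of "(\<lambda>s. exp (s ^ 3 / 3 - X * s)) ` {0..\<eta>}"] assms
      by (force intro!: compact_continuous_image continuous_intros)
    have M0: "M > 0" using M[of 0] assms by simp
    have bd: "norm (Re (\<Phi> (of_real R + \<eta> * \<i>) - \<Phi> R)) \<le> M / R\<^sup>2" if "R > 0" for R :: real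
    proof -
      have 1: "((\<lambda>s. \<i> * f (of_real R + of_real s * \<i>)) has_integral (\<Phi> (of_real R + \<eta> * \<i>) - \<Phi> R)) {0..\<eta>}"
        using line[of \<eta> \<i> R] assms by simp
      \<comment> \<open>The decay exp (- R^2 s) away from the real axis integrates to at most 1 /
        R^2. A supremum bound over the side would not do, since the integrand has modulus 1 at s =
        0.\<close>
      have 2: "((\<lambda>s. M * exp (- (R\<^sup>2 * s))) has_integral (- (M / R\<^sup>2 * exp (- (R\<^sup>2 * \<eta>)))) - (- (M / R\<^sup>2 * exp (- (R\<^sup>2 * 0))))) {0..\<eta>}"
        using assms that by (intro fundamental_theorem_of_calculus) (auto intro!: derivative_eq_intros simp: has_real_derivative_iff_has_vector_derivative[symmetric] field_simps power2_eq_square)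
      have "norm (\<Phi> (of_real R + \<eta> * \<i>) - \<Phi> R) \<le> (- (M / R\<^sup>2 * exp (- (R\<^sup>2 * \<eta>)))) - (- (M / R\<^sup>2 * exp (- (R\<^sup>2 * 0))))"
      proof (rule order_trans[OF integral_norm_bound_integral[OF has_integral_integrable[OF 1] has_integral_integrable[OF 2], unfolded integral_unique[OF 1] integral_unique[OF 2]] order_refl])
        fix s assume s: "s \<in> {0..\<eta>}"
        have "Re (\<i> * ((of_real R + of_real s * \<i>) ^ 3 / 3 + X * (of_real R + of_real s * \<i>))) = (s ^ 3 / 3 - X * s) + - (R\<^sup>2 * s)"
          by (simp add: power3_eq_cube power2_eq_square field_simps)
        then have "norm (\<i> * f (of_real R + of_real s * \<i>)) = exp (s ^ 3 / 3 - X * s) * exp (- (R\<^sup>2 * s))"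
          unfolding f_def norm_mult norm_exp_eq_Re by (simp only: exp_add norm_ii mult_1_left)
        then show "norm (\<i> * f (of_real R + of_real s * \<i>)) \<le> M * exp (- (R\<^sup>2 * s))"
          using M[OF s] by (simp add: mult_right_mono)
      qed
      also have "\<dots> \<le> M / R\<^sup>2" using M0 by (simp add: divide_nonneg_nonneg)
      finally show ?thesis using abs_Re_le_cmod order_trans by (simp only: real_norm_def) blast
    qed
    have "((\<lambda>R. M / R\<^sup>2) \<longlongrightarrow> 0) at_top" by real_asymp
    then show ?thesis
      by (rule Lim_null_comparison[rotated]) (rule eventually_mono[OF eventually_gt_at_top[of 0] bd])
  qed
  have gint: "set_integrable lborel {0..} (\<lambda>t. Re (?g t))"
    unfolding set_integrable_def
    by (rule integrable_mult_indicator) (use integrable_Re[OF airy_integrand_integrable[OF assms, of 0 X]] in auto)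
  have top: "((\<lambda>R. LBINT t:{0..R}. Re (?g t)) \<longlongrightarrow> (LBINT t:{0..}. Re (?g t))) at_top"
    by (rule tendsto_set_lebesgue_integral_at_top[OF _ gint]) auto
  have "((\<lambda>R. (LBINT t:{0..R}. Re (?g t)) - Re (\<Phi> (of_real R + \<eta> * \<i>) - \<Phi> R)) \<longlongrightarrow> (LBINT t:{0..}. Re (?g t)) - 0) at_top"
    by (intro tendsto_diff top right)
  moreover have "\<forall>\<^sub>F R in at_top. (LBINT t:{0..R}. Re (?g t)) - Re (\<Phi> (of_real R + \<eta> * \<i>) - \<Phi> R) = integral {0..R} (\<lambda>t. cos (t ^ 3 / 3 + X * t))"
    using eventually_ge_at_top[of 0]
  proof eventually_elim
    case (elim R)
    have "((\<lambda>s. Re (f (0 + of_real s * 1))) has_integral Re (\<Phi> (of_real R) - \<Phi> 0)) {0..R}"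
      using has_integral_linear[OF line[of R 1 0] bounded_linear_Re] elim by (simp add: o_def)
    moreover have "Re (f (0 + of_real s * 1)) = cos (s ^ 3 / 3 + X * s)" for s
      by (simp add: f_def Re_exp)
    ultimately have 1: "integral {0..R} (\<lambda>t. cos (t ^ 3 / 3 + X * t)) = Re (\<Phi> (of_real R) - \<Phi> 0)"
      by (simp add: integral_unique)
    have "((\<lambda>s. Re (1 * f (\<i> * \<eta> + of_real s * 1))) has_integral Re (\<Phi> (\<i> * \<eta> + of_real R * 1) - \<Phi> (\<i> * \<eta>))) {0..R}"
      using has_integral_linear[OF line[of R 1 "\<i> * \<eta>"] bounded_linear_Re] elim by (simp add: o_def)
    then have "integral {0..R} (\<lambda>t. Re (?g t)) = Re (\<Phi> (\<i> * \<eta> + of_real R) - \<Phi> (\<i> * \<eta>))"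
      unfolding mult_1_left fg Re_g by (simp add: integral_unique)
    moreover have "(LBINT t:{0..R}. Re (?g t)) = integral {0..R} (\<lambda>t. Re (?g t))"
      by (intro set_borel_integral_eq_integral(2) set_integrable_subset[OF gint]) auto
    ultimately show ?case using left unfolding 1 by (simp add: algebra_simps)
  qed
  ultimately have "((\<lambda>R. integral {0..R} (\<lambda>t. cos (t ^ 3 / 3 + X * t))) \<longlongrightarrow> (LBINT t:{0..}. Re (?g t)) - 0) at_top"
    by (rule Lim_transform_eventually)
  then have "((\<lambda>t. cos (t ^ 3 / 3 + X * t)) has_integral (LBINT t:{0..}. Re (?g t))) {0..}"
    by (intro has_integral_improper_at_top) (auto intro!: continuous_intros)
  then show ?thesis unfolding Airy_def by (simp add: integral_unique)
qed

text \<open>The integrand at - t is the conjugate of the one at t, so the line integral is real and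
  twice the real part over the half line. As the left side does not contain \<eta>, the contour may
  be moved freely.\<close>

lemma Airy_eq_airy_int:
  assumes "\<eta> > 0"
  shows "of_real (Airy X) = airy_int \<eta> 0 X"
proof -
  let ?g = "\<lambda>t. exp (Complex \<eta> t ^ 3 / 3 - Complex \<eta> t * of_real X)"
  have int: "integrable lborel ?g" using airy_integrand_integrable[OF assms, of 0 X] by simp
  have cnj: "?g (- s) = cnj (?g s)" for s by (simp add: exp_cnj complex_cnj)
  have "(\<integral>t. ?g t \<partial>lborel) = (\<integral>t. ?g (- t) \<partial>lborel)"
    by (subst lborel_integral_real_affine[of "-1" _ 0]) auto
  also have "\<dots> = cnj (\<integral>t. ?g t \<partial>lborel)" unfolding cnj by simp
  finally have "Im (\<integral>t. ?g t \<partial>lborel) = 0" by (metis complex_cnj_cancel_iff Reals_cnj_iff complex_is_Real_iff)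
  moreover have "Re (\<integral>t. ?g t \<partial>lborel) = 2 * (LBINT t:{0..}. Re (?g t))"
    using int by (subst integral_even[symmetric]) (auto simp: cnj simp del: complex_cnj)
  ultimately show ?thesis
    by (simp add: airy_int_def Airy_eq_half_line[OF assms] complex_eq_iff)
qed

lemma Airy_has_vector_derivative: "((\<lambda>x. complex_of_real (Airy x)) has_vector_derivative - airy_int 1 1 x) (at x)"
  using airy_int_has_vector_derivative[of 1 0 x] unfolding Airy_eq_airy_int[of 1, symmetric, simplified] by simp

lemma Airy_DERIV: "(Airy has_real_derivative Airy' x) (at x)"
proof -
  have "(Airy has_vector_derivative Re (- airy_int 1 1 x)) (at x)"
    using bounded_linear.has_vector_derivative[OF bounded_linear_Re Airy_has_vector_derivative[of x]] by simp
  then show ?thesis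
    by (simp only: has_real_derivative_iff_has_vector_derivative[symmetric] DERIV_imp_deriv)
qed

lemma deriv_Airy_eq_airy_int:
  assumes "\<eta> > 0"
  shows "of_real (Airy' X) = - airy_int \<eta> 1 X"
proof -
  have "((\<lambda>x. complex_of_real (Airy x)) has_vector_derivative - airy_int \<eta> 1 X) (at X)"
    using airy_int_has_vector_derivative[OF assms, of 0 X] unfolding Airy_eq_airy_int[OF assms, symmetric] by simp
  moreover have "((\<lambda>x. complex_of_real (Airy x)) has_vector_derivative of_real (Airy' X)) (at X)"
    using Airy_DERIV[of X] by (auto simp: has_real_derivative_iff_has_vector_derivative intro: has_vector_derivative_of_real)
  ultimately show ?thesis by (rule vector_derivative_unique_at[symmetric])
qed

text \<open>The Airy equation, read off from \<open>airy_int_rec\<close> at k = 0.\<close>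

lemma deriv_Airy_DERIV: "(Airy' has_real_derivative x * Airy x) (at x)"
proof -
  have "((\<lambda>x. - airy_int 1 1 x) has_vector_derivative airy_int 1 (Suc 1) x) (at x)"
    using has_vector_derivative_minus[OF airy_int_has_vector_derivative[of 1 1 x]] by simp
  also have "airy_int 1 (Suc 1) x = of_real (x * Airy x)"
    using airy_int_rec[of 1 0 x] Airy_eq_airy_int[of 1 x] by (simp add: numeral_2_eq_2)
  also have "(\<lambda>x. - airy_int 1 1 x) = (\<lambda>x. of_real (Airy' x))"
    using deriv_Airy_eq_airy_int[of 1] by simp
  finally have "(Airy' has_vector_derivative Re (of_real (x * Airy x))) (at x)"
    using bounded_linear.has_vector_derivative[OF bounded_linear_Re] by fastforce
  then show ?thesis by (simp add: has_real_derivative_iff_has_vector_derivative)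
qed

section \<open>Trace class operators with a Lipschitz kernel\<close>

lemma L2_norm_nonneg: "L2_norm M f \<ge> 0"
  unfolding L2_norm_def L2_inner_def by (auto intro!: integral_nonneg_AE)

lemma L2_norm_squared: "(L2_norm M f)\<^sup>2 = (\<integral>x. (f x)\<^sup>2 \<partial>M)"
  unfolding L2_norm_def L2_inner_def by (simp add: power2_eq_square integral_nonneg_AE)

lemma L2_space_mult_integrable:
  assumes "f \<in> L2_space M" "g \<in> L2_space M"
  shows "integrable M (\<lambda>x. f x * g x)"
proof (rule Bochner_Integration.integrable_bound)
  show "integrable M (\<lambda>x. (f x)\<^sup>2 + (g x)\<^sup>2)" using assms by (simp add: L2_space_def)
  have "\<bar>a * b\<bar> \<le> a\<^sup>2 + b\<^sup>2" for a b :: real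
    using sum_squares_bound[of "\<bar>a\<bar>" "\<bar>b\<bar>"] mult_nonneg_nonneg[OF abs_ge_zero[of a] abs_ge_zero[of b]]
    unfolding abs_mult power2_abs by linarith
  then show "AE x in M. norm (f x * g x) \<le> norm ((f x)\<^sup>2 + (g x)\<^sup>2)" by (simp add: abs_of_nonneg)
qed (use assms in \<open>auto simp: L2_space_def\<close>)

lemma L2_space_add:
  assumes "f \<in> L2_space M" "g \<in> L2_space M"
  shows "(\<lambda>x. f x + g x) \<in> L2_space M"
proof -
  have "integrable M (\<lambda>x. (f x)\<^sup>2 + (g x)\<^sup>2 + 2 * (f x * g x))"
    using assms L2_space_mult_integrable[OF assms] by (simp add: L2_space_def)
  then have "integrable M (\<lambda>x. (f x + g x)\<^sup>2)" by (simp add: power2_sum mult.assoc)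
  then show ?thesis using assms by (auto simp: L2_space_def)
qed

lemma L2_space_scale: "f \<in> L2_space M \<Longrightarrow> (\<lambda>x. c * f x) \<in> L2_space M"
  by (auto simp: L2_space_def power_mult_distrib)

lemma L2_norm_scale: "L2_norm M (\<lambda>x. c * f x) = \<bar>c\<bar> * L2_norm M f"
proof -
  have "(\<integral>x. c * f x * (c * f x) \<partial>M) = c\<^sup>2 * (\<integral>x. f x * f x \<partial>M)"
    by (subst integral_mult_right_zero[symmetric]) (simp add: power2_eq_square mult_ac)
  then show ?thesis by (simp add: L2_norm_def L2_inner_def real_sqrt_mult)
qed

text \<open>Cauchy-Schwarz from nonnegativity of the quadratic form of s f + t g, taken at s =
  \<open>?b\<close>, t = \<plusminus> \<open>?a\<close>. Since \<open>L2_norm\<close> is only a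
  seminorm on functions, vanishing norms form a separate case.\<close>

lemma L2_inner_le:
  assumes "f \<in> L2_space M" "g \<in> L2_space M"
  shows "\<bar>L2_inner M f g\<bar> \<le> L2_norm M f * L2_norm M g"
proof -
  let ?a = "L2_norm M f" and ?b = "L2_norm M g"
  have int: "integrable M (\<lambda>x. (f x)\<^sup>2)" "integrable M (\<lambda>x. (g x)\<^sup>2)" "integrable M (\<lambda>x. f x * g x)"
    using assms L2_space_mult_integrable[OF assms] by (auto simp: L2_space_def)
  have quad: "0 \<le> ?a\<^sup>2 * s\<^sup>2 + 2 * s * t * L2_inner M f g + ?b\<^sup>2 * t\<^sup>2" for s t
  proof -
    have "0 \<le> (\<integral>x. (s * f x + t * g x)\<^sup>2 \<partial>M)" by (intro integral_nonneg_AE) auto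
    also have "\<dots> = (\<integral>x. s\<^sup>2 * (f x)\<^sup>2 + 2 * s * t * (f x * g x) + t\<^sup>2 * (g x)\<^sup>2 \<partial>M)"
      by (intro Bochner_Integration.integral_cong) (auto simp: power2_sum power_mult_distrib)
    also have "\<dots> = s\<^sup>2 * (\<integral>x. (f x)\<^sup>2 \<partial>M) + 2 * s * t * L2_inner M f g + t\<^sup>2 * (\<integral>x. (g x)\<^sup>2 \<partial>M)"
      using int by (simp add: L2_inner_def)
    finally show ?thesis by (simp add: L2_norm_squared mult_ac)
  qed
  have a: "?a \<ge> 0" "?b \<ge> 0" by (auto simp: L2_norm_nonneg)
  have z: "L2_inner M f g = 0" if "?a = 0 \<or> ?b = 0"
  proof (rule ccontr)
    assume n: "L2_inner M f g \<noteq> 0"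
    let ?i = "L2_inner M f g"
    \<comment> \<open>If one norm vanishes, the form is affine in the corresponding variable with
      nonzero slope; the chosen value makes it - 1.\<close>
    have "?a = 0 \<Longrightarrow> False" using quad[of "- (?b\<^sup>2 + 1) / (2 * ?i)" 1] n by (simp add: field_simps)
    moreover have "?b = 0 \<Longrightarrow> False" using quad[of 1 "- (?a\<^sup>2 + 1) / (2 * ?i)"] n by (simp add: field_simps)
    ultimately show False using that by auto
  qed
  show ?thesis
  proof (cases "?a = 0 \<or> ?b = 0")
    case False
    then have ab: "?a * ?b > 0" using a by simp
    have "0 \<le> 2 * (?a * ?b) * (?a * ?b + L2_inner M f g)" "0 \<le> 2 * (?a * ?b) * (?a * ?b - L2_inner M f g)"
      using quad[of ?b ?a] quad[of ?b "- ?a"] by (simp_all add: algebra_simps power2_eq_square)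
    then have "0 \<le> ?a * ?b + L2_inner M f g" "0 \<le> ?a * ?b - L2_inner M f g"
      using ab by (auto simp: zero_le_mult_iff)
    then show ?thesis by auto
  qed (use z in auto)
qed

lemma L2_norm_add_le:
  assumes "f \<in> L2_space M" "g \<in> L2_space M"
  shows "L2_norm M (\<lambda>x. f x + g x) \<le> L2_norm M f + L2_norm M g"
proof (rule power2_le_imp_le)
  have int: "integrable M (\<lambda>x. (f x)\<^sup>2)" "integrable M (\<lambda>x. (g x)\<^sup>2)" "integrable M (\<lambda>x. f x * g x)"
    using assms L2_space_mult_integrable[OF assms] by (auto simp: L2_space_def)
  have "(L2_norm M (\<lambda>x. f x + g x))\<^sup>2 = (\<integral>x. (f x)\<^sup>2 + (g x)\<^sup>2 + 2 * (f x * g x) \<partial>M)"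
    by (simp add: L2_norm_squared power2_sum mult.assoc)
  also have "\<dots> = (L2_norm M f)\<^sup>2 + (L2_norm M g)\<^sup>2 + 2 * L2_inner M f g"
    using int by (simp add: L2_norm_squared L2_inner_def)
  also have "\<dots> \<le> (L2_norm M f + L2_norm M g)\<^sup>2"
    using L2_inner_le[OF assms] by (simp add: power2_sum)
  finally show "(L2_norm M (\<lambda>x. f x + g x))\<^sup>2 \<le> (L2_norm M f + L2_norm M g)\<^sup>2" .
qed (simp add: L2_norm_nonneg)

lemma L2_space_zero: "(\<lambda>x. 0) \<in> L2_space M" by (simp add: L2_space_def)

lemma L2_space_sum: "finite A \<Longrightarrow> (\<And>k. k \<in> A \<Longrightarrow> f k \<in> L2_space M) \<Longrightarrow> (\<lambda>x. \<Sum>k\<in>A. f k x) \<in> L2_space M"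
  by (induction A rule: finite_induct) (auto simp: L2_space_zero intro: L2_space_add)

lemma L2_norm_sum_le:
  "finite A \<Longrightarrow> (\<And>k. k \<in> A \<Longrightarrow> f k \<in> L2_space M) \<Longrightarrow> L2_norm M (\<lambda>x. \<Sum>k\<in>A. f k x) \<le> (\<Sum>k\<in>A. L2_norm M (f k))"
proof (induction A rule: finite_induct)
  case (insert a A)
  have "L2_norm M (\<lambda>x. f a x + (\<Sum>k\<in>A. f k x)) \<le> L2_norm M (f a) + L2_norm M (\<lambda>x. \<Sum>k\<in>A. f k x)"
    using insert by (intro L2_norm_add_le L2_space_sum) auto
  then show ?case using insert by fastforce
qed (simp add: L2_norm_def L2_inner_def)

text \<open>Fatou's lemma passes the finite triangle inequality to the limit.\<close>

lemma L2_norm_limit_le: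
  assumes f: "\<And>n. f n \<in> L2_space M" and B: "\<And>n. L2_norm M (f n) \<le> B"
    and lim: "\<And>x. x \<in> space M \<Longrightarrow> (\<lambda>n. f n x) \<longlonglongrightarrow> g x"
  shows "g \<in> L2_space M" "L2_norm M g \<le> B"
proof -
  have B0: "B \<ge> 0" using B[of 0] L2_norm_nonneg[of M "f 0"] by simp
  have meas [measurable]: "f n \<in> borel_measurable M" for n using f by (simp add: L2_space_def)
  have g [measurable]: "g \<in> borel_measurable M"
    by (rule borel_measurable_LIMSEQ_real[OF lim meas])
  have "(\<integral>\<^sup>+x. ennreal ((g x)\<^sup>2) \<partial>M) = (\<integral>\<^sup>+x. liminf (\<lambda>n. ennreal ((f n x)\<^sup>2)) \<partial>M)"
  proof (rule nn_integral_cong)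
    fix x assume "x \<in> space M"
    then have "(\<lambda>n. ennreal ((f n x)\<^sup>2)) \<longlonglongrightarrow> ennreal ((g x)\<^sup>2)"
      by (intro tendsto_ennrealI tendsto_power lim)
    then show "ennreal ((g x)\<^sup>2) = liminf (\<lambda>n. ennreal ((f n x)\<^sup>2))"
      by (intro lim_imp_Liminf[symmetric]) auto
  qed
  also have "\<dots> \<le> liminf (\<lambda>n. \<integral>\<^sup>+x. ennreal ((f n x)\<^sup>2) \<partial>M)"
    by (rule nn_integral_liminf) measurable
  also have "\<dots> \<le> ennreal (B\<^sup>2)"
  proof -
    have "(\<integral>\<^sup>+x. ennreal ((f n x)\<^sup>2) \<partial>M) \<le> ennreal (B\<^sup>2)" for n
    proof -
      have "(\<integral>\<^sup>+x. ennreal ((f n x)\<^sup>2) \<partial>M) = ennreal ((L2_norm M (f n))\<^sup>2)"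
        unfolding L2_norm_squared using f[of n] by (intro nn_integral_eq_integral) (auto simp: L2_space_def)
      also have "\<dots> \<le> ennreal (B\<^sup>2)" by (intro ennreal_leI power_mono B L2_norm_nonneg)
      finally show ?thesis .
    qed
    then show ?thesis by (intro Liminf_le) auto
  qed
  finally have le: "(\<integral>\<^sup>+x. ennreal ((g x)\<^sup>2) \<partial>M) \<le> ennreal (B\<^sup>2)" .
  then have int: "integrable M (\<lambda>x. (g x)\<^sup>2)"
    by (intro integrableI_bounded) (auto intro: order_le_less_trans)
  then show "g \<in> L2_space M" by (simp add: L2_space_def)
  have "ennreal ((L2_norm M g)\<^sup>2) = (\<integral>\<^sup>+x. ennreal ((g x)\<^sup>2) \<partial>M)"
    unfolding L2_norm_squared by (rule nn_integral_eq_integral[symmetric]) (use int in auto)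
  with le have "(L2_norm M g)\<^sup>2 \<le> B\<^sup>2" by (metis ennreal_le_iff zero_le_power2)
  then show "L2_norm M g \<le> B" using B0 by (rule power2_le_imp_le)
qed

text \<open>Pointwise convergence of the rank one series is enough: by the triangle inequality,
  Cauchy-Schwarz and Fatou the remainder after N terms has norm at most the norm of f times the N-th
  tail of the norm products. The case N = 0 also shows that T f lies in the space.\<close>

lemma nuclear_representationI:
  assumes u: "\<And>k. u k \<in> L2_space M" and v: "\<And>k. v k \<in> L2_space M"
    and sm: "summable (\<lambda>k. L2_norm M (u k) * L2_norm M (v k))"
    and T: "\<And>f x. f \<in> L2_space M \<Longrightarrow> x \<in> space M \<Longrightarrow> (\<lambda>k. L2_inner M (u k) f * v k x) sums T f x"
  shows "nuclear_representation M T u v" "f \<in> L2_space M \<Longrightarrow> T f \<in> L2_space M"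
proof -
  let ?a = "\<lambda>k. L2_norm M (u k) * L2_norm M (v k)"
  have tail: "(\<lambda>x. T f x - (\<Sum>k<N. L2_inner M (u k) f * v k x)) \<in> L2_space M
      \<and> L2_norm M (\<lambda>x. T f x - (\<Sum>k<N. L2_inner M (u k) f * v k x)) \<le> L2_norm M f * (\<Sum>k. ?a (k + N))"
    if f: "f \<in> L2_space M" for f N
  proof -
    let ?f = "\<lambda>n x. \<Sum>k<n. L2_inner M (u (k + N)) f * v (k + N) x"
    have 1: "?f n \<in> L2_space M" for n
      by (intro L2_space_sum L2_space_scale v) auto
    have 2: "L2_norm M (?f n) \<le> L2_norm M f * (\<Sum>k. ?a (k + N))" for n
    proof -
      have "L2_norm M (?f n) \<le> (\<Sum>k<n. L2_norm M (\<lambda>x. L2_inner M (u (k + N)) f * v (k + N) x))"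
        by (intro L2_norm_sum_le L2_space_scale v) auto
      also have "\<dots> \<le> (\<Sum>k<n. L2_norm M f * ?a (k + N))"
      proof (rule sum_mono)
        fix k
        have "\<bar>L2_inner M (u (k + N)) f\<bar> * L2_norm M (v (k + N)) \<le> L2_norm M (u (k + N)) * L2_norm M f * L2_norm M (v (k + N))"
          by (intro mult_right_mono L2_inner_le u f L2_norm_nonneg)
        then show "L2_norm M (\<lambda>x. L2_inner M (u (k + N)) f * v (k + N) x) \<le> L2_norm M f * ?a (k + N)"
          unfolding L2_norm_scale by (simp only: mult_ac)
      qed
      also have "\<dots> = L2_norm M f * (\<Sum>k<n. ?a (k + N))" by (simp add: sum_distrib_left)
      also have "\<dots> \<le> L2_norm M f * (\<Sum>k. ?a (k + N))"
        by (intro mult_left_mono sum_le_suminf L2_norm_nonneg summable_ignore_initial_segment[OF sm]) (auto simp: L2_norm_nonneg)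
      finally show ?thesis .
    qed
    have 3: "(\<lambda>n. ?f n x) \<longlonglongrightarrow> T f x - (\<Sum>k<N. L2_inner M (u k) f * v k x)" if "x \<in> space M" for x
      using sums_split_initial_segment[OF T[OF f that], of N] by (simp add: sums_def)
    from L2_norm_limit_le[of ?f, OF 1 2 3] show ?thesis by blast
  qed
  show "T f \<in> L2_space M" if "f \<in> L2_space M" for f using tail[OF that, of 0] by simp
  show "nuclear_representation M T u v" unfolding nuclear_representation_def
  proof (intro conjI ballI sm)
    fix f assume f: "f \<in> L2_space M"
    have "(\<lambda>N. \<Sum>k. ?a (k + N)) \<longlonglongrightarrow> 0" by (rule suminf_exist_split2[OF sm])
    from tendsto_mult_right_zero[OF this, of "L2_norm M f"]
    show "(\<lambda>N. L2_norm M (\<lambda>x. T f x - (\<Sum>k<N. L2_inner M (u k) f * v k x))) \<longlonglongrightarrow> 0"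
      by (rule Lim_null_comparison[rotated]) (use tail[OF f] in \<open>auto simp: L2_norm_nonneg\<close>)
  qed (use u v in auto)
qed

lemma trace_norm_le:
  assumes "nuclear_representation M T u v" "(\<Sum>k. L2_norm M (u k) * L2_norm M (v k)) \<le> C"
  shows "trace_norm M T \<le> C"
proof -
  have "trace_norm M T \<le> (\<Sum>k. L2_norm M (u k) * L2_norm M (v k))"
    unfolding trace_norm_def
  proof (rule cInf_lower)
    show "bdd_below {(\<Sum>k. L2_norm M (u k) * L2_norm M (v k)) | u v. nuclear_representation M T u v}"
      by (intro bdd_belowI[of _ 0]) (auto simp: nuclear_representation_def L2_norm_nonneg intro!: suminf_nonneg)
  qed (use assms in auto)
  with assms(2) show ?thesis by simp
qed

section \<open>Norm bounds for the factors of the rank one terms\<close>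

lemma L2_space_dominated:
  assumes "g \<in> L2_space M" "\<phi> \<in> borel_measurable M" "\<And>y. y \<in> space M \<Longrightarrow> \<bar>\<phi> y\<bar> \<le> c * g y" "c \<ge> 0"
  shows "\<phi> \<in> L2_space M" "L2_norm M \<phi> \<le> c * L2_norm M g"
proof -
  have sq: "(\<phi> y)\<^sup>2 \<le> (c * g y)\<^sup>2" if "y \<in> space M" for y
    using power_mono[OF assms(3)[OF that], of 2] by simp
  have int: "integrable M (\<lambda>y. (c * g y)\<^sup>2)" using L2_space_scale[OF assms(1), of c] by (simp add: L2_space_def)
  have int': "integrable M (\<lambda>y. (\<phi> y)\<^sup>2)"
    by (rule Bochner_Integration.integrable_bound[OF int]) (use assms(2) sq in auto)
  then show "\<phi> \<in> L2_space M" using assms(2) by (simp add: L2_space_def)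
  have "(L2_norm M \<phi>)\<^sup>2 \<le> (L2_norm M (\<lambda>y. c * g y))\<^sup>2"
    unfolding L2_norm_squared using int int' sq by (intro integral_mono) auto
  then have "L2_norm M \<phi> \<le> L2_norm M (\<lambda>y. c * g y)"
    by (rule power2_le_imp_le) (rule L2_norm_nonneg)
  then show "L2_norm M \<phi> \<le> c * L2_norm M g" using assms(4) by (simp add: L2_norm_scale)
qed

lemma L2_norm_indicator_le:
  assumes "J \<in> sets lborel" "a \<le> b"
  shows "(\<lambda>x. indicator {a..<b} x :: real) \<in> L2_space (restrict_space lborel J)"
    "L2_norm (restrict_space lborel J) (indicator {a..<b}) \<le> sqrt (b - a)"
proof -
  let ?M = "restrict_space lborel J"
  have em: "emeasure ?M ({a..<b} \<inter> J) \<le> ennreal (b - a)"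
  proof -
    have "emeasure ?M ({a..<b} \<inter> J) = emeasure lborel ({a..<b} \<inter> J)"
      using assms by (intro emeasure_restrict_space) auto
    also have "\<dots> \<le> emeasure lborel {a..<b}" by (intro emeasure_mono) auto
    also have "\<dots> = ennreal (b - a)" using assms by simp
    finally show ?thesis .
  qed
  have sets: "{a..<b} \<inter> J \<in> sets ?M" unfolding sets_restrict_space
    by (rule image_eqI[of _ _ "{a..<b}"]) (simp_all add: Int_commute)
  have sq: "(indicator {a..<b} x)\<^sup>2 = (indicator ({a..<b} \<inter> J) x :: real)" if "x \<in> space ?M" for x
    using that by (simp add: space_restrict_space indicator_def)
  have int: "integrable ?M (indicator ({a..<b} \<inter> J) :: real \<Rightarrow> real)"
    using sets em by (intro integrable_real_indicator) (auto intro: le_less_trans)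
  have "integrable ?M (\<lambda>x. (indicator {a..<b} x :: real)\<^sup>2)"
    using int by (subst Bochner_Integration.integrable_cong[OF refl sq]) auto
  then show "(\<lambda>x. indicator {a..<b} x :: real) \<in> L2_space ?M"
    by (auto simp: L2_space_def intro!: measurable_restrict_space1)
  have "(L2_norm ?M (indicator {a..<b}))\<^sup>2 = (\<integral>x. indicator ({a..<b} \<inter> J) x \<partial>?M)"
    unfolding L2_norm_squared by (intro Bochner_Integration.integral_cong[OF refl sq])
  also have "\<dots> = measure ?M ({a..<b} \<inter> J)" using sets.sets_into_space[OF sets] by (simp add: Int_absorb2)
  also have "\<dots> \<le> b - a" using em assms(2) by (simp add: measure_def enn2real_leI)
  finally show "L2_norm ?M (indicator {a..<b}) \<le> sqrt (b - a)" by (rule real_le_rsqrt)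
qed

lemma exp_neg_L2:
  assumes "J \<in> sets borel" "J \<subseteq> {s..}"
  shows "(\<lambda>y. exp (- y)) \<in> L2_space (restrict_space lborel J)"
    "L2_norm (restrict_space lborel J) (\<lambda>y. exp (- y)) \<le> exp (- s)"
proof -
  let ?M = "restrict_space lborel J"
  have 0: "((\<lambda>y::real. - exp (- (2 * y)) / 2) \<longlongrightarrow> 0) at_top" by real_asymp
  have der: "DERIV (\<lambda>y. - exp (- (2 * y)) / 2) y :> exp (- (2 * y))" for y :: real
    by (auto intro!: derivative_eq_intros)
  have nn: "(\<integral>\<^sup>+y. ennreal (exp (- (2 * y))) * indicator {s..} y \<partial>lborel) = ennreal (0 - (- exp (- (2 * s)) / 2))"
    by (rule nn_integral_FTC_atLeast[OF _ der _ 0]) auto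
  have eq: "(exp (- y))\<^sup>2 = exp (- (2 * y))" for y :: real by (simp add: exp_double[symmetric] power2_eq_square exp_add[symmetric])
  have "(\<integral>\<^sup>+y. ennreal (exp (- (2 * y))) \<partial>?M) = (\<integral>\<^sup>+y. ennreal (exp (- (2 * y))) * indicator J y \<partial>lborel)"
    using assms(1) by (intro nn_integral_restrict_space) auto
  also have "\<dots> \<le> (\<integral>\<^sup>+y. ennreal (exp (- (2 * y))) * indicator {s..} y \<partial>lborel)"
    using assms(2) by (intro nn_integral_mono) (auto split: split_indicator)
  also have "\<dots> \<le> ennreal ((exp (- s))\<^sup>2)" unfolding nn eq by (intro ennreal_leI) simp
  finally have le: "(\<integral>\<^sup>+y. ennreal ((exp (- y))\<^sup>2) \<partial>?M) \<le> ennreal ((exp (- s))\<^sup>2)" by (simp only: eq)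
  have int: "integrable ?M (\<lambda>y. (exp (- y))\<^sup>2)"
    using le by (intro integrableI_bounded) (auto intro: le_less_trans intro!: measurable_restrict_space1)
  then show "(\<lambda>y. exp (- y)) \<in> L2_space ?M"
    by (auto simp: L2_space_def intro!: measurable_restrict_space1)
  have "ennreal ((L2_norm ?M (\<lambda>y. exp (- y)))\<^sup>2) = (\<integral>\<^sup>+y. ennreal ((exp (- y))\<^sup>2) \<partial>?M)"
    unfolding L2_norm_squared by (rule nn_integral_eq_integral[symmetric]) (use int in auto)
  with le have "(L2_norm ?M (\<lambda>y. exp (- y)))\<^sup>2 \<le> (exp (- s))\<^sup>2" by (metis ennreal_le_iff zero_le_power2)
  then show "L2_norm ?M (\<lambda>y. exp (- y)) \<le> exp (- s)" by (rule power2_le_imp_le) simp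
qed

lemma has_sum_prod_decode_sums:
  fixes f :: "nat \<times> nat \<Rightarrow> real"
  assumes "(f has_sum S) UNIV"
  shows "(\<lambda>k. f (prod_decode k)) sums S"
  by (rule has_sum_imp_sums) (use assms has_sum_reindex_bij_betw[OF bij_prod_decode, of f S] in simp)

text \<open>The factor 2^-j is the Lipschitz gain over a cell at level j, its square root is the
  norm of the cell's indicator, and the exponential is the decay of the kernel at the left end of
  the parent cell, at most one cell further left, hence m - 1.\<close>

definition dyadic_weight :: "nat \<times> nat \<Rightarrow> real" where
  "dyadic_weight = (\<lambda>(j, m). (1 / 2 ^ j) * sqrt (1 / 2 ^ j) * exp (- (real m - 1) / 2 ^ j))"

text \<open>The sum over m is geometric with ratio exp (- 2^-j) and costs a factor of order 2^j.
  What remains is of order 2^(-j/2), a geometric series in j.\<close>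

lemma dyadic_weight_sums:
  obtains S where "(\<lambda>k. dyadic_weight (prod_decode k)) sums S" "S \<le> 2 * exp 1 / (1 - sqrt (1 / 2))"
proof -
  define g where "g j = (1 / 2 ^ j) * sqrt (1 / 2 ^ j) * (exp (1 / 2 ^ j) * (1 / (1 - exp (- (1 / 2 ^ j)))))" for j :: nat
  have row: "((\<lambda>m. dyadic_weight (j, m)) has_sum g j) UNIV" for j
  proof -
    let ?q = "1 / 2 ^ j :: real"
    have "(\<lambda>m. exp (- ?q) ^ m) sums (1 / (1 - exp (- ?q)))" by (intro geometric_sums) simp
    then have "(\<lambda>m. ?q * sqrt ?q * (exp ?q * exp (- ?q) ^ m)) sums g j" unfolding g_def by (intro sums_mult)
    also have "(\<lambda>m. ?q * sqrt ?q * (exp ?q * exp (- ?q) ^ m)) = (\<lambda>m. dyadic_weight (j, m))"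
      by (auto simp: dyadic_weight_def fun_eq_iff exp_of_nat_mult[symmetric] exp_add[symmetric] diff_divide_distrib)
    finally show ?thesis by (intro sums_nonneg_imp_has_sum) (auto simp: dyadic_weight_def)
  qed
  have gle: "g j \<le> 2 * exp 1 * sqrt (1 / 2) ^ j" and g0: "g j \<ge> 0" for j
  proof -
    define q where "q = (1 / 2 ^ j :: real)"
    have q: "0 < q" "q \<le> 1" by (auto simp: q_def)
    \<comment> \<open>The Lipschitz gain q = 2^-j cancels the number of cells: q / (1 - exp (- q))
      stays at most 2 on (0, 1].\<close>
    have "q * (1 / (1 - exp (- q))) = q * exp q / (exp q - 1)" using q by (simp add: exp_minus field_simps)
    also have "\<dots> \<le> 2"
    proof -
      have "exp q - 1 \<ge> q" using exp_ge_add_one_self[of q] by linarith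
      moreover have "q * exp q - q \<le> exp q - 1"
        using mult_right_mono[of q 1 "exp q - 1"] q by (simp add: right_diff_distrib)
      ultimately have "(q * exp q - q) + q \<le> (exp q - 1) + (exp q - 1)" by (intro add_mono)
      then have "q * exp q \<le> 2 * (exp q - 1)" by simp
      then show ?thesis using q by (simp add: divide_le_eq)
    qed
    finally have 1: "q * (1 / (1 - exp (- q))) \<le> 2" .
    have "g j = sqrt q * exp q * (q * (1 / (1 - exp (- q))))" by (simp add: g_def q_def)
    also have "\<dots> \<le> sqrt q * exp 1 * 2" using q 1 by (intro mult_mono) auto
    also have "sqrt q = sqrt (1 / 2) ^ j" by (simp add: q_def real_sqrt_power[symmetric] power_one_over)
    finally show "g j \<le> 2 * exp 1 * sqrt (1 / 2) ^ j" by (simp only: mult_ac)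
    show "g j \<ge> 0" using q by (auto simp: g_def q_def[symmetric] intro!: mult_nonneg_nonneg divide_nonneg_nonneg)
  qed
  have geo: "(\<lambda>j. 2 * exp 1 * sqrt (1 / 2) ^ j) sums (2 * exp 1 * (1 / (1 - sqrt (1 / 2))))"
    by (intro sums_mult geometric_sums) simp
  have sg: "summable g"
    by (rule summable_comparison_test'[OF sums_summable[OF geo], of 0]) (use gle g0 in auto)
  have "(g has_sum suminf g) UNIV"
    by (intro sums_nonneg_imp_has_sum summable_sums sg g0)
  moreover have "dyadic_weight summable_on Sigma UNIV (\<lambda>_. UNIV)"
    using row has_sum_imp_summable[OF calculation] by (rule summable_on_SigmaI) (auto simp: dyadic_weight_def)
  ultimately have "(dyadic_weight has_sum suminf g) (Sigma UNIV (\<lambda>_. UNIV))"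
    using row by (intro has_sum_SigmaI)
  then have "(\<lambda>k. dyadic_weight (prod_decode k)) sums suminf g"
    by (intro has_sum_prod_decode_sums) (simp add: UNIV_Times_UNIV)
  moreover have "suminf g \<le> 2 * exp 1 / (1 - sqrt (1 / 2))"
    using suminf_le[OF gle sg sums_summable[OF geo]] sums_unique[OF geo] by simp
  ultimately show ?thesis by (rule that)
qed

text \<open>The telescoping acts on the first variable only: \<open>v\<close> is the indicator of a
  cell in x and \<open>u\<close> carries the decay in y. The resulting bound depends on C and s
  alone, which makes the trace norm uniform in every other parameter of the kernel.\<close>

lemma trace_class_exp_Lipschitz_kernel:
  fixes E :: "real \<Rightarrow> real \<Rightarrow> real"
  assumes J: "J \<in> sets borel" "J \<subseteq> {s..}" and C: "C \<ge> 0"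
    and bound: "\<And>x y. s \<le> x \<Longrightarrow> s \<le> y \<Longrightarrow> \<bar>E x y\<bar> \<le> C * exp (- x - y)"
    and lip: "\<And>x x' y. s \<le> x \<Longrightarrow> x \<le> x' \<Longrightarrow> s \<le> y \<Longrightarrow> \<bar>E x' y - E x y\<bar> \<le> C * (x' - x) * exp (- x - y)"
    and meas: "\<And>x. s \<le> x \<Longrightarrow> E x \<in> borel_measurable borel"
  defines "M \<equiv> restrict_space lborel J"
  shows "L2_operator_kernel M E" "trace_class_operator M (integral_operator M E)"
    "trace_norm M (integral_operator M E) \<le> C * exp (- 2 * s) * (2 * exp 1 / (1 - sqrt (1 / 2)))"
proof -
  define g where "g y = exp (- y)" for y :: real
  have gL2: "g \<in> L2_space M" and gn: "L2_norm M g \<le> exp (- s)"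
    using exp_neg_L2[OF J] by (auto simp: g_def[abs_def] M_def)
  have space: "space M = J" by (simp add: M_def space_restrict_space)
  have dom: "\<phi> \<in> L2_space M \<and> L2_norm M \<phi> \<le> c * exp (- s)"
    if "\<phi> \<in> borel_measurable borel" "\<And>y. s \<le> y \<Longrightarrow> \<bar>\<phi> y\<bar> \<le> c * exp (- y)" "c \<ge> 0" for \<phi> c
  proof -
    have 1: "\<phi> \<in> borel_measurable M" using that(1) by (simp add: M_def measurable_restrict_space1)
    have 2: "\<bar>\<phi> y\<bar> \<le> c * g y" if "y \<in> space M" for y
      using \<open>\<And>y. s \<le> y \<Longrightarrow> \<bar>\<phi> y\<bar> \<le> c * exp (- y)\<close>[of y] that J by (auto simp: g_def space)
    show ?thesis
      using L2_space_dominated[OF gL2 1 2 that(3)] mult_left_mono[OF gn that(3)] by auto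
  qed
  have ExL2: "E x \<in> L2_space M" if "s \<le> x" for x
    using dom[of "E x" "C * exp (- x)"] bound[OF that] meas[OF that] C by (simp add: mult.assoc exp_add[symmetric])
  define p where "p j m = s + real m / 2 ^ j" for j m :: nat
  have ps: "p j m \<ge> s" for j m by (simp add: p_def)
  \<comment> \<open>For \<open>x\<close> in the dyadic cell \<open>[p j m, p j (m + 1))\<close>, \<open>u (j, m)\<close> is the difference between the step function
    approximations of \<open>E x\<close> at levels \<open>j\<close> and \<open>j - 1\<close>, as the parent cell has index \<open>m div 2\<close>.\<close>
  define u where "u = (\<lambda>(j, m) y. E (p j m) y - (if j = 0 then 0 else E (p (j - 1) (m div 2)) y))"
  define v where "v = (\<lambda>(j, m). indicator {p j m..<p j (Suc m)} :: real \<Rightarrow> real)"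
  have u_bound: "\<bar>u (j, m) y\<bar> \<le> C * (1 / 2 ^ j) * exp (- (real m - 1) / 2 ^ j) * exp (- s) * exp (- y)" if "s \<le> y" for j m y
  proof (cases j)
    case 0
    have "\<bar>u (j, m) y\<bar> \<le> C * exp (- p 0 m - y)" using bound[OF ps that] 0 by (simp add: u_def)
    \<comment> \<open>Level 0 would give exp (- m); it is weakened to m - 1 so that all levels share
      one weight.\<close>
    also have "\<dots> \<le> C * exp (- (real m - 1) + - s + - y)" using C by (intro mult_left_mono) (auto simp: p_def)
    finally show ?thesis using 0 by (simp only: exp_add) (simp add: mult_ac)
  next
    case (Suc i)
    have m: "real m = 2 * real (m div 2) + real (m mod 2)"
      by (metis of_nat_add of_nat_mult of_nat_numeral mult_div_mod_eq)
    have mm: "real (m mod 2) \<le> 1" by (simp add: mod_le_divisor not_less_eq_eq[symmetric] of_nat_le_1_iff)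
    \<comment> \<open>A cell with even index starts where its parent starts, a cell with odd index
      one cell width later.\<close>
    have d: "p j m - p i (m div 2) = real (m mod 2) / 2 ^ j"
      unfolding p_def Suc by (subst (1) m) (simp add: add_divide_distrib)
    have le: "p i (m div 2) \<le> p j m" "p j m - p i (m div 2) \<le> 1 / 2 ^ j"
    proof -
      have "0 \<le> real (m mod 2) / 2 ^ j" by simp
      then show "p i (m div 2) \<le> p j m" using d by linarith
      show "p j m - p i (m div 2) \<le> 1 / 2 ^ j" unfolding d using mm by (rule divide_right_mono) simp
    qed
    \<comment> \<open>The parent point may lie one cell to the left of \<open>p j m\<close>; this is
      the origin of m - 1 in the weight.\<close>
    have ge: "p i (m div 2) \<ge> s + (real m - 1) / 2 ^ j"
    proof -
      have "p i (m div 2) = p j m - real (m mod 2) / 2 ^ j" using d by simp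
      also have "\<dots> \<ge> p j m - 1 / 2 ^ j" using mm by (simp add: divide_right_mono)
      finally show ?thesis by (simp add: p_def diff_divide_distrib)
    qed
    have "\<bar>u (j, m) y\<bar> \<le> C * (p j m - p i (m div 2)) * exp (- p i (m div 2) - y)"
      using lip[OF ps le(1) that] by (simp add: u_def Suc)
    also have "\<dots> \<le> C * (1 / 2 ^ j) * exp (- (s + (real m - 1) / 2 ^ j) - y)"
      using C le ge by (intro mult_mono mult_left_mono) auto
    also have "- (s + (real m - 1) / 2 ^ j) - y = - (real m - 1) / 2 ^ j + - s + - y"
      by (simp only: minus_divide_left[symmetric])
    finally show ?thesis by (simp only: exp_add mult_ac)
  qed
  have u_meas: "u (j, m) \<in> borel_measurable borel" for j m
    unfolding u_def using meas[OF ps] by (cases "j = 0") auto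
  have uL2: "u (j, m) \<in> L2_space M" and un: "L2_norm M (u (j, m)) \<le> C * (1 / 2 ^ j) * exp (- (real m - 1) / 2 ^ j) * exp (- s) * exp (- s)" for j m
    using dom[OF u_meas u_bound, of j m] C by auto
  have vle: "p j m \<le> p j (Suc m)" and vd: "p j (Suc m) - p j m = 1 / 2 ^ j" for j m
    by (auto simp: p_def divide_right_mono add_divide_distrib)
  have vL2: "v (j, m) \<in> L2_space M" and vn: "L2_norm M (v (j, m)) \<le> sqrt (1 / 2 ^ j)" for j m
    using L2_norm_indicator_le[of J, OF _ vle[of j m]] J(1) by (auto simp: v_def M_def vd)
  have prod: "L2_norm M (u k) * L2_norm M (v k) \<le> C * exp (- 2 * s) * dyadic_weight k" for k
  proof -
    obtain j m where k: "k = (j, m)" by (cases k)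
    have "L2_norm M (u k) * L2_norm M (v k) \<le> (C * (1 / 2 ^ j) * exp (- (real m - 1) / 2 ^ j) * exp (- s) * exp (- s)) * sqrt (1 / 2 ^ j)"
      unfolding k using C by (intro mult_mono un vn L2_norm_nonneg) auto
    also have "\<dots> = C * (exp (- s) * exp (- s)) * dyadic_weight k" by (simp add: k dyadic_weight_def)
    also have "exp (- s) * exp (- s) = exp (- 2 * s)" by (simp add: exp_add[symmetric])
    finally show ?thesis .
  qed
  obtain W where W: "(\<lambda>k. dyadic_weight (prod_decode k)) sums W" "W \<le> 2 * exp 1 / (1 - sqrt (1 / 2))"
    by (rule dyadic_weight_sums)
  have CW: "(\<lambda>k. C * exp (- 2 * s) * dyadic_weight (prod_decode k)) sums (C * exp (- 2 * s) * W)"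
    by (intro sums_mult W)
  have sm: "summable (\<lambda>k. L2_norm M (u (prod_decode k)) * L2_norm M (v (prod_decode k)))"
    by (rule summable_comparison_test'[OF sums_summable[OF CW], of 0]) (use prod in \<open>auto simp: L2_norm_nonneg\<close>)
  \<comment> \<open>At fixed x each level has exactly one cell containing x, so the double series
    reduces to a telescoping series over j. Absolute summability then justifies the enumeration by
    \<open>prod_decode\<close>.\<close>
  have point: "(\<lambda>k. L2_inner M (u (prod_decode k)) f * v (prod_decode k) x) sums integral_operator M E f x"
    if f: "f \<in> L2_space M" and x: "x \<in> space M" for f x
  proof (rule has_sum_prod_decode_sums)
    have xs: "s \<le> x" using x J by (auto simp: space)
    define F where "F = L2_norm M f"
    have F0: "F \<ge> 0" by (simp add: F_def L2_norm_nonneg)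
    define \<mu> where "\<mu> j = nat \<lfloor>(x - s) * 2 ^ j\<rfloor>" for j :: nat
    have \<mu>: "real (\<mu> j) \<le> (x - s) * 2 ^ j" "(x - s) * 2 ^ j < real (\<mu> j) + 1" for j
      using xs by (auto simp: \<mu>_def)
    have pl: "p j (\<mu> j) \<le> x" "x < p j (Suc (\<mu> j))" for j
      using \<mu>[of j] by (auto simp: p_def field_simps)
    have v1: "v (j, m) x = (if m = \<mu> j then 1 else 0)" for j m
    proof -
      have "x \<in> {p j m..<p j (Suc m)} \<longleftrightarrow> real m \<le> (x - s) * 2 ^ j \<and> (x - s) * 2 ^ j < real m + 1"
        by (auto simp: p_def field_simps)
      also have "\<dots> \<longleftrightarrow> m = \<mu> j" using \<mu>[of j] by (smt (verit) of_nat_Suc of_nat_le_iff of_nat_less_iff not_less_eq_eq nat_less_le Suc_leI)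
      finally show ?thesis by (simp add: v_def indicator_def)
    qed
    \<comment> \<open>The cells containing x are nested, so the term subtracted at level j + 1 is
      the approximation at level j.\<close>
    have \<mu>_div: "\<mu> (Suc j) div 2 = \<mu> j" for j
    proof -
      have "\<lfloor>(x - s) * 2 ^ Suc j\<rfloor> div 2 = \<lfloor>(x - s) * 2 ^ j\<rfloor>"
        using floor_divide_real_eq_div[of 2 "(x - s) * 2 ^ Suc j"] by simp
      then show ?thesis using xs unfolding \<mu>_def by (metis nat_div_distrib' nat_numeral zero_le_numeral)
    qed
    define e where "e j = L2_inner M (E (p j (\<mu> j))) f" for j
    have ifE: "integrable M (\<lambda>y. E z y * f y)" if "s \<le> z" for z by (rule L2_space_mult_integrable[OF ExL2[OF that] f])
    have inner_diff: "L2_inner M (\<lambda>y. E z y - E z' y) f = L2_inner M (E z) f - L2_inner M (E z') f" if "s \<le> z" "s \<le> z'" for z z'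
      using ifE[OF that(1)] ifE[OF that(2)] by (simp add: L2_inner_def left_diff_distrib)
    have gj: "L2_inner M (u (j, \<mu> j)) f = e j - (if j = 0 then 0 else e (j - 1))" for j
    proof (cases j)
      case (Suc i)
      then show ?thesis using inner_diff[OF ps ps, of j "\<mu> j" i "\<mu> i"] by (simp add: u_def e_def \<mu>_div)
    qed (simp add: u_def e_def)
    have lim: "e \<longlonglongrightarrow> integral_operator M E f x"
    proof -
      have bd: "\<bar>e j - integral_operator M E f x\<bar> \<le> (C * exp (- s) * exp (- s) * F) * (1 / 2) ^ j" for j
      proof -
        have d: "x - p j (\<mu> j) \<le> 1 / 2 ^ j" using pl[of j] vd[of j "\<mu> j"] by linarith
        have "\<bar>E x y - E (p j (\<mu> j)) y\<bar> \<le> (C * (1 / 2 ^ j) * exp (- s)) * exp (- y)" if "s \<le> y" for y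
        proof -
          have "\<bar>E x y - E (p j (\<mu> j)) y\<bar> \<le> C * (x - p j (\<mu> j)) * exp (- p j (\<mu> j) - y)"
            by (rule lip[OF ps pl(1) that])
          also have "\<dots> \<le> C * (1 / 2 ^ j) * exp (- s + - y)"
            using C d pl(1)[of j] ps[of j "\<mu> j"] by (intro mult_mono mult_left_mono) auto
          finally show ?thesis by (simp only: exp_add mult_ac)
        qed
        from dom[OF _ this] have n: "(\<lambda>y. E x y - E (p j (\<mu> j)) y) \<in> L2_space M"
          "L2_norm M (\<lambda>y. E x y - E (p j (\<mu> j)) y) \<le> C * (1 / 2 ^ j) * exp (- s) * exp (- s)"
          using meas[OF xs] meas[OF ps, of j "\<mu> j"] C by auto
        have "\<bar>e j - integral_operator M E f x\<bar> = \<bar>L2_inner M (\<lambda>y. E x y - E (p j (\<mu> j)) y) f\<bar>"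
          unfolding inner_diff[OF xs ps] by (simp add: e_def integral_operator_def L2_inner_def abs_minus_commute)
        also have "\<dots> \<le> (C * (1 / 2 ^ j) * exp (- s) * exp (- s)) * F"
          using L2_inner_le[OF n(1) f] mult_right_mono[OF n(2) F0] unfolding F_def by linarith
        finally show ?thesis by (simp add: power_one_over mult_ac)
      qed
      have z: "(\<lambda>j. (C * exp (- s) * exp (- s) * F) * (1 / 2) ^ j) \<longlonglongrightarrow> 0"
        by (intro tendsto_mult_right_zero LIMSEQ_power_zero) simp
      have "(\<lambda>j. e j - integral_operator M E f x) \<longlonglongrightarrow> 0"
        by (rule Lim_null_comparison[OF always_eventually[OF allI] z]) (simp only: real_norm_def bd)
      then show ?thesis by (simp add: LIM_zero_iff)
    qed
    have sumg: "(\<lambda>j. L2_inner M (u (j, \<mu> j)) f) sums integral_operator M E f x"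
    proof -
      have "(\<Sum>j<Suc n. L2_inner M (u (j, \<mu> j)) f) = e n" for n
        by (induction n) (auto simp: gj)
      then have "(\<lambda>n. \<Sum>j<Suc n. L2_inner M (u (j, \<mu> j)) f) \<longlonglongrightarrow> integral_operator M E f x" using lim by simp
      then show ?thesis unfolding sums_def by (subst (asm) filterlim_sequentially_Suc)
    qed
    have ug: "\<bar>L2_inner M (u (j, \<mu> j)) f\<bar> \<le> (C * exp (- s) * exp (- s) * exp 1 * F) * (1 / 2) ^ j" for j
    proof -
      have "\<bar>L2_inner M (u (j, \<mu> j)) f\<bar> \<le> L2_norm M (u (j, \<mu> j)) * F"
        unfolding F_def by (rule L2_inner_le[OF uL2 f])
      also have "\<dots> \<le> (C * (1 / 2 ^ j) * exp (- (real (\<mu> j) - 1) / 2 ^ j) * exp (- s) * exp (- s)) * F"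
        by (intro mult_right_mono un F0)
      also have "\<dots> \<le> (C * (1 / 2 ^ j) * exp 1 * exp (- s) * exp (- s)) * F"
      proof (intro mult_right_mono mult_left_mono F0)
        have "- (real (\<mu> j) - 1) / 2 ^ j \<le> 1 / 2 ^ j" by (intro divide_right_mono) auto
        also have "\<dots> \<le> (1 :: real)" by simp
        finally show "exp (- (real (\<mu> j) - 1) / 2 ^ j) \<le> exp (1 :: real)" by simp
      qed (use C in auto)
      finally show ?thesis by (simp add: power_one_over mult_ac)
    qed
    have geo: "summable (\<lambda>j. (C * exp (- s) * exp (- s) * exp 1 * F) * (1 / 2 :: real) ^ j)"
      by (intro summable_mult summable_geometric) simp
    have absm: "summable (\<lambda>j. norm (L2_inner M (u (j, \<mu> j)) f))"
      by (rule summable_comparison_test'[OF geo, of 0]) (use ug in auto)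
    have outer: "((\<lambda>j. L2_inner M (u (j, \<mu> j)) f) has_sum integral_operator M E f x) UNIV"
      by (rule norm_summable_imp_has_sum[OF absm sumg])
    let ?h = "\<lambda>k. L2_inner M (u k) f * v k x"
    have inner: "((\<lambda>m. ?h (j, m)) has_sum L2_inner M (u (j, \<mu> j)) f) UNIV"
      and inner': "((\<lambda>m. norm (?h (j, m))) has_sum norm (L2_inner M (u (j, \<mu> j)) f)) UNIV" for j
      by (rule has_sum_finite_neutralI[of "{\<mu> j}"]; simp add: v1)+
    have "(\<lambda>k. norm (?h k)) summable_on Sigma UNIV (\<lambda>_. UNIV)"
      by (rule summable_on_SigmaI[OF inner']) (use absm in \<open>auto intro: summable_nonneg_imp_summable_on\<close>)
    then have "?h summable_on Sigma UNIV (\<lambda>_. UNIV)" by (rule abs_summable_summable)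
    then have "(?h has_sum integral_operator M E f x) (Sigma UNIV (\<lambda>_. UNIV))"
      using inner outer by (intro has_sum_SigmaI)
    then show "(?h has_sum integral_operator M E f x) UNIV" by (simp add: UNIV_Times_UNIV)
  qed
  have uL2': "u (prod_decode k) \<in> L2_space M" and vL2': "v (prod_decode k) \<in> L2_space M" for k
    using uL2 vL2 by (metis surj_pair)+
  note nuc = nuclear_representationI[of "\<lambda>k. u (prod_decode k)" M "\<lambda>k. v (prod_decode k)", OF uL2' vL2' sm point]
  show "trace_class_operator M (integral_operator M E)"
    unfolding trace_class_operator_def using nuc by blast
  show "L2_operator_kernel M E"
    unfolding L2_operator_kernel_def
  proof (intro ballI conjI nuc(2) AE_I2)
    fix f x assume "f \<in> L2_space M" "x \<in> space M"
    then show "integrable M (\<lambda>y. E x y * f y)"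
      using J by (intro L2_space_mult_integrable ExL2) (auto simp: space)
  qed
  have "(\<Sum>k. L2_norm M (u (prod_decode k)) * L2_norm M (v (prod_decode k))) \<le> C * exp (- 2 * s) * W"
    using suminf_le[OF prod sm sums_summable[OF CW]] sums_unique[OF CW] by simp
  also have "\<dots> \<le> C * exp (- 2 * s) * (2 * exp 1 / (1 - sqrt (1 / 2)))"
    using C W by (intro mult_left_mono) auto
  finally show "trace_norm M (integral_operator M E) \<le> C * exp (- 2 * s) * (2 * exp 1 / (1 - sqrt (1 / 2)))"
    using trace_norm_le[OF nuc(1)] by blast
qed

section \<open>Stirling's formula\<close>

text \<open>The difference has derivative t^3 / (1 + t). The bound serves Stirling's formula and, at
  x = h \<eta>, the modulus of the contour integrand, where n h^3 = 1 turns n x^3 / 3 into \<eta>^3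
  / 3.\<close>

lemma ln_one_plus_le_cubic:
  fixes x :: real
  assumes "x \<ge> 0"
  shows "ln (1 + x) \<le> x - x\<^sup>2 / 2 + x ^ 3 / 3"
proof -
  have "0 - 0\<^sup>2 / 2 + 0 ^ 3 / 3 - ln (1 + 0) \<le> x - x\<^sup>2 / 2 + x ^ 3 / 3 - ln (1 + x)"
  proof (rule DERIV_nonneg_imp_nondecreasing[OF assms])
    fix t :: real assume t: "0 \<le> t" "t \<le> x"
    have "((\<lambda>x. x - x\<^sup>2 / 2 + x ^ 3 / 3 - ln (1 + x)) has_real_derivative (1 - t + t\<^sup>2 - 1 / (1 + t))) (at t)"
      using t by (auto intro!: derivative_eq_intros)
    moreover have "1 - t + t\<^sup>2 - 1 / (1 + t) \<ge> 0"
    proof -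
      have "1 - t + t\<^sup>2 - 1 / (1 + t) = t ^ 3 / (1 + t)" using t by (simp add: field_simps power2_eq_square power3_eq_cube)
      then show ?thesis using t by simp
    qed
    ultimately show "\<exists>y. ((\<lambda>x. x - x\<^sup>2 / 2 + x ^ 3 / 3 - ln (1 + x)) has_real_derivative y) (at t) \<and> 0 \<le> y" by blast
  qed
  then show ?thesis by simp
qed

definition stirling_gap :: "nat \<Rightarrow> real" where
  "stirling_gap n = ln (fact n) - (real n + 1 / 2) * ln (real n) + real n"

text \<open>The decrement is (n + 1/2) ln (1 + 1/n) - 1. Bounding it by the telescoping quantity 1/n
  - 1/(n + 1) makes the gap minus 1/n increasing, which later gives the explicit error 1/n.\<close>

lemma stirling_gap_step:
  assumes "n > 0"
  shows "stirling_gap (Suc n) \<le> stirling_gap n"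
    "stirling_gap n - stirling_gap (Suc n) \<le> 1 / real n - 1 / real (Suc n)"
proof -
  let ?x = "1 / real n"
  have eq: "stirling_gap n - stirling_gap (Suc n) = (real n + 1 / 2) * ln (1 + ?x) - 1"
  proof -
    have l: "ln (1 + ?x) = ln (real (Suc n)) - ln (real n)"
    proof -
      have "1 + ?x = real (Suc n) / real n" using assms by (simp add: field_simps)
      then show ?thesis using assms by (simp only: ln_divide_pos of_nat_0_less_iff zero_less_Suc)
    qed
    then have S: "ln (real (Suc n)) = ln (1 + ?x) + ln (real n)" by linarith
    have F: "ln (fact (Suc n)) = ln (real (Suc n)) + ln (fact n)"
      using assms unfolding fact_Suc of_nat_mult of_nat_fact by (intro ln_mult_pos) auto
    show ?thesis unfolding stirling_gap_def F S by (simp add: algebra_simps)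
  qed
  \<comment> \<open>The left side is 2 x / (2 + x), the first Pade approximant of ln (1 + x). At x =
    1/n it equals 1 / (n + 1/2), so the product with n + 1/2 is exactly 1.\<close>
  have lower: "2 - 4 / (2 + x) \<le> ln (1 + x)" if "x \<ge> 0" for x :: real
  proof -
    have "ln (1 + 0) - (2 - 4 / (2 + 0)) \<le> ln (1 + x) - (2 - 4 / (2 + x))"
    proof (rule DERIV_nonneg_imp_nondecreasing[OF that])
      fix t :: real assume t: "0 \<le> t" "t \<le> x"
      have "((\<lambda>x. ln (1 + x) - (2 - 4 / (2 + x))) has_real_derivative (1 / (1 + t) - 4 / ((2 + t) * (2 + t)))) (at t)"
        using t by (auto intro!: derivative_eq_intros)
      moreover have "1 / (1 + t) - 4 / ((2 + t) * (2 + t)) \<ge> 0"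
        using t by (simp add: divide_simps) (simp add: algebra_simps)
      ultimately show "\<exists>y. ((\<lambda>x. ln (1 + x) - (2 - 4 / (2 + x))) has_real_derivative y) (at t) \<and> 0 \<le> y" by blast
    qed
    then show ?thesis by simp
  qed
  have "(real n + 1 / 2) * (2 - 4 / (2 + ?x)) = 1" using assms by (simp add: field_simps)
  moreover have "(real n + 1 / 2) * (2 - 4 / (2 + ?x)) \<le> (real n + 1 / 2) * ln (1 + ?x)"
    by (intro mult_left_mono lower) auto
  ultimately show "stirling_gap (Suc n) \<le> stirling_gap n" using eq by linarith
  have "(real n + 1 / 2) * ln (1 + ?x) \<le> (real n + 1 / 2) * (?x - ?x\<^sup>2 / 2 + ?x ^ 3 / 3)"
    by (intro mult_left_mono ln_one_plus_le_cubic) auto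
  also have "\<dots> = 1 + (1 / 12) * ?x\<^sup>2 + (1 / 6) * ?x ^ 3"
    using assms by (simp add: field_simps power2_eq_square power3_eq_cube)
  also have "\<dots> \<le> 1 + (1 / real n - 1 / real (Suc n))"
  proof -
    have n1: "real n \<ge> 1" using assms by simp
    have "(1 / 12) * ?x\<^sup>2 + (1 / 6) * ?x ^ 3 \<le> (1 / 12) * ?x\<^sup>2 + (1 / 6) * ?x ^ 2"
      using n1 by (intro add_left_mono mult_left_mono power_decreasing) auto
    also have "\<dots> \<le> 1 / real n - 1 / real (Suc n)"
      using n1 by (simp add: divide_simps power2_eq_square)
    finally show ?thesis by simp
  qed
  finally show "stirling_gap n - stirling_gap (Suc n) \<le> 1 / real n - 1 / real (Suc n)" using eq by linarith
qed

lemma wallis_product_eq: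
  "(\<Prod>k=1..n. (4 * real k ^ 2) / (4 * real k ^ 2 - 1)) = 2 ^ (4 * n) * fact n ^ 4 / (fact (2 * n) ^ 2 * (2 * real n + 1))"
proof (induction n)
  case (Suc n)
  have nz: "4 * real (Suc n) ^ 2 - 1 = (2 * real n + 1) * (2 * real n + 3)" by (simp add: power2_eq_square algebra_simps)
  have f: "fact (2 * Suc n) = (2 * real n + 2) * (2 * real n + 1) * fact (2 * n)" by (simp add: algebra_simps)
  have g: "fact (Suc n) = (real n + 1) * fact n" by (simp add: algebra_simps)
  have p: "(2::real) ^ (4 * Suc n) = 16 * 2 ^ (4 * n)" by (simp add: power_add)
  define F where "F = (fact (2 * n) :: real)"
  define P where "P = (2 :: real) ^ (4 * n)"
  define G where "G = (fact n :: real)"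
  have F: "F > 0" by (simp add: F_def)
  have pos: "2 * real n + 1 > 0" "2 * real n + 2 > 0" "2 * real n + 3 > 0" by auto
  have "(\<Prod>k=1..Suc n. (4 * real k ^ 2) / (4 * real k ^ 2 - 1)) = P * G ^ 4 / (F ^ 2 * (2 * real n + 1)) * ((4 * (real n + 1) ^ 2) / ((2 * real n + 1) * (2 * real n + 3)))"
    using Suc unfolding P_def F_def G_def by (simp add: nz[simplified] add.commute)
  also have "\<dots> = 16 * P * ((real n + 1) * G) ^ 4 / (((2 * real n + 2) * (2 * real n + 1) * F) ^ 2 * (2 * real n + 3))"
  proof -
    have e: "(2 * real n + 2) = 2 * (real n + 1)" by simp
    show ?thesis unfolding e power_mult_distrib using F pos by (simp add: divide_simps power2_eq_square) (simp add: power4_eq_xxxx)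
  qed
  finally show ?case unfolding f g p P_def F_def G_def by (simp add: add.commute)
qed simp

text \<open>Convergence follows from monotonicity. Wallis' product then identifies the limit L,
  because its logarithm is four times the gap at n minus twice the gap at 2 n, plus a term tending
  to - 2 ln 2; hence 2 L - 2 ln 2 = ln (pi / 2).\<close>

lemma stirling_gap_tendsto: "stirling_gap \<longlonglongrightarrow> ln (2 * pi) / 2"
proof -
  define d where "d n = stirling_gap (Suc n)" for n
  have "decseq d" by (rule decseq_SucI) (simp add: d_def stirling_gap_step)
  moreover have "incseq (\<lambda>n. d n - 1 / real (Suc n))"
  proof (rule incseq_SucI)
    fix n show "d n - 1 / real (Suc n) \<le> d (Suc n) - 1 / real (Suc (Suc n))"
      using stirling_gap_step(2)[of "Suc n"] unfolding d_def by linarith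
  qed
  then have "d n \<ge> d 0 - 1" for n
  proof -
    have "d 0 - 1 / real (Suc 0) \<le> d n - 1 / real (Suc n)" using incseqD[OF \<open>incseq (\<lambda>n. d n - 1 / real (Suc n))\<close>, of 0 n] by simp
    moreover have "1 / real (Suc n) \<ge> 0" by simp
    ultimately show ?thesis by (simp only: of_nat_1 One_nat_def[symmetric] div_by_1)
  qed
  ultimately obtain L where "d \<longlonglongrightarrow> L" using decseq_convergent by metis
  then have L: "stirling_gap \<longlonglongrightarrow> L" unfolding d_def filterlim_sequentially_Suc .
  have L2: "(\<lambda>n. stirling_gap (2 * n)) \<longlonglongrightarrow> L"
    using LIMSEQ_subseq_LIMSEQ[OF L, of "\<lambda>n. 2 * n"] by (simp add: o_def strict_mono_def)
  define W where "W n = (\<Prod>k=1..n. (4 * real k ^ 2) / (4 * real k ^ 2 - 1))" for n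
  have "(\<lambda>n. ln (W n)) \<longlonglongrightarrow> ln (pi / 2)" using wallis unfolding W_def by (intro tendsto_ln) auto
  moreover have "\<forall>\<^sub>F n in sequentially. ln (W n) = 4 * stirling_gap n - 2 * stirling_gap (2 * n) + (ln (real n) - ln (2 * real n + 1) - ln 2)"
    using eventually_gt_at_top[of 0]
  proof eventually_elim
    case (elim n)
    have "ln (W n) = ln (2 ^ (4 * n) * fact n ^ 4) - ln (fact (2 * n) ^ 2 * (2 * real n + 1))"
      unfolding W_def wallis_product_eq by (intro ln_divide_pos) auto
    also have "ln (2 ^ (4 * n) * (fact n :: real) ^ 4) = 4 * real n * ln 2 + 4 * ln (fact n)"
      by (simp add: ln_mult ln_realpow)
    also have "ln ((fact (2 * n) :: real) ^ 2 * (2 * real n + 1)) = 2 * ln (fact (2 * n)) + ln (2 * real n + 1)"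
    proof -
      have "2 * real n + 1 > 0" by simp
      then show ?thesis by (simp add: ln_mult_pos ln_realpow)
    qed
    finally have 1: "ln (W n) = 4 * real n * ln 2 + 4 * ln (fact n) - (2 * ln (fact (2 * n)) + ln (2 * real n + 1))" .
    have 2: "ln (real (2 * n)) = ln 2 + ln (real n)" using elim by (simp add: ln_mult_pos)
    show ?case unfolding stirling_gap_def 1 2 by (simp add: algebra_simps)
  qed
  ultimately have "(\<lambda>n. 4 * stirling_gap n - 2 * stirling_gap (2 * n) + (ln (real n) - ln (2 * real n + 1) - ln 2)) \<longlonglongrightarrow> ln (pi / 2)"
    by (rule Lim_transform_eventually)
  moreover have c: "(\<lambda>n. ln (real n) - ln (2 * real n + 1) - ln 2) \<longlonglongrightarrow> - ln 2 - ln 2" by real_asymp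
  have "(\<lambda>n. 4 * stirling_gap n - 2 * stirling_gap (2 * n) + (ln (real n) - ln (2 * real n + 1) - ln 2)) \<longlonglongrightarrow> 4 * L - 2 * L + (- ln 2 - ln 2)"
    by (rule tendsto_add[OF tendsto_diff[OF tendsto_mult[OF tendsto_const L] tendsto_mult[OF tendsto_const L2]] c])
  ultimately have "ln (pi / 2) = 4 * L - 2 * L + (- ln 2 - ln 2)" by (rule LIMSEQ_unique)
  moreover have "ln (pi / 2) = ln pi - ln 2" "ln (2 * pi) = ln 2 + ln pi" by (simp_all add: ln_div ln_mult)
  ultimately have "L = ln (2 * pi) / 2" by simp
  then show ?thesis using L by (simp only:)
qed

lemma stirling_gap_bounds:
  assumes "n > 0"
  shows "ln (2 * pi) / 2 \<le> stirling_gap n" "stirling_gap n \<le> ln (2 * pi) / 2 + 1 / real n"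
proof -
  have dec: "stirling_gap m \<le> stirling_gap n" if "m \<ge> n" for m
    using that
  proof (induction m rule: dec_induct)
    case (step m)
    then show ?case using stirling_gap_step(1)[of m] assms by simp
  qed simp
  show "ln (2 * pi) / 2 \<le> stirling_gap n"
    by (rule LIMSEQ_le_const2[OF stirling_gap_tendsto]) (use dec in blast)
  have inc: "stirling_gap n - 1 / real n \<le> stirling_gap m" if "m \<ge> n" for m
  proof -
    have "stirling_gap n - 1 / real n \<le> stirling_gap m - 1 / real m"
      using that
    proof (induction m rule: dec_induct)
      case (step m)
      then show ?case using stirling_gap_step(2)[of m] assms by simp
    qed simp
    moreover have "1 / real m \<ge> 0" by simp
    ultimately show ?thesis by linarith
  qed
  have "stirling_gap n - 1 / real n \<le> ln (2 * pi) / 2"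
    by (rule LIMSEQ_le_const[OF stirling_gap_tendsto]) (use inc in blast)
  then show "stirling_gap n \<le> ln (2 * pi) / 2 + 1 / real n" by simp
qed

text \<open>The square root of the Stirling quotient is the normalisation constant of the edge-scaled
  Hermite functions.\<close>

definition stirling_ratio :: "nat \<Rightarrow> real" where
  "stirling_ratio n = sqrt (sqrt (2 * pi * real n) * (real n ^ n * exp (- real n)) / fact n)"

text \<open>As 1/n = h^3, the normalisation constant may be replaced by 1 within the accuracy of the
  expansion.\<close>

lemma stirling_ratio_bounds:
  assumes "n > 0"
  shows "stirling_ratio n \<le> 1" "1 - 1 / real n \<le> stirling_ratio n"
proof -
  define r where "r = sqrt (2 * pi * real n) * (real n ^ n * exp (- real n)) / fact n"
  have r0: "r > 0" using assms by (simp add: r_def)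
  have lnr: "ln r = ln (2 * pi) / 2 - stirling_gap n"
  proof -
    have "ln r = ln (sqrt (2 * pi * real n)) + (ln (real n ^ n) + ln (exp (- real n))) - ln (fact n)"
      unfolding r_def using assms by (simp add: ln_divide_pos ln_mult_pos)
    also have "ln (sqrt (2 * pi * real n)) = (ln (2 * pi) + ln (real n)) / 2"
      using assms by (simp add: ln_sqrt ln_mult_pos)
    finally show ?thesis using assms by (simp add: stirling_gap_def ln_realpow field_simps)
  qed
  have "ln r \<le> 0" "ln r \<ge> - (1 / real n)" using stirling_gap_bounds[OF assms] unfolding lnr by linarith+
  then have r1: "r \<le> 1" and "exp (- (1 / real n)) \<le> exp (ln r)" using r0 by (simp_all only: ln_le_zero_iff exp_le_cancel_iff)
  moreover have "1 + - (1 / real n) \<le> exp (- (1 / real n))" by (rule exp_ge_add_one_self)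
  ultimately have r2: "1 - 1 / real n \<le> r" using r0 by simp
  show "stirling_ratio n \<le> 1" unfolding stirling_ratio_def r_def[symmetric] using r1 by simp
  have "r \<le> sqrt r" using r0 r1 by (intro real_le_rsqrt) (simp add: power2_eq_square mult_left_le)
  then show "1 - 1 / real n \<le> stirling_ratio n" unfolding stirling_ratio_def r_def[symmetric] using r2 by simp
qed

lemma stirling_ratio_pos: "n > 0 \<Longrightarrow> stirling_ratio n > 0"
  by (simp add: stirling_ratio_def)

section \<open>Hermite polynomials\<close>

text \<open>The raising operator 2 x - d/dx, equivalent to Rodrigues' formula. This form makes
  orthogonality a matter of integration by parts.\<close>

primrec hermite_rec :: "nat \<Rightarrow> real poly" where
  "hermite_rec 0 = 1"
| "hermite_rec (Suc n) = [:0, 2:] * hermite_rec n - pderiv (hermite_rec n)"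

lemma pderiv_hermite_rec: "pderiv (hermite_rec (Suc n)) = smult (2 * (real n + 1)) (hermite_rec n)"
proof (induction n)
  case (Suc n)
  define p where "p = hermite_rec n"
  define q where "q = hermite_rec (Suc n)"
  have q: "q = [:0, 2:] * p - pderiv p" by (simp add: p_def q_def)
  have IH: "pderiv q = smult (2 * (real n + 1)) p" using Suc by (simp add: p_def q_def)
  have "pderiv (hermite_rec (Suc (Suc n))) = pderiv ([:0, 2:] * q - pderiv q)" by (simp only: q_def hermite_rec.simps)
  also have "\<dots> = smult 2 q + smult (2 * (real n + 1)) ([:0, 2:] * p - pderiv p)"
    unfolding pderiv_diff pderiv_mult IH by (simp add: pderiv_pCons pderiv_smult smult_diff_right)
  also have "\<dots> = smult (2 * (real (Suc n) + 1)) q"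
    unfolding q[symmetric] by (simp add: smult_add_left[symmetric] algebra_simps)
  finally show ?case by (simp only: q_def)
qed (simp add: pderiv_pCons one_pCons)

lemma hermite_rec_three_term:
  "poly (hermite_rec (Suc (Suc n))) x = 2 * x * poly (hermite_rec (Suc n)) x - 2 * (real n + 1) * poly (hermite_rec n) x"
proof -
  have "hermite_rec (Suc (Suc n)) = [:0, 2:] * hermite_rec (Suc n) - pderiv (hermite_rec (Suc n))"
    by (rule hermite_rec.simps(2))
  then show ?thesis unfolding pderiv_hermite_rec by (simp del: hermite_rec.simps)
qed

lemma degree_hermite_rec: "degree (hermite_rec n) = n" and coeff_hermite_rec: "coeff (hermite_rec n) n = 2 ^ n"
proof -
  have "degree (hermite_rec n) = n \<and> lead_coeff (hermite_rec n) = 2 ^ n"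
  proof (induction n)
    case (Suc n)
    let ?p = "hermite_rec n"
    have nz: "?p \<noteq> 0" using Suc by auto
    have d: "degree ([:0, 2:] * ?p) = Suc n" using Suc nz by (subst degree_mult_eq) auto
    have l: "degree (- pderiv ?p) < degree ([:0, 2:] * ?p)"
      using d Suc by (simp add: degree_pderiv)
    have "degree (hermite_rec (Suc n)) = Suc n"
      unfolding hermite_rec.simps diff_conv_add_uminus degree_add_eq_left[OF l] by (rule d)
    moreover have "lead_coeff ([:0, 2:] * ?p) = 2 ^ Suc n" using Suc by (subst lead_coeff_mult) auto
    then have "lead_coeff ([:0, 2:] * ?p + - pderiv ?p) = 2 ^ Suc n"
      unfolding degree_add_eq_left[OF l] coeff_add coeff_eq_0[OF l] by (simp only: add_0_right)
    ultimately show ?case by (simp only: hermite_rec.simps diff_conv_add_uminus simp_thms)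
  qed simp
  then show "degree (hermite_rec n) = n" "coeff (hermite_rec n) n = 2 ^ n" by auto
qed

section \<open>Gaussian integrals of polynomials and uniqueness of the Hermite family\<close>

lemma poly_abs_bound:
  fixes p :: "real poly"
  shows "\<bar>poly p t\<bar> \<le> (\<Sum>i\<le>degree p. \<bar>coeff p i\<bar>) * (1 + \<bar>t\<bar>) ^ degree p"
proof -
  have "\<bar>poly p t\<bar> \<le> (\<Sum>i\<le>degree p. \<bar>coeff p i * t ^ i\<bar>)" unfolding poly_altdef by (rule sum_abs)
  also have "\<dots> \<le> (\<Sum>i\<le>degree p. \<bar>coeff p i\<bar> * (1 + \<bar>t\<bar>) ^ degree p)"
  proof (rule sum_mono)
    fix i assume i: "i \<in> {..degree p}"
    have "\<bar>t\<bar> ^ i \<le> (1 + \<bar>t\<bar>) ^ i" by (intro power_mono) auto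
    also have "\<dots> \<le> (1 + \<bar>t\<bar>) ^ degree p" using i by (intro power_increasing) auto
    finally show "\<bar>coeff p i * t ^ i\<bar> \<le> \<bar>coeff p i\<bar> * (1 + \<bar>t\<bar>) ^ degree p"
      by (simp add: abs_mult power_abs mult_left_mono)
  qed
  also have "\<dots> = (\<Sum>i\<le>degree p. \<bar>coeff p i\<bar>) * (1 + \<bar>t\<bar>) ^ degree p" by (simp add: sum_distrib_right)
  finally show ?thesis .
qed

lemma poly_gauss_norm_bound:
  fixes p :: "real poly"
  assumes "c > 0"
  shows "norm (poly p t * exp (- (c * t\<^sup>2))) \<le> (\<Sum>i\<le>degree p. \<bar>coeff p i\<bar>) * ((1 + \<bar>t\<bar>) ^ degree p * exp (- (c * t\<^sup>2)))"
  using mult_right_mono[OF poly_abs_bound[of p t], of "exp (- (c * t\<^sup>2))"] by (simp add: abs_mult mult.assoc)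

lemma poly_gauss_integrable:
  fixes p :: "real poly"
  assumes "c > 0"
  shows "integrable lborel (\<lambda>t. poly p t * exp (- (c * t\<^sup>2)))"
  by (rule integrable_gaussian_bound[OF assms borel_measurable_continuous_lborel poly_gauss_norm_bound[OF assms]])
    (intro continuous_intros)

definition gauss_int :: "real poly \<Rightarrow> real" where
  "gauss_int p = (\<integral>x. poly p x * exp (- x\<^sup>2) \<partial>lborel)"

lemma gauss_integrable: "integrable lborel (\<lambda>x. poly (p :: real poly) x * exp (- x\<^sup>2))"
  using poly_gauss_integrable[of 1 p] by simp

lemma gauss_int_smult: "gauss_int (smult c p) = c * gauss_int p"
  by (simp add: gauss_int_def mult.assoc)

lemma gauss_int_diff: "gauss_int (p - q) = gauss_int p - gauss_int q"
  using gauss_integrable[of p] gauss_integrable[of q] by (simp add: gauss_int_def left_diff_distrib)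

lemma gauss_int_by_parts: "gauss_int (pderiv p - [:0, 2:] * p) = 0"
proof -
  have "(\<integral>t. poly (pderiv p - [:0, 2:] * p) t * exp (- t\<^sup>2) \<partial>lborel) = 0"
  proof (rule integral_derivative_eq_0[where F="\<lambda>t. poly p t * exp (- t\<^sup>2)"])
    show "((\<lambda>t. poly p t * exp (- t\<^sup>2)) has_vector_derivative poly (pderiv p - [:0, 2:] * p) t * exp (- t\<^sup>2)) (at t)" for t
      unfolding has_real_derivative_iff_has_vector_derivative[symmetric]
      by (auto intro!: derivative_eq_intros poly_DERIV simp: algebra_simps)
    show "norm (poly p t * exp (- t\<^sup>2)) \<le> (\<Sum>i\<le>degree p. \<bar>coeff p i\<bar>) * ((1 + \<bar>t\<bar>) ^ degree p * exp (- (1 * t\<^sup>2)))" for t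
      using poly_gauss_norm_bound[of 1 p t] by simp
    show "continuous_on UNIV (\<lambda>t. poly (pderiv p - [:0, 2:] * p) t * exp (- t\<^sup>2))" by (intro continuous_intros)
  qed (rule gauss_integrable zero_less_one)+
  then show ?thesis by (simp only: gauss_int_def)
qed

text \<open>For the weight exp (- x^2) the raising operator is the adjoint of
  differentiation.\<close>

lemma gauss_int_hermite_Suc: "gauss_int (p * hermite_rec (Suc n)) = gauss_int (pderiv p * hermite_rec n)"
proof -
  have "pderiv p * hermite_rec n - p * hermite_rec (Suc n) = pderiv (p * hermite_rec n) - [:0, 2:] * (p * hermite_rec n)"
    by (simp only: pderiv_mult hermite_rec.simps) (simp only: algebra_simps)
  then have "gauss_int (pderiv p * hermite_rec n - p * hermite_rec (Suc n)) = 0"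
    using gauss_int_by_parts by metis
  then show ?thesis by (simp add: gauss_int_diff del: hermite_rec.simps)
qed

text \<open>Each adjoint step trades one index of the Hermite polynomial for one derivative of p,
  and p is exhausted first. The alternative p = 0 is carried along because the zero polynomial has
  degree 0.\<close>

lemma gauss_int_hermite_orthogonal: "p = 0 \<or> degree p < n \<Longrightarrow> gauss_int (p * hermite_rec n) = 0"
proof (induction n arbitrary: p)
  case 0
  then show ?case by (simp add: gauss_int_def)
next
  case (Suc n)
  have "pderiv p = 0 \<or> degree (pderiv p) < n"
    using Suc.prems by (cases "degree p") (auto simp: degree_pderiv pderiv_eq_0_iff)
  then show ?case unfolding gauss_int_hermite_Suc by (rule Suc.IH)
qed

lemma hermite_family_iff_gauss_int:
  "hermite_family H \<longleftrightarrow> (\<forall>n. degree (H n) = n \<and> lead_coeff (H n) = 2 ^ n) \<and> (\<forall>m n. m \<noteq> n \<longrightarrow> gauss_int (H m * H n) = 0)"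
  by (simp add: hermite_family_def gauss_int_def)

lemma hermite_family_hermite_rec: "hermite_family hermite_rec"
  unfolding hermite_family_iff_gauss_int
proof (intro conjI allI impI)
  fix m n :: nat assume "m \<noteq> n"
  then consider "m < n" | "n < m" by linarith
  then show "gauss_int (hermite_rec m * hermite_rec n) = 0"
  proof cases
    case 1
    then show ?thesis by (intro gauss_int_hermite_orthogonal) (simp add: degree_hermite_rec)
  next
    case 2
    then show ?thesis by (subst mult.commute, intro gauss_int_hermite_orthogonal) (simp add: degree_hermite_rec)
  qed
qed (simp_all add: degree_hermite_rec coeff_hermite_rec)

lemma degree_cancel_lead_less:
  fixes p q :: "real poly"
  assumes "degree p \<le> n" "degree q \<le> n" "coeff p n = coeff q n"
  shows "p - q = 0 \<or> degree (p - q) < n"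
proof (cases "p - q = 0")
  case False
  have "degree (p - q) \<le> n" using assms by (intro degree_diff_le)
  moreover have "coeff (p - q) n = 0" using assms by simp
  ultimately show ?thesis using False by (metis leading_coeff_0_iff le_neq_implies_less)
qed simp

text \<open>A multiple of the member of degree k removes the leading term of p, and induction on the
  degree handles the rest. This covers an arbitrary family, as the uniqueness argument
  requires.\<close>

lemma hermite_family_orthogonal:
  assumes "hermite_family H" "p = 0 \<or> degree p < n"
  shows "gauss_int (p * H n) = 0"
  using assms(2)
proof (induction "degree p" arbitrary: p rule: less_induct)
  case less
  note H = assms(1)[unfolded hermite_family_iff_gauss_int]
  show ?case
  proof (cases "p = 0")
    case False
    define k where "k = degree p"
    define q where "q = smult (lead_coeff p / 2 ^ k) (H k)"
    have k: "k < n" using less.prems False by (simp add: k_def)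
    have dH: "degree (H k) = k" "coeff (H k) k = 2 ^ k" using H by metis+
    have dq: "degree q \<le> k" using dH by (simp add: q_def)
    have r: "p - q = 0 \<or> degree (p - q) < k"
      by (rule degree_cancel_lead_less) (use dq dH in \<open>auto simp: k_def[symmetric] q_def\<close>)
    have "gauss_int ((p - q) * H n) = 0"
    proof (cases "p - q = 0")
      case nz: False
      then show ?thesis using r k by (intro less.hyps) (auto simp: k_def)
    qed (simp add: gauss_int_def)
    moreover have "gauss_int (q * H n) = 0"
      using H k by (simp add: q_def gauss_int_smult)
    ultimately show ?thesis by (simp add: left_diff_distrib gauss_int_diff)
  qed (simp add: gauss_int_def)
qed

lemma gauss_int_square_eq_0:
  assumes "gauss_int (d * d) = 0"
  shows "d = 0"
proof (rule ccontr)
  assume d: "d \<noteq> 0"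
  have "AE x in lborel. poly (d * d) x * exp (- x\<^sup>2) = 0"
    using assms gauss_integrable[of "d * d"] unfolding gauss_int_def
    by (subst (asm) integral_nonneg_eq_0_iff_AE) auto
  moreover have "AE x in lborel. x \<notin> {x. poly d x = 0}"
    using poly_roots_finite[OF d] by (intro AE_not_in finite_imp_null_set_lborel)
  ultimately have "AE x::real in lborel. False" by eventually_elim auto
  then show False using AE_iff_measurable[of UNIV lborel "\<lambda>x::real. False"] by simp
qed

text \<open>Equal leading coefficients leave a difference of lower degree; it is orthogonal to both
  polynomials of index n, hence to itself, and the weight is positive.\<close>

lemma hermite_poly_eq: "hermite_poly = hermite_rec"
  unfolding hermite_poly_def
proof (rule the_equality[where P=hermite_family, OF hermite_family_hermite_rec])
  fix H assume H: "hermite_family H"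
  show "H = hermite_rec"
  proof
    fix n
    have dH: "degree (H n) = n" "coeff (H n) n = 2 ^ n" using H unfolding hermite_family_def by metis+
    let ?d = "H n - hermite_rec n"
    have d: "?d = 0 \<or> degree ?d < n"
      by (rule degree_cancel_lead_less) (use dH in \<open>auto simp: degree_hermite_rec coeff_hermite_rec\<close>)
    have "gauss_int (?d * ?d) = 0"
      using hermite_family_orthogonal[OF H d] gauss_int_hermite_orthogonal[OF d]
      by (simp add: right_diff_distrib[of ?d] gauss_int_diff)
    then show "H n = hermite_rec n" using gauss_int_square_eq_0 by force
  qed
qed

text \<open>This is the characteristic function of the standard normal distribution at sqrt 2 a,
  with t rescaled by sqrt 2. That the value does not depend on a is the base case of the free choice
  of contour.\<close>

lemma gaussian_line_integral:
  "(\<integral>t. exp ((Complex a t)\<^sup>2) \<partial>lborel) = complex_of_real (sqrt pi)"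
proof -
  have "complex_of_real (exp (- (a\<^sup>2))) = char std_normal_distribution (sqrt 2 * a)"
    unfolding char_std_normal_distribution by (simp add: power_mult_distrib)
  also have "\<dots> = (\<integral>x. std_normal_density x *\<^sub>R iexp (sqrt 2 * a * x) \<partial>lborel)"
    unfolding char_def by (subst integral_density) (auto simp: normal_density_nonneg)
  also have "\<dots> = sqrt 2 *\<^sub>R (\<integral>t. std_normal_density (sqrt 2 * t) *\<^sub>R iexp (sqrt 2 * a * (sqrt 2 * t)) \<partial>lborel)"
    by (subst lborel_integral_real_affine[of "sqrt 2" _ 0]) auto
  also have "(\<lambda>t. std_normal_density (sqrt 2 * t) *\<^sub>R iexp (sqrt 2 * a * (sqrt 2 * t))) =
      (\<lambda>t. (1 / sqrt (2 * pi) * exp (- (a\<^sup>2))) *\<^sub>R exp ((Complex a t)\<^sup>2))"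
  proof
    fix t
    have "exp ((Complex a t)\<^sup>2) = complex_of_real (exp (a\<^sup>2)) * (complex_of_real (exp (- t\<^sup>2)) * iexp (sqrt 2 * a * (sqrt 2 * t)))"
      unfolding exp_of_real[symmetric] exp_add[symmetric]
      by (intro arg_cong[of _ _ exp]) (simp add: complex_eq_iff power2_eq_square)
    moreover have "std_normal_density (sqrt 2 * t) = 1 / sqrt (2 * pi) * exp (- t\<^sup>2)"
      by (simp add: std_normal_density_def power_mult_distrib)
    ultimately show "std_normal_density (sqrt 2 * t) *\<^sub>R iexp (sqrt 2 * a * (sqrt 2 * t)) = (1 / sqrt (2 * pi) * exp (- (a\<^sup>2))) *\<^sub>R exp ((Complex a t)\<^sup>2)"
      by (simp add: scaleR_conv_of_real exp_minus mult_ac flip: of_real_mult)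
  qed
  finally have "complex_of_real (exp (- (a\<^sup>2))) = of_real (sqrt 2 * (1 / sqrt (2 * pi)) * exp (- (a\<^sup>2))) * (\<integral>t. exp ((Complex a t)\<^sup>2) \<partial>lborel)"
    by (simp add: scaleR_conv_of_real mult.assoc)
  also have "sqrt 2 * (1 / sqrt (2 * pi)) = 1 / sqrt pi" by (simp add: real_sqrt_mult)
  finally show ?thesis by (simp add: field_simps)
qed

section \<open>Contour integral for the Hermite polynomials\<close>

lemma norm_hermite_integrand:
  "norm (Complex \<sigma> t ^ n * exp ((Complex \<sigma> t - of_real x)\<^sup>2)) \<le> exp ((\<sigma> - x)\<^sup>2) * ((\<bar>\<sigma>\<bar> + \<bar>t\<bar>) ^ n * exp (- (1 * t\<^sup>2)))"
proof -
  have 1: "norm (Complex \<sigma> t) \<le> \<bar>\<sigma>\<bar> + \<bar>t\<bar>" using cmod_le[of "Complex \<sigma> t"] by simp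
  have 2: "norm (exp ((Complex \<sigma> t - of_real x)\<^sup>2)) = exp ((\<sigma> - x)\<^sup>2) * exp (- (1 * t\<^sup>2))"
    by (simp add: power2_eq_square exp_add[symmetric])
  show ?thesis unfolding norm_mult 2 norm_power
    using power_mono[OF 1, of n] by (simp add: mult_ac mult_right_mono)
qed

lemma hermite_integrand_integrable:
  "integrable lborel (\<lambda>t. Complex \<sigma> t ^ n * exp ((Complex \<sigma> t - of_real x)\<^sup>2))"
  by (rule integrable_gaussian_bound[OF zero_less_one borel_measurable_continuous_lborel norm_hermite_integrand])
    (intro continuous_intros)

lemma hermite_integral_rec:
  fixes \<sigma> x :: real and I :: "nat \<Rightarrow> complex"
  defines "I \<equiv> \<lambda>n::nat. (\<integral>t. Complex \<sigma> t ^ n * exp ((Complex \<sigma> t - of_real x)\<^sup>2) \<partial>lborel) :: complex"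
  shows "I (Suc n) = of_real x * I n - of_nat n / 2 * I (n - 1)"
proof -
  let ?g = "\<lambda>k t. Complex \<sigma> t ^ k * exp ((Complex \<sigma> t - of_real x)\<^sup>2)"
  let ?f = "\<lambda>t. \<i> * (of_nat n * ?g (n - 1) t + 2 * ?g (Suc n) t - 2 * x * ?g n t)"
  have int: "integrable lborel ?f"
    by (intro integrable_mult_right Bochner_Integration.integrable_diff Bochner_Integration.integrable_add hermite_integrand_integrable)
  have "(\<integral>t. ?f t \<partial>lborel) = 0"
  proof (rule integral_derivative_eq_0[OF _ _ int zero_less_one norm_hermite_integrand[of \<sigma> _ n x]])
    fix t
    have "((\<lambda>z::complex. z ^ n * exp ((z - of_real x)\<^sup>2)) has_field_derivative
       (of_nat n * w ^ (n - 1) + w ^ n * (2 * (w - x))) * exp ((w - of_real x)\<^sup>2)) (at w)" for w :: complex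
      by (auto intro!: derivative_eq_intros simp: algebra_simps)
    from field_vector_diff_chain_at[OF has_vector_derivative_Complex_line[of \<sigma> t] this]
    show "(?g n has_vector_derivative ?f t) (at t)"
      by (simp add: o_def algebra_simps)
    show "continuous_on UNIV ?f" by (intro continuous_intros)
  qed
  also have "(\<integral>t. ?f t \<partial>lborel) = \<i> * (of_nat n * I (n - 1) + 2 * I (Suc n) - 2 * x * I n)"
    unfolding I_def
    by (simp only: integral_mult_right_zero Bochner_Integration.integral_diff Bochner_Integration.integral_add Bochner_Integration.integrable_add integrable_mult_right hermite_integrand_integrable)
  finally have eq: "\<i> * (of_nat n * I (n - 1) + 2 * I (Suc n) - 2 * x * I n) = 0" .
  have "\<i> * (a + 2 * b - c) = 0 \<Longrightarrow> b = c / 2 - a / 2" for a b c :: complex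
  proof -
    assume "\<i> * (a + 2 * b - c) = 0"
    then have "a + 2 * b - c = 0" by simp
    then show "b = c / 2 - a / 2" by (simp add: field_simps)
  qed
  from this[OF eq] show ?thesis by simp
qed

text \<open>Both sides satisfy the same three-term recurrence and agree for n = 0 and n = 1. The
  argument holds on every line, so independence of \<sigma> comes without Cauchy's theorem.\<close>

lemma hermite_integral_representation:
  "complex_of_real (poly (hermite_rec n) x) = 2 ^ n / sqrt pi * (\<integral>t. Complex \<sigma> t ^ n * exp ((Complex \<sigma> t - of_real x)\<^sup>2) \<partial>lborel)"
proof -
  define I where "I n = (\<integral>t. Complex \<sigma> t ^ n * exp ((Complex \<sigma> t - of_real x)\<^sup>2) \<partial>lborel)" for n
  have rec: "I (Suc n) = x * I n - of_nat n / 2 * I (n - 1)" for n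
    unfolding I_def by (rule hermite_integral_rec)
  have I0: "I 0 = of_real (sqrt pi)"
  proof -
    have "Complex \<sigma> t - of_real x = Complex (\<sigma> - x) t" for t by (simp add: complex_eq_iff)
    then show ?thesis by (simp add: I_def gaussian_line_integral)
  qed
  have pi: "complex_of_real (sqrt pi) \<noteq> 0" by simp
  have "complex_of_real (poly (hermite_rec n) x) = 2 ^ n / sqrt pi * I n"
  proof (induction n rule: induct_nat_012)
    case 0
    then show ?case using I0 pi by simp
  next
    case 1
    then show ?case using I0 pi rec[of 0] by simp
  next
    case (ge2 n)
    then show ?case unfolding hermite_rec_three_term rec[of "Suc n"]
      by (simp add: field_simps del: hermite_rec.simps)
  qed
  then show ?thesis by (simp only: I_def)
qed

section \<open>Hermite functions in edge scaling\<close>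

definition hermite_norm :: "nat \<Rightarrow> real" where
  "hermite_norm n = (2 ^ n * fact n * sqrt pi) powr (- 1 / 2)"

text \<open>One of the two ladder relations taken as definition, so that later identities are
  algebraic; \<open>hermite_fun_DERIV\<close> shows that it is the derivative.\<close>

definition hermite_fun_deriv :: "nat \<Rightarrow> real \<Rightarrow> real" where
  "hermite_fun_deriv n x = x * hermite_fun n x - sqrt (2 * (real n + 1)) * hermite_fun (Suc n) x"

lemma hermite_fun_eq: "hermite_fun n x = hermite_norm n * poly (hermite_rec n) x * exp (- x\<^sup>2 / 2)"
  by (simp add: hermite_fun_def hermite_norm_def hermite_poly_eq)

lemma hermite_norm_pos: "hermite_norm n > 0"
  by (simp add: hermite_norm_def)

lemma hermite_norm_Suc: "hermite_norm n = sqrt (2 * (real n + 1)) * hermite_norm (Suc n)"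
proof -
  let ?A = "2 ^ n * fact n * sqrt pi" and ?c = "2 * (real n + 1)"
  have "hermite_norm (Suc n) = (?c * ?A) powr (- 1 / 2)"
    unfolding hermite_norm_def by (intro arg_cong2[of _ _ _ _ "(powr)"]) (simp_all add: algebra_simps)
  also have "\<dots> = ?c powr (- 1 / 2) * ?A powr (- 1 / 2)" by (rule powr_mult)
  also have "?c powr (- 1 / 2) = 1 / sqrt ?c"
    by (simp add: powr_minus_divide powr_half_sqrt)
  finally show ?thesis by (simp add: hermite_norm_def)
qed

lemma hermite_fun_deriv_eq:
  "hermite_fun_deriv n x = hermite_norm n * (x * poly (hermite_rec n) x - poly (hermite_rec (Suc n)) x) * exp (- x\<^sup>2 / 2)"
proof -
  have "sqrt (2 * (real n + 1)) * hermite_fun (Suc n) x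
      = (sqrt (2 * (real n + 1)) * hermite_norm (Suc n)) * (poly (hermite_rec (Suc n)) x * exp (- x\<^sup>2 / 2))"
    by (simp only: hermite_fun_eq mult_ac)
  then have "sqrt (2 * (real n + 1)) * hermite_fun (Suc n) x = hermite_norm n * (poly (hermite_rec (Suc n)) x * exp (- x\<^sup>2 / 2))"
    by (simp only: hermite_norm_Suc[of n, symmetric])
  then show ?thesis unfolding hermite_fun_deriv_def
    by (simp only: hermite_fun_eq[of n] right_diff_distrib left_diff_distrib mult_ac)
qed

lemma hermite_fun_deriv_Suc:
  "hermite_fun_deriv (Suc n) x = sqrt (2 * (real n + 1)) * hermite_fun n x - x * hermite_fun (Suc n) x"
proof -
  let ?c = "sqrt (2 * (real n + 1))"
  have "?c * hermite_norm n = (?c * ?c) * hermite_norm (Suc n)"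
    by (subst hermite_norm_Suc[of n]) (simp only: mult.assoc)
  also have "?c * ?c = 2 * (real n + 1)" by simp
  finally have N: "?c * hermite_norm n = 2 * (real n + 1) * hermite_norm (Suc n)" .
  have "?c * hermite_fun n x = (?c * hermite_norm n) * (poly (hermite_rec n) x * exp (- x\<^sup>2 / 2))"
    by (simp only: hermite_fun_eq mult_ac)
  then show ?thesis unfolding N hermite_fun_deriv_eq hermite_rec_three_term
    by (simp add: hermite_fun_eq algebra_simps del: hermite_rec.simps)
qed

lemma hermite_fun_deriv_0: "hermite_fun_deriv 0 x = - x * hermite_fun 0 x"
  by (simp add: hermite_fun_deriv_eq hermite_fun_eq)

lemma hermite_fun_DERIV: "(hermite_fun n has_real_derivative hermite_fun_deriv n x) (at x)"
proof -
  have "((\<lambda>x. hermite_norm n * poly (hermite_rec n) x * exp (- x\<^sup>2 / 2)) has_real_derivative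
      hermite_norm n * (poly (pderiv (hermite_rec n)) x * exp (- x\<^sup>2 / 2) + poly (hermite_rec n) x * (exp (- x\<^sup>2 / 2) * (- x)))) (at x)"
    by (auto intro!: derivative_eq_intros poly_DERIV simp: algebra_simps)
  moreover have "poly (pderiv (hermite_rec n)) x = 2 * x * poly (hermite_rec n) x - poly (hermite_rec (Suc n)) x"
    by simp
  ultimately show ?thesis unfolding hermite_fun_deriv_eq hermite_fun_eq[abs_def]
    by (simp add: algebra_simps del: hermite_rec.simps)
qed

text \<open>The harmonic oscillator equation, obtained by combining both ladder relations.\<close>

lemma hermite_fun_deriv_DERIV:
  "(hermite_fun_deriv n has_real_derivative (x\<^sup>2 - 2 * real n - 1) * hermite_fun n x) (at x)"
proof -
  define c where "c = sqrt (2 * (real n + 1))"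
  have c2: "c * c = 2 * (real n + 1)" by (simp add: c_def)
  have "((\<lambda>x. x * hermite_fun n x - c * hermite_fun (Suc n) x) has_real_derivative
     (1 * hermite_fun n x + hermite_fun_deriv n x * x - c * hermite_fun_deriv (Suc n) x)) (at x)"
    by (intro DERIV_diff DERIV_mult DERIV_cmult DERIV_ident hermite_fun_DERIV)
  moreover have "1 * hermite_fun n x + hermite_fun_deriv n x * x - c * hermite_fun_deriv (Suc n) x = (x\<^sup>2 - 2 * real n - 1) * hermite_fun n x"
  proof -
    have "c * hermite_fun_deriv (Suc n) x = (c * c) * hermite_fun n x - x * (c * hermite_fun (Suc n) x)"
      unfolding hermite_fun_deriv_Suc c_def[symmetric] by (simp only: right_diff_distrib mult_ac)
    moreover have "c * hermite_fun (Suc n) x = x * hermite_fun n x - hermite_fun_deriv n x"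
      by (simp add: hermite_fun_deriv_def c_def)
    ultimately show ?thesis unfolding c2 by (simp add: algebra_simps power2_eq_square)
  qed
  ultimately show ?thesis unfolding hermite_fun_deriv_def[abs_def] c_def by simp
qed

text \<open>In the usual form the right side is - sqrt (n / 2) times the symmetrised product of the
  functions of index n and n - 1. Eliminating the latter by the ladder relation also gives the case
  n = 0 a meaning, and the induction step is the ladder relation once more.\<close>

lemma hermite_kernel_diagonal_DERIV:
  "((\<lambda>t. hermite_kernel n (x + t) (y + t)) has_real_derivative
     - (hermite_fun n (x + t) * hermite_fun_deriv n (y + t) + hermite_fun_deriv n (x + t) * hermite_fun n (y + t)
        + ((x + t) + (y + t)) * hermite_fun n (x + t) * hermite_fun n (y + t)) / 2) (at t)"
proof (induction n)
  case 0
  then show ?case by (simp add: hermite_kernel_def hermite_fun_deriv_0 algebra_simps)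
next
  case (Suc n)
  define a where "a = x + t"
  define b where "b = y + t"
  have d: "((\<lambda>t. hermite_fun n (z + t)) has_real_derivative hermite_fun_deriv n (z + t)) (at t)" for z
  proof -
    have "((\<lambda>t. z + t) has_real_derivative 1) (at t)" by (auto intro!: derivative_eq_intros)
    from DERIV_chain2[OF hermite_fun_DERIV this] show ?thesis by simp
  qed
  have "((\<lambda>t. hermite_kernel n (x + t) (y + t) + hermite_fun n (x + t) * hermite_fun n (y + t)) has_real_derivative
    - (hermite_fun n a * hermite_fun_deriv n b + hermite_fun_deriv n a * hermite_fun n b
        + (a + b) * hermite_fun n a * hermite_fun n b) / 2 + (hermite_fun_deriv n a * hermite_fun n b + hermite_fun_deriv n b * hermite_fun n a)) (at t)"
    unfolding a_def b_def by (rule DERIV_add[OF Suc DERIV_mult[OF d d]])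
  moreover have "- (hermite_fun n a * hermite_fun_deriv n b + hermite_fun_deriv n a * hermite_fun n b
        + (a + b) * hermite_fun n a * hermite_fun n b) / 2 + (hermite_fun_deriv n a * hermite_fun n b + hermite_fun_deriv n b * hermite_fun n a)
     = - (hermite_fun (Suc n) a * hermite_fun_deriv (Suc n) b + hermite_fun_deriv (Suc n) a * hermite_fun (Suc n) b
        + (a + b) * hermite_fun (Suc n) a * hermite_fun (Suc n) b) / 2" (is "?l = ?r")
  proof -
    let ?c = "sqrt (2 * (real n + 1))"
    have r: "?r = - ((?c * hermite_fun (Suc n) a) * hermite_fun n b + hermite_fun n a * (?c * hermite_fun (Suc n) b)) / 2"
      by (simp add: hermite_fun_deriv_Suc algebra_simps)
    have e: "?c * hermite_fun (Suc n) z = z * hermite_fun n z - hermite_fun_deriv n z" for z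
      by (simp add: hermite_fun_deriv_def)
    show ?thesis unfolding r e by (simp add: field_simps)
  qed
  ultimately show ?case unfolding a_def b_def by (simp only: hermite_kernel_def sum.lessThan_Suc)
qed

section \<open>Scaling constants and the Hermite functions in edge coordinates\<close>

definition edge_h :: "nat \<Rightarrow> real" where "edge_h n = real n powr (- 1 / 3)"

text \<open>The reciprocal of the classical amplitude 2^(1/4) n^(-1/12) at the edge, so that
  \<open>edge_fun\<close> tends to Ai.\<close>

definition edge_scale :: "nat \<Rightarrow> real" where "edge_scale n = 2 powr (- 1 / 4) * real n powr (1 / 12)"

lemma edge_h_pos: "n > 0 \<Longrightarrow> edge_h n > 0" by (simp add: edge_h_def)

lemma edge_jacobian_pos: "n > 0 \<Longrightarrow> edge_jacobian n > 0" by (simp add: edge_jacobian_def)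

lemma edge_scale_pos: "n > 0 \<Longrightarrow> edge_scale n > 0" by (simp add: edge_scale_def)

lemma edge_h_power: "n > 0 \<Longrightarrow> edge_h n ^ k = real n powr (- real k / 3)"
  by (simp add: edge_h_def powr_power)

lemma edge_h_cube: "n > 0 \<Longrightarrow> real n * edge_h n ^ 3 = 1"
  by (simp add: edge_h_power powr_minus)

lemma powr_square: "((x::real) powr a)\<^sup>2 = x powr (2 * a)"
  unfolding power2_eq_square powr_add[symmetric] by simp

text \<open>With j the Jacobian and \<alpha> the scale, the relations j^2 = h / 2, j = h \<alpha>^2,
  h j sqrt (2 n) = 1 and n h^3 = 1 reduce the scaled equations to polynomial algebra.\<close>

lemma edge_jacobian_square: "n > 0 \<Longrightarrow> (edge_jacobian n)\<^sup>2 = edge_h n / 2"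
proof -
  assume n: "n > 0"
  have "(edge_jacobian n)\<^sup>2 = 2 powr (- 1) * real n powr (- 1 / 3)"
    unfolding edge_jacobian_def power_mult_distrib powr_square by simp
  then show ?thesis by (simp add: edge_h_def powr_minus_divide)
qed

lemma edge_jacobian_eq: "n > 0 \<Longrightarrow> edge_jacobian n = edge_h n * (edge_scale n)\<^sup>2"
proof -
  have "edge_h n * (edge_scale n)\<^sup>2 = 2 powr (2 * (- 1 / 4)) * (real n powr (- 1 / 3) * real n powr (2 * (1 / 12)))"
    unfolding edge_h_def edge_scale_def power_mult_distrib powr_square by (rule mult.left_commute)
  then show ?thesis unfolding edge_jacobian_def powr_add[symmetric] by simp
qed

lemma edge_jacobian_sqrt: "n > 0 \<Longrightarrow> edge_h n * edge_jacobian n * sqrt (2 * real n) = 1"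
proof -
  assume n: "n > 0"
  have "sqrt (2 * real n) = 2 powr (1 / 2) * real n powr (1 / 2)"
    by (simp add: powr_half_sqrt real_sqrt_mult)
  then have "edge_h n * edge_jacobian n * sqrt (2 * real n) = (2 powr (- 1 / 2) * 2 powr (1 / 2)) * (real n powr (- 1 / 3) * real n powr (- 1 / 6) * real n powr (1 / 2))"
    by (simp only: edge_h_def edge_jacobian_def mult_ac)
  also have "\<dots> = 1" using n by (simp only: powr_add[symmetric]) simp
  finally show ?thesis .
qed

lemma edge_point_0: "edge_point 0 n X = sqrt (2 * real n) + edge_jacobian n * X"
  by (simp add: edge_point_def)

definition edge_fun :: "nat \<Rightarrow> real \<Rightarrow> real" where
  "edge_fun n X = edge_scale n * hermite_fun n (edge_point 0 n X)"

definition edge_fun_deriv :: "nat \<Rightarrow> real \<Rightarrow> real" where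
  "edge_fun_deriv n X = edge_scale n * edge_jacobian n * hermite_fun_deriv n (edge_point 0 n X)"

lemma edge_point_DERIV: "(edge_point c n has_real_derivative edge_jacobian n) (at X)"
  unfolding edge_point_def[abs_def] by (auto intro!: derivative_eq_intros)

lemma edge_fun_DERIV: "(edge_fun n has_real_derivative edge_fun_deriv n X) (at X)"
  using DERIV_cmult[OF DERIV_chain2[OF hermite_fun_DERIV[of n "edge_point 0 n X"] edge_point_DERIV[of 0 n X]], of "edge_scale n"]
  by (simp add: edge_fun_def[abs_def] edge_fun_deriv_def mult_ac)

text \<open>The oscillator equation in edge coordinates, an exact perturbation of the Airy equation
  with corrections of order h and h^2.\<close>

lemma edge_fun_deriv_DERIV:
  assumes n: "n > 0"
  shows "(edge_fun_deriv n has_real_derivative (X - edge_h n / 2 + (edge_h n)\<^sup>2 * X\<^sup>2 / 4) * edge_fun n X) (at X)"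
proof -
  define h where "h = edge_h n"
  define j where "j = edge_jacobian n"
  define q where "q = sqrt (2 * real n)"
  have r: "j\<^sup>2 = h / 2" "h * j * q = 1" "q\<^sup>2 = 2 * real n" "j > 0"
    using edge_jacobian_square[OF n] edge_jacobian_sqrt[OF n] edge_jacobian_pos[OF n] by (auto simp: h_def j_def q_def)
  have id: "((q + j * X)\<^sup>2 - 2 * real n - 1) * j\<^sup>2 = X - h / 2 + h\<^sup>2 * X\<^sup>2 / 4"
  proof -
    have "((q + j * X)\<^sup>2 - 2 * real n - 1) * j\<^sup>2 = (2 * j\<^sup>2) * j * q * X + (j\<^sup>2)\<^sup>2 * X\<^sup>2 - j\<^sup>2"
      using r(3) by (simp add: power2_eq_square algebra_simps)
    also have "\<dots> = (h * j * q) * X + (h / 2)\<^sup>2 * X\<^sup>2 - h / 2" unfolding r(1) by (simp add: mult_ac)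
    finally show ?thesis unfolding r(2) by (simp add: power_divide)
  qed
  have "(edge_fun_deriv n has_real_derivative edge_scale n * j * (((edge_point 0 n X)\<^sup>2 - 2 * real n - 1) * hermite_fun n (edge_point 0 n X) * j)) (at X)"
    using DERIV_cmult[OF DERIV_chain2[OF hermite_fun_deriv_DERIV[of n "edge_point 0 n X"] edge_point_DERIV[of 0 n X]], of "edge_scale n * j"]
    by (simp add: edge_fun_deriv_def[abs_def] j_def)
  also have "edge_scale n * j * (((edge_point 0 n X)\<^sup>2 - 2 * real n - 1) * hermite_fun n (edge_point 0 n X) * j) =
     (((q + j * X)\<^sup>2 - 2 * real n - 1) * j\<^sup>2) * edge_fun n X"
    unfolding edge_fun_def edge_point_0 q_def j_def power2_eq_square by (simp only: mult_ac)
  finally show ?thesis unfolding id h_def .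
qed

text \<open>The negative of the diagonal derivative of the scaled kernel for \<open>c = 0\<close>, with \<open>\<phi>\<^sub>n\<^sub>-\<^sub>1\<close> eliminated in
  favour of \<open>\<phi>\<^sub>n'\<close>.\<close>

definition edge_source :: "nat \<Rightarrow> real \<Rightarrow> real \<Rightarrow> real" where
  "edge_source n X Y = (edge_h n * (edge_fun n X * edge_fun_deriv n Y + edge_fun_deriv n X * edge_fun n Y)
     + (2 + (edge_h n)\<^sup>2 / 2 * (X + Y)) * edge_fun n X * edge_fun n Y) / 2"

lemma edge_kernel_DERIV:
  assumes n: "n > 0"
  shows "((\<lambda>t. edge_jacobian n * hermite_kernel n (edge_point 0 n (X + t)) (edge_point 0 n (Y + t)))
     has_real_derivative - edge_source n (X + t) (Y + t)) (at t)"
proof -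
  define h where "h = edge_h n"
  define j where "j = edge_jacobian n"
  define q where "q = sqrt (2 * real n)"
  define \<alpha> where "\<alpha> = edge_scale n"
  have r: "j\<^sup>2 = h / 2" "h * j * q = 1" "j = h * \<alpha>\<^sup>2" "j > 0" "\<alpha> > 0" "h > 0"
    unfolding h_def j_def q_def \<alpha>_def
    by (fact edge_jacobian_square[OF n] edge_jacobian_sqrt[OF n] edge_jacobian_pos[OF n] edge_jacobian_eq[OF n] edge_scale_pos[OF n] edge_h_pos[OF n])+
  let ?x = "edge_point 0 n X" and ?y = "edge_point 0 n Y"
  have shift: "edge_point 0 n (Z + t) = edge_point 0 n Z + j * t" for Z t
    by (simp add: edge_point_def j_def algebra_simps)
  let ?a = "edge_point 0 n (X + t)" and ?b = "edge_point 0 n (Y + t)"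
  have "((\<lambda>t. hermite_kernel n (?x + j * t) (?y + j * t)) has_real_derivative
     - (hermite_fun n ?a * hermite_fun_deriv n ?b + hermite_fun_deriv n ?a * hermite_fun n ?b
        + (?a + ?b) * hermite_fun n ?a * hermite_fun n ?b) / 2 * j) (at t)"
    unfolding shift
    by (rule DERIV_chain2[OF hermite_kernel_diagonal_DERIV]) (auto intro!: derivative_eq_intros)
  from DERIV_cmult[OF this, of j]
  have "((\<lambda>t. j * hermite_kernel n (edge_point 0 n (X + t)) (edge_point 0 n (Y + t))) has_real_derivative
     j * (- (hermite_fun n ?a * hermite_fun_deriv n ?b + hermite_fun_deriv n ?a * hermite_fun n ?b
        + (?a + ?b) * hermite_fun n ?a * hermite_fun n ?b) / 2 * j)) (at t)"
    unfolding shift .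
  also have "j * (- (hermite_fun n ?a * hermite_fun_deriv n ?b + hermite_fun_deriv n ?a * hermite_fun n ?b
        + (?a + ?b) * hermite_fun n ?a * hermite_fun n ?b) / 2 * j) = - edge_source n (X + t) (Y + t)"
  proof -
    define u where "u = hermite_fun n ?a"
    define v where "v = hermite_fun n ?b"
    define u' where "u' = hermite_fun_deriv n ?a"
    define v' where "v' = hermite_fun_deriv n ?b"
    have ab: "?a + ?b = 2 * q + j * ((X + t) + (Y + t))" by (simp add: edge_point_0 q_def j_def algebra_simps)
    have S: "edge_source n (X + t) (Y + t) = (h * (\<alpha> * u * (\<alpha> * j * v') + \<alpha> * j * u' * (\<alpha> * v)) + (2 + h\<^sup>2 / 2 * ((X + t) + (Y + t))) * (\<alpha> * u) * (\<alpha> * v)) / 2"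
      by (simp only: edge_source_def edge_fun_def edge_fun_deriv_def u_def v_def u'_def v'_def h_def j_def \<alpha>_def)
    have "\<dots> = ((h * \<alpha>\<^sup>2) * j * (u * v' + u' * v) + (2 * \<alpha>\<^sup>2 + (h * \<alpha>\<^sup>2) * h / 2 * ((X + t) + (Y + t))) * u * v) / 2"
      by (simp add: power2_eq_square algebra_simps)
    also have "\<dots> = (j * j * (u * v' + u' * v) + (2 * \<alpha>\<^sup>2 + j * h / 2 * ((X + t) + (Y + t))) * u * v) / 2"
      unfolding r(3)[symmetric] ..
    \<comment> \<open>Inserting the factor h j q = 1 expresses \<alpha>^2 through j and q, which
      matches the leading part 2 q of the sum of the two points.\<close>
    also have "\<alpha>\<^sup>2 = j * j * q"
    proof -
      have "\<alpha>\<^sup>2 = (h * j * q) * \<alpha>\<^sup>2" using r by simp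
      also have "\<dots> = (h * \<alpha>\<^sup>2) * j * q" by (simp only: mult_ac)
      finally show ?thesis by (simp only: r(3)[symmetric])
    qed
    also have "j * h / 2 = j * j * j" using r(1) by (simp add: power2_eq_square)
    finally show ?thesis unfolding S ab u_def[symmetric] v_def[symmetric] u'_def[symmetric] v'_def[symmetric]
      by (simp add: algebra_simps)
  qed
  finally show ?thesis by (simp only: j_def)
qed

text \<open>With \<open>u = sqrt (n / 2) (1 + h w)\<close>, the integrand \<open>u\<^sup>n exp ((u - x)\<^sup>2)\<close> of the Hermite contour
  integral equals \<open>edge_exp n w exp (- w X)\<close> up to factors that do not depend on \<open>w\<close>.\<close>

definition edge_exp :: "nat \<Rightarrow> complex \<Rightarrow> complex" where
  "edge_exp n w = (1 + of_real (edge_h n) * w) ^ n * exp (- (of_nat n * of_real (edge_h n) * w) + of_nat n * (of_real (edge_h n) * w)\<^sup>2 / 2)"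

definition edge_int :: "real \<Rightarrow> nat \<Rightarrow> nat \<Rightarrow> real \<Rightarrow> complex" where
  "edge_int \<eta> k n X = (1 / (2 * pi)) *
     (\<integral>t. Complex \<eta> t ^ k * (edge_exp n (Complex \<eta> t) * exp (- (Complex \<eta> t * of_real X))) \<partial>lborel)"

text \<open>With \<open>a\<close> and \<open>b\<close> the real and imaginary part of h w, the
  squared modulus of 1 + h w is (1 + a)^2 (1 + z), and 1 + z \<le> exp z. Together with the Gaussian
  factor of \<open>edge_exp\<close> and n h^3 = 1 this gives the stated rate. No smallness of h
  \<eta> enters, so the bound serves the fixed and the moving contour alike.\<close>

lemma norm_edge_exp_le:
  assumes n: "n > 0" and \<eta>: "\<eta> > 0"
  defines "a \<equiv> edge_h n * \<eta>"
  shows "norm (edge_exp n (Complex \<eta> t)) \<le> exp (n * (ln (1 + a) - a + a\<^sup>2 / 2)) * exp (- (\<eta> * (2 + a) / (2 * (1 + a)\<^sup>2) * t\<^sup>2))"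
proof -
  define h where "h = edge_h n"
  define b where "b = h * t"
  have h: "h > 0" "real n * h ^ 3 = 1" using edge_h_pos[OF n] edge_h_cube[OF n] by (auto simp: h_def)
  have a: "a > 0" "a = h * \<eta>" using h \<eta> by (auto simp: a_def h_def)
  define z where "z = b\<^sup>2 / (1 + a)\<^sup>2"
  have z: "z \<ge> 0" by (simp add: z_def)
  have w: "of_real (edge_h n) * Complex \<eta> t = Complex a b" by (simp add: complex_eq_iff a b_def h_def)
  have "norm (1 + Complex a b) = sqrt ((1 + a)\<^sup>2 + b\<^sup>2)" by (simp add: cmod_def)
  also have "(1 + a)\<^sup>2 + b\<^sup>2 = (1 + a)\<^sup>2 * (1 + z)" using a by (simp add: z_def field_simps)
  also have "sqrt \<dots> = (1 + a) * sqrt (1 + z)" using a by (simp add: real_sqrt_mult)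
  also have "\<dots> \<le> (1 + a) * exp (z / 2)"
  proof (intro mult_left_mono)
    have "1 + z \<le> exp z" by (rule exp_ge_add_one_self)
    then show "sqrt (1 + z) \<le> exp (z / 2)" by (intro real_le_lsqrt) (auto simp: exp_double[symmetric])
  qed (use a in simp)
  also have "\<dots> = exp (ln (1 + a) + z / 2)" using a by (simp add: exp_add)
  finally have "norm (1 + Complex a b) ^ n \<le> exp (ln (1 + a) + z / 2) ^ n" by (intro power_mono) auto
  also have "\<dots> = exp (n * (ln (1 + a) + z / 2))" by (simp add: exp_of_nat_mult)
  finally have 1: "norm ((1 + Complex a b) ^ n) \<le> exp (n * (ln (1 + a) + z / 2))" by (simp add: norm_power)
  have 2: "norm (exp (- (of_nat n * of_real (edge_h n) * Complex \<eta> t) + of_nat n * (Complex a b)\<^sup>2 / 2)) = exp (- (n * a) + n * (a\<^sup>2 - b\<^sup>2) / 2)"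
    by (simp add: power2_eq_square a(2) h_def)
  have "norm (edge_exp n (Complex \<eta> t)) \<le> exp (n * (ln (1 + a) + z / 2)) * exp (- (n * a) + n * (a\<^sup>2 - b\<^sup>2) / 2)"
    unfolding edge_exp_def w norm_mult 2 using 1 by (intro mult_right_mono) auto
  also have "\<dots> = exp (n * (ln (1 + a) - a + a\<^sup>2 / 2) + n * (z - b\<^sup>2) / 2)"
    unfolding exp_add[symmetric] by (intro arg_cong[of _ _ exp]) (simp add: field_simps)
  also have "n * (z - b\<^sup>2) / 2 = - (\<eta> * (2 + a) / (2 * (1 + a)\<^sup>2) * t\<^sup>2)"
  proof -
    have "z - b\<^sup>2 = - (a * (2 + a) / (1 + a)\<^sup>2) * b\<^sup>2"
      using a unfolding z_def by (simp add: divide_simps) (simp add: power2_eq_square algebra_simps)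
    then have "n * (z - b\<^sup>2) / 2 = - ((real n * h ^ 3) * \<eta> * (2 + a) / (2 * (1 + a)\<^sup>2) * t\<^sup>2)"
      unfolding a(2) b_def by (simp add: power2_eq_square power3_eq_cube mult_ac)
    then show ?thesis unfolding h by simp
  qed
  finally show ?thesis by (simp only: exp_add)
qed

lemma edge_integrand_continuous:
  "continuous_on UNIV (\<lambda>t. Complex \<eta> t ^ k * (edge_exp n (Complex \<eta> t) * exp (- (Complex \<eta> t * of_real X))))"
  unfolding edge_exp_def by (intro continuous_intros) auto

lemma norm_edge_integrand:
  assumes n: "n > 0" and \<eta>: "\<eta> > 0"
  defines "a \<equiv> edge_h n * \<eta>"
  shows "norm (Complex \<eta> t ^ k * (edge_exp n (Complex \<eta> t) * exp (- (Complex \<eta> t * of_real X))))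
    \<le> exp (n * (ln (1 + a) - a + a\<^sup>2 / 2) - \<eta> * X) * ((\<eta> + \<bar>t\<bar>) ^ k * exp (- (\<eta> * (2 + a) / (2 * (1 + a)\<^sup>2) * t\<^sup>2)))"
proof -
  have "norm (Complex \<eta> t ^ k) \<le> (\<eta> + \<bar>t\<bar>) ^ k"
    unfolding norm_power using \<eta> by (intro power_mono norm_Complex_line_le) auto
  moreover have "norm (exp (- (Complex \<eta> t * of_real X))) = exp (- (\<eta> * X))" by simp
  ultimately have "norm (Complex \<eta> t ^ k * (edge_exp n (Complex \<eta> t) * exp (- (Complex \<eta> t * of_real X))))
    \<le> (\<eta> + \<bar>t\<bar>) ^ k * ((exp (n * (ln (1 + a) - a + a\<^sup>2 / 2)) * exp (- (\<eta> * (2 + a) / (2 * (1 + a)\<^sup>2) * t\<^sup>2))) * exp (- (\<eta> * X)))"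
    unfolding norm_mult using norm_edge_exp_le[OF n \<eta>, of t, folded a_def] \<eta>
    by (intro mult_mono) auto
  also have "\<dots> = (exp (n * (ln (1 + a) - a + a\<^sup>2 / 2)) * exp (- (\<eta> * X))) * ((\<eta> + \<bar>t\<bar>) ^ k * exp (- (\<eta> * (2 + a) / (2 * (1 + a)\<^sup>2) * t\<^sup>2)))"
    by (simp only: mult_ac)
  finally show ?thesis by (simp only: exp_add[symmetric] add_uminus_conv_diff)
qed

lemma edge_rate_pos:
  assumes "n > 0" "\<eta> > 0"
  shows "\<eta> * (2 + edge_h n * \<eta>) / (2 * (1 + edge_h n * \<eta>)\<^sup>2) > 0"
proof -
  have "edge_h n * \<eta> > 0" using edge_h_pos assms by simp
  then show ?thesis using assms by (intro divide_pos_pos mult_pos_pos) auto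
qed

lemma edge_integrand_integrable:
  assumes "n > 0" "\<eta> > 0"
  shows "integrable lborel (\<lambda>t. Complex \<eta> t ^ k * (edge_exp n (Complex \<eta> t) * exp (- (Complex \<eta> t * of_real X))))"
  by (rule integrable_gaussian_bound[OF edge_rate_pos[OF assms] borel_measurable_continuous_lborel[OF edge_integrand_continuous] norm_edge_integrand[OF assms]])

text \<open>The product collects every constant met on the way to \<open>edge_int\<close>: amplitude
  and norm, the constant of the Hermite integral, the Jacobian q h of the substitution, q^n exp (- n
  / 2) from the integrand at the critical point, and 2 pi from the prefactor of
  \<open>edge_int\<close>. Comparing squares removes the roots.\<close>

lemma stirling_ratio_eq:
  assumes n: "n > 0"
  shows "edge_scale n * hermite_norm n * (2 ^ n / sqrt pi) * (sqrt (real n / 2) * edge_h n) * (sqrt (real n / 2) ^ n * exp (- real n / 2)) * (2 * pi) = stirling_ratio n"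
proof (rule power2_eq_imp_eq)
  have s: "(edge_scale n)\<^sup>2 = 2 powr (- 1 / 2) * real n powr (1 / 6)"
    unfolding edge_scale_def power_mult_distrib powr_square by simp
  have hn: "(hermite_norm n)\<^sup>2 = 1 / (2 ^ n * fact n * sqrt pi)"
    unfolding hermite_norm_def powr_square by (simp add: powr_minus_divide)
  have h2: "(edge_h n)\<^sup>2 = real n powr (- 2 / 3)" using edge_h_power[OF n, of 2] by simp
  have q: "(sqrt (real n / 2) ^ n)\<^sup>2 = (real n / 2) ^ n"
    by (simp add: power_mult[symmetric] mult.commute[of n] power_mult)
  have e: "(exp (- real n / 2))\<^sup>2 = exp (- real n)" by (simp add: power2_eq_square exp_add[symmetric])
  have pw: "real n powr (1 / 6) * (real n * real n powr (- 2 / 3)) = sqrt (real n)"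
  proof -
    have "real n powr (1 / 6) * (real n powr 1 * real n powr (- 2 / 3)) = real n powr (1 / 2)"
      by (simp only: powr_add[symmetric]) simp
    then show ?thesis using n by (simp add: powr_half_sqrt)
  qed
  have c: "(2::real) powr (- 1 / 2) = 1 / sqrt 2" by (simp add: powr_minus_divide powr_half_sqrt)
  have "(edge_scale n * hermite_norm n * (2 ^ n / sqrt pi) * (sqrt (real n / 2) * edge_h n) * (sqrt (real n / 2) ^ n * exp (- real n / 2)) * (2 * pi))\<^sup>2
     = (1 / sqrt 2 * real n powr (1 / 6)) * (1 / (2 ^ n * fact n * sqrt pi)) * ((2 ^ n)\<^sup>2 / pi) * (real n / 2 * real n powr (- 2 / 3)) * ((real n / 2) ^ n * exp (- real n)) * (4 * pi\<^sup>2)"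
    unfolding power_mult_distrib power_divide s hn h2 q[unfolded power_mult_distrib] e c using pi_gt_zero by (simp add: power_divide)
  also have "\<dots> = (1 / sqrt 2 * (real n powr (1 / 6) * (real n * real n powr (- 2 / 3))) * 2 * (pi / sqrt pi)) * (((2 ^ n)\<^sup>2 * (1 / 2 ^ n) * (1 / 2 ^ n)) * (real n ^ n * exp (- real n)) / fact n)"
    by (simp add: power_divide power2_eq_square field_simps)
  also have "\<dots> = (2 / sqrt 2 * (pi / sqrt pi) * sqrt (real n)) * (real n ^ n * exp (- real n)) / fact n"
    unfolding pw by (simp add: power2_eq_square)
  also have "2 / sqrt 2 = sqrt (2::real)" by (simp add: real_div_sqrt)
  also have "pi / sqrt pi = sqrt pi" by (simp add: real_div_sqrt)
  also have "sqrt 2 * sqrt pi * sqrt (real n) = sqrt (2 * pi * real n)" by (simp add: real_sqrt_mult)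
  also have "sqrt (2 * pi * real n) * (real n ^ n * exp (- real n)) / fact n = (stirling_ratio n)\<^sup>2"
    by (simp add: stirling_ratio_def)
  finally show "(edge_scale n * hermite_norm n * (2 ^ n / sqrt pi) * (sqrt (real n / 2) * edge_h n) * (sqrt (real n / 2) ^ n * exp (- real n / 2)) * (2 * pi))\<^sup>2 = (stirling_ratio n)\<^sup>2" .
qed (use edge_scale_pos[OF n] hermite_norm_pos[of n] edge_h_pos[OF n] stirling_ratio_pos[OF n] in \<open>auto intro!: mult_nonneg_nonneg\<close>)

text \<open>At x = 2 q with q = sqrt (n / 2), the exponent n ln u + (u - x)^2 has derivative 2 (u -
  q)^2 / u, so u = q is a double critical point. The substitution u = q (1 + h w) blows it up at the
  Airy scale. The derivative formula comes from the integral of index n + 1, which inserts one more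
  factor u.\<close>

lemma edge_fun_contour:
  assumes n: "n > 0" and \<eta>: "\<eta> > 0"
  shows "of_real (edge_fun n X) = of_real (stirling_ratio n * exp (edge_h n * X\<^sup>2 / 4)) * edge_int \<eta> 0 n X"
    and "of_real (edge_fun_deriv n X) = of_real (stirling_ratio n * exp (edge_h n * X\<^sup>2 / 4)) * (of_real (edge_h n * X / 2) * edge_int \<eta> 0 n X - edge_int \<eta> 1 n X)"
proof -
  define h where "h = edge_h n"
  define j where "j = edge_jacobian n"
  define q where "q = sqrt (real n / 2)"
  define x where "x = edge_point 0 n X"
  define \<sigma> where "\<sigma> = q * (1 + h * \<eta>)"
  have q2: "sqrt (2 * real n) = 2 * q"
  proof -
    have "sqrt (2 * real n) = sqrt (4 * (real n / 2))" by simp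
    also have "\<dots> = 2 * q" unfolding q_def real_sqrt_mult by simp
    finally show ?thesis .
  qed
  have r: "j\<^sup>2 = h / 2" "2 * q * j * h = 1" "q\<^sup>2 = real n / 2" "q > 0" "h > 0" "x = 2 * q + j * X"
    using edge_jacobian_square[OF n] edge_jacobian_sqrt[OF n] edge_h_pos[OF n] n
    unfolding q2 x_def edge_point_0 by (auto simp: h_def j_def q_def mult_ac)
  define Q where "Q = q ^ n * exp (- real n / 2) * exp (h * X\<^sup>2 / 4)"
  define f where "f t = edge_exp n (Complex \<eta> t) * exp (- (Complex \<eta> t * of_real X))" for t
  have line: "Complex \<sigma> (q * h * t) = of_real q * (1 + of_real h * Complex \<eta> t)" for t
    by (simp add: complex_eq_iff \<sigma>_def)
  have integrand: "Complex \<sigma> (q * h * t) ^ n * exp ((Complex \<sigma> (q * h * t) - of_real x)\<^sup>2) * of_real (exp (- x\<^sup>2 / 2)) = of_real Q * f t" for t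
  proof -
    define w where "w = Complex \<eta> t"
    \<comment> \<open>The terms linear in X without w cancel against those of - x^2 / 2; half of j^2
      X^2 survives and is the exponent h X^2 / 4 of the prefactor.\<close>
    have ex: "(of_real q * (1 + of_real h * w) - of_real x)\<^sup>2 + of_real (- x\<^sup>2 / 2) =
       of_real (- real n / 2) + of_real (h * X\<^sup>2 / 4) + ((- (of_nat n * of_real h * w) + of_nat n * (of_real h * w)\<^sup>2 / 2) + - (w * of_real X))"
    proof -
      have "(of_real q * (1 + of_real h * w) - of_real x)\<^sup>2 + of_real (- x\<^sup>2 / 2) =
         - of_real (q\<^sup>2) - 2 * of_real (q\<^sup>2) * of_real h * w + of_real (q\<^sup>2) * (of_real h * w)\<^sup>2 - of_real (2 * q * j * h) * w * of_real X + of_real (j\<^sup>2) * of_real X ^ 2 / 2"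
        unfolding r(6) by (simp add: power2_eq_square field_simps)
      also have "\<dots> = of_real (- real n / 2) + of_real (h * X\<^sup>2 / 4) + ((- (of_nat n * of_real h * w) + of_nat n * (of_real h * w)\<^sup>2 / 2) + - (w * of_real X))"
        unfolding r(1,2,3) by (simp add: field_simps)
      finally show ?thesis .
    qed
    have "(of_real q * (1 + of_real h * w)) ^ n * exp ((of_real q * (1 + of_real h * w) - of_real x)\<^sup>2) * of_real (exp (- x\<^sup>2 / 2)) =
       (of_real q ^ n * (1 + of_real h * w) ^ n) * exp ((of_real q * (1 + of_real h * w) - of_real x)\<^sup>2 + of_real (- x\<^sup>2 / 2))"
      by (simp only: power_mult_distrib exp_add exp_of_real mult_ac)
    also have "\<dots> = (of_real q ^ n * (1 + of_real h * w) ^ n) * (exp (of_real (- real n / 2)) * exp (of_real (h * X\<^sup>2 / 4)) * (exp (- (of_nat n * of_real h * w) + of_nat n * (of_real h * w)\<^sup>2 / 2) * exp (- (w * of_real X))))"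
      unfolding ex by (simp only: exp_add)
    also have "\<dots> = of_real Q * f t"
      unfolding Q_def f_def edge_exp_def h_def[symmetric] w_def[symmetric] exp_of_real of_real_mult of_real_power by (simp only: mult_ac)
    finally show ?thesis unfolding line w_def .
  qed
  define J where "J k = (\<integral>t. Complex \<sigma> t ^ k * exp ((Complex \<sigma> t - of_real x)\<^sup>2) \<partial>lborel)" for k
  have J: "J k = (q * h) *\<^sub>R (\<integral>t. Complex \<sigma> (q * h * t) ^ k * exp ((Complex \<sigma> (q * h * t) - of_real x)\<^sup>2) \<partial>lborel)" for k
    unfolding J_def using r by (subst lborel_integral_real_affine[of "q * h" _ 0]) auto
  have f: "integrable lborel (\<lambda>t. Complex \<eta> t ^ k * f t)" for k
    unfolding f_def by (rule edge_integrand_integrable[OF n \<eta>])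
  have P: "(\<integral>t. Complex \<eta> t ^ k * f t \<partial>lborel) = of_real (2 * pi) * edge_int \<eta> k n X" for k
    unfolding edge_int_def f_def by simp
  have J0: "J n * of_real (exp (- x\<^sup>2 / 2)) = of_real (q * h * Q * (2 * pi)) * edge_int \<eta> 0 n X"
  proof -
    have "J n * of_real (exp (- x\<^sup>2 / 2)) = of_real (q * h) * (\<integral>t. of_real Q * f t \<partial>lborel)"
      unfolding J integrand[symmetric] by (simp add: scaleR_conv_of_real del: of_real_exp)
    also have "\<dots> = of_real (q * h) * (of_real Q * (\<integral>t. Complex \<eta> t ^ 0 * f t \<partial>lborel))"
      by simp
    finally show ?thesis unfolding P by (simp add: mult_ac)
  qed
  have J1: "J (Suc n) * of_real (exp (- x\<^sup>2 / 2)) = of_real (q * h * Q * (2 * pi)) * (of_real q * (edge_int \<eta> 0 n X + of_real h * edge_int \<eta> 1 n X))"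
  proof -
    have i: "of_real q * (of_real Q * (1 * f t + of_real h * (Complex \<eta> t ^ 1 * f t))) = Complex \<sigma> (q * h * t) ^ Suc n * exp ((Complex \<sigma> (q * h * t) - of_real x)\<^sup>2) * of_real (exp (- x\<^sup>2 / 2))" for t
    proof -
      have "of_real q * (of_real Q * (1 * f t + of_real h * (Complex \<eta> t ^ 1 * f t))) = Complex \<sigma> (q * h * t) * (of_real Q * f t)"
        unfolding line by (simp add: algebra_simps)
      then show ?thesis unfolding integrand[symmetric] by (simp only: power_Suc mult.assoc)
    qed
    have "J (Suc n) * of_real (exp (- x\<^sup>2 / 2)) = of_real (q * h) * (\<integral>t. of_real q * (of_real Q * (1 * f t + of_real h * (Complex \<eta> t ^ 1 * f t))) \<partial>lborel)"
      unfolding J i by (simp add: scaleR_conv_of_real del: of_real_exp power_Suc)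
    also have "\<dots> = of_real (q * h) * (of_real q * (of_real Q * ((\<integral>t. Complex \<eta> t ^ 0 * f t \<partial>lborel) + of_real h * (\<integral>t. Complex \<eta> t ^ 1 * f t \<partial>lborel))))"
      using f[of 0] f[of 1] by simp
    finally show ?thesis unfolding P by (simp add: algebra_simps)
  qed
  define c where "c = edge_scale n * hermite_norm n * (2 ^ n / sqrt pi)"
  have cQ: "c * (q * h * Q * (2 * pi)) = stirling_ratio n * exp (h * X\<^sup>2 / 4)"
    unfolding stirling_ratio_eq[OF n, symmetric] c_def Q_def q_def h_def by (simp only: mult_ac)
  have H: "complex_of_real (poly (hermite_rec m) x) = 2 ^ m / sqrt pi * J m" for m
    unfolding J_def by (rule hermite_integral_representation)
  have "complex_of_real (edge_fun n X) = of_real (edge_scale n * hermite_norm n) * (of_real (poly (hermite_rec n) x) * of_real (exp (- x\<^sup>2 / 2)))"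
    by (simp add: edge_fun_def hermite_fun_eq x_def mult_ac)
  also have "\<dots> = of_real c * (J n * of_real (exp (- x\<^sup>2 / 2)))"
    unfolding H c_def by (simp add: mult_ac)
  also have "\<dots> = of_real (c * (q * h * Q * (2 * pi))) * edge_int \<eta> 0 n X"
    unfolding J0 by (simp only: of_real_mult mult_ac)
  finally show "of_real (edge_fun n X) = of_real (stirling_ratio n * exp (edge_h n * X\<^sup>2 / 4)) * edge_int \<eta> 0 n X"
    unfolding cQ by (simp only: h_def)
  have "complex_of_real (edge_fun_deriv n X) = of_real (edge_scale n * hermite_norm n * j) * ((of_real x * of_real (poly (hermite_rec n) x) - of_real (poly (hermite_rec (Suc n)) x)) * of_real (exp (- x\<^sup>2 / 2)))"
    by (simp add: edge_fun_deriv_def hermite_fun_deriv_eq x_def j_def mult_ac del: hermite_rec.simps)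
  also have "\<dots> = of_real c * of_real j * (of_real x * (J n * of_real (exp (- x\<^sup>2 / 2))) - 2 * (J (Suc n) * of_real (exp (- x\<^sup>2 / 2))))"
    unfolding H c_def by (simp add: algebra_simps)
  also have "\<dots> = of_real (c * (q * h * Q * (2 * pi))) * (of_real (j * (x - 2 * q)) * edge_int \<eta> 0 n X - of_real (2 * q * j * h) * edge_int \<eta> 1 n X)"
    unfolding J0 J1 by (simp add: algebra_simps)
  also have "j * (x - 2 * q) = h * X / 2"
    using r(1) unfolding r(6) by (simp add: power2_eq_square)
  finally show "of_real (edge_fun_deriv n X) = of_real (stirling_ratio n * exp (edge_h n * X\<^sup>2 / 4)) * (of_real (edge_h n * X / 2) * edge_int \<eta> 0 n X - edge_int \<eta> 1 n X)"
    unfolding cQ r(2) by (simp add: h_def)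
qed

section \<open>Third order expansion of the contour integrand in h\<close>

lemma Ln_one_plus_Taylor5:
  assumes "norm d \<le> 1 / 2"
  shows "norm (Ln (1 + d) - (d - d\<^sup>2 / 2 + d ^ 3 / 3 - d ^ 4 / 4 + d ^ 5 / 5)) \<le> 2 * norm d ^ 6"
proof -
  let ?f = "\<lambda>d. Ln (1 + d) - (d - d\<^sup>2 / 2 + d ^ 3 / 3 - d ^ 4 / 4 + d ^ 5 / 5)"
  have nz: "1 + z \<notin> \<real>\<^sub>\<le>\<^sub>0" "1 + z \<noteq> 0" "norm (1 + z) \<ge> 1 / 2" if "norm z \<le> 1 / 2" for z :: complex
  proof -
    have "Re z \<ge> - (1 / 2)" using abs_Re_le_cmod[of z] that by linarith
    then have "Re (1 + z) > 0" by simp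
    then show "1 + z \<notin> \<real>\<^sub>\<le>\<^sub>0" by (auto simp: complex_nonpos_Reals_iff)
    show "1 + z \<noteq> 0" using \<open>Re (1 + z) > 0\<close> by (metis less_irrefl zero_complex.simps(1))
    show "norm (1 + z) \<ge> 1 / 2" using norm_triangle_ineq2[of 1 "- z"] that by simp
  qed
  have "norm (?f d - ?f 0) \<le> (2 * norm d ^ 5) * norm (d - 0)"
  proof (rule field_differentiable_bound)
    show "convex (cball (0::complex) (norm d))" by (rule convex_cball)
    fix z :: complex assume "z \<in> cball 0 (norm d)"
    then have zd: "norm z \<le> norm d" by simp
    then have z: "norm z \<le> 1 / 2" using assms by linarith
    have "(?f has_field_derivative (inverse (1 + z) - (1 - z + z\<^sup>2 - z ^ 3 + z ^ 4))) (at z)"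
    proof -
      have "((\<lambda>d. Ln (1 + d) - (d - (1 / 2) * d\<^sup>2 + (1 / 3) * d ^ 3 - (1 / 4) * d ^ 4 + (1 / 5) * d ^ 5)) has_field_derivative
          (inverse (1 + z) - (1 - z + z\<^sup>2 - z ^ 3 + z ^ 4))) (at z)"
        using nz(1)[OF z] by (auto intro!: derivative_eq_intros simp: inverse_eq_divide)
      then show ?thesis by simp
    qed
    \<comment> \<open>The derivative of the Taylor polynomial is a truncated geometric series, so
      only one fraction remains, and |1 + z| \<ge> 1/2.\<close>
    moreover have "inverse (1 + z) - (1 - z + z\<^sup>2 - z ^ 3 + z ^ 4) = - (z ^ 5) / (1 + z)"
      using nz(2)[OF z] by (simp add: field_simps eval_nat_numeral)
    ultimately have "(?f has_field_derivative - (z ^ 5) / (1 + z)) (at z)" by (simp only:)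
    then show "(?f has_field_derivative - (z ^ 5) / (1 + z)) (at z within cball 0 (norm d))"
      by (rule has_field_derivative_at_within)
    have "norm (- (z ^ 5) / (1 + z)) = norm z ^ 5 / norm (1 + z)" by (simp add: norm_divide norm_power)
    also have "\<dots> \<le> norm d ^ 5 / (1 / 2)"
      using nz(3)[OF z] zd by (intro frac_le power_mono) auto
    finally show "norm (- (z ^ 5) / (1 + z)) \<le> 2 * norm d ^ 5" by simp
  qed auto
  moreover have "(2 * norm d ^ 5) * norm (d - 0) = 2 * norm d ^ 6" by (simp add: eval_nat_numeral)
  ultimately show ?thesis by simp
qed

text \<open>Along the segment from 0 to z the real part stays below max 0 (Re z). A bound by exp |z|
  would be useless below, where the correction may be large while its product with exp (v^3 / 3)
  stays under the Gaussian.\<close>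

lemma norm_exp_Taylor2:
  fixes z :: complex
  shows "norm (exp z - (1 + z + z\<^sup>2 / 2)) \<le> max 1 (exp (Re z)) * norm z ^ 3"
proof -
  let ?B = "max 1 (exp (Re z))"
  have "norm (exp z - (\<Sum>i\<le>2. exp 0 * (z - 0) ^ i / fact i)) \<le> ?B * norm (z - 0) ^ Suc 2 / fact 2"
  proof (rule complex_Taylor[of "closed_segment 0 z" 2 "\<lambda>_. exp"])
    fix x assume "x \<in> closed_segment 0 z"
    then obtain u where u: "0 \<le> u" "u \<le> 1" "x = u *\<^sub>R z" by (auto simp: closed_segment_def)
    have "u * Re z \<le> max 0 (Re z)"
    proof (cases "Re z \<ge> 0")
      case True
      then show ?thesis using u mult_right_mono[of u 1 "Re z"] by simp
    next
      case False
      then show ?thesis using u by (simp add: mult_nonneg_nonpos)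
    qed
    then have "exp (Re x) \<le> exp (max 0 (Re z))" by (simp add: u)
    also have "\<dots> = ?B" by (simp add: max_def)
    finally show "norm (exp x) \<le> ?B" by simp
  qed (auto intro!: derivative_eq_intros)
  moreover have "(\<Sum>i\<le>2. exp 0 * (z - 0) ^ i / fact i) = 1 + z + z\<^sup>2 / 2"
    by (simp add: eval_nat_numeral)
  ultimately have "norm (exp z - (1 + z + z\<^sup>2 / 2)) \<le> ?B * norm z ^ 3 / 2"
    by (simp add: eval_nat_numeral)
  moreover have "0 \<le> ?B * norm z ^ 3" by (intro mult_nonneg_nonneg) auto
  ultimately show ?thesis by linarith
qed

lemma edge_h_le_1: "n > 0 \<Longrightarrow> edge_h n \<le> 1"
proof -
  assume "n > 0"
  then have "real n powr (- 1 / 3) \<le> 1 powr (- 1 / 3)" by (intro powr_mono2') auto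
  then show ?thesis by (simp add: edge_h_def)
qed

text \<open>A common Gaussian majorant of rate \<eta> / 2 for the exact and the limiting integrand.
  The assumption on h \<eta> gives (1 + a)^2 \<le> 2 + a.\<close>

lemma edge_exp_bounds:
  assumes n: "n > 0" and \<eta>: "\<eta> > 0" and h: "edge_h n * \<eta> \<le> 1 / 2"
  shows "norm (edge_exp n (Complex \<eta> t)) \<le> exp (\<eta> ^ 3 / 3) * exp (- (\<eta> / 2 * t\<^sup>2))"
    "norm (exp (Complex \<eta> t ^ 3 / 3)) \<le> exp (\<eta> ^ 3 / 3) * exp (- (\<eta> / 2 * t\<^sup>2))"
proof -
  define a where "a = edge_h n * \<eta>"
  have a: "0 < a" "a \<le> 1 / 2" using h edge_h_pos[OF n] \<eta> by (auto simp: a_def)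
  have "ln (1 + a) - a + a\<^sup>2 / 2 \<le> a ^ 3 / 3" using ln_one_plus_le_cubic[of a] a by linarith
  then have "real n * (ln (1 + a) - a + a\<^sup>2 / 2) \<le> real n * (a ^ 3 / 3)" by (intro mult_left_mono) auto
  also have "\<dots> = (real n * edge_h n ^ 3) * (\<eta> ^ 3 / 3)" by (simp add: a_def power_mult_distrib)
  finally have 1: "real n * (ln (1 + a) - a + a\<^sup>2 / 2) \<le> \<eta> ^ 3 / 3" using edge_h_cube[OF n] by simp
  have "a * a \<le> 1 / 2 * (1 / 2)" using a by (intro mult_mono) auto
  then have "(1 + a)\<^sup>2 \<le> 2 + a" using a by (simp add: power2_eq_square algebra_simps)
  then have "1 / 2 \<le> (2 + a) / (2 * (1 + a)\<^sup>2)" using a by (simp add: divide_simps)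
  then have "\<eta> * (1 / 2) \<le> \<eta> * ((2 + a) / (2 * (1 + a)\<^sup>2))" using \<eta> by (intro mult_left_mono) auto
  then have "\<eta> / 2 * t\<^sup>2 \<le> \<eta> * (2 + a) / (2 * (1 + a)\<^sup>2) * t\<^sup>2" by (intro mult_right_mono) auto
  with 1 have "exp (n * (ln (1 + a) - a + a\<^sup>2 / 2)) * exp (- (\<eta> * (2 + a) / (2 * (1 + a)\<^sup>2) * t\<^sup>2)) \<le> exp (\<eta> ^ 3 / 3) * exp (- (\<eta> / 2 * t\<^sup>2))"
    by (intro mult_mono) auto
  with norm_edge_exp_le[OF n \<eta>, of t] show "norm (edge_exp n (Complex \<eta> t)) \<le> exp (\<eta> ^ 3 / 3) * exp (- (\<eta> / 2 * t\<^sup>2))"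
    unfolding a_def[symmetric] by linarith
  have "\<eta> / 2 * t\<^sup>2 \<le> \<eta> * t\<^sup>2" using \<eta> by (intro mult_right_mono) auto
  then have "exp (- (\<eta> * t\<^sup>2)) \<le> exp (- (\<eta> / 2 * t\<^sup>2))" by simp
  then have "exp (\<eta> ^ 3 / 3) * exp (- (\<eta> * t\<^sup>2)) \<le> exp (\<eta> ^ 3 / 3) * exp (- (\<eta> / 2 * t\<^sup>2))"
    by (intro mult_left_mono) auto
  then show "norm (exp (Complex \<eta> t ^ 3 / 3)) \<le> exp (\<eta> ^ 3 / 3) * exp (- (\<eta> / 2 * t\<^sup>2))"
    using norm_airy_exp[of \<eta> t 0] by simp
qed

text \<open>Where h |w| \<le> 1/2 the logarithm and then the exponential are expanded; the term w^8
  / 32 is half the square of w^4 / 4, and power 12 comes from the cube of h w^4. Elsewhere the crude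
  bounds suffice, and 40 = 5 * 8 arises there.\<close>

lemma edge_exp_expansion:
  assumes n: "n > 0" and \<eta>: "\<eta> > 0" and h: "edge_h n * \<eta> \<le> 1 / 2"
  defines "w \<equiv> \<lambda>t. Complex \<eta> t"
  shows "norm (edge_exp n (w t) - exp (w t ^ 3 / 3) * (1 - of_real (edge_h n) * w t ^ 4 / 4
      + of_real (edge_h n) ^ 2 * (w t ^ 8 / 32 + w t ^ 5 / 5)))
    \<le> 40 * exp (\<eta> ^ 3 / 3) * edge_h n ^ 3 * ((1 + \<eta> + \<bar>t\<bar>) ^ 12 * exp (- (\<eta> / 2 * t\<^sup>2)))"
proof -
  define v where "v = Complex \<eta> t"
  define k where "k = edge_h n"
  define K where "K = complex_of_real k"
  define M where "M = exp (\<eta> ^ 3 / 3) * exp (- (\<eta> / 2 * t\<^sup>2))"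
  define s where "s = 1 + \<eta> + \<bar>t\<bar>"
  define A where "A = - (K * v ^ 4 / 4)"
  define p where "p = 1 + A + K ^ 2 * (v ^ 8 / 32 + v ^ 5 / 5)"
  have k: "0 < k" "k \<le> 1" "real n * k ^ 3 = 1" "norm K = k"
    using edge_h_pos[OF n] edge_h_le_1[OF n] edge_h_cube[OF n] by (auto simp: k_def K_def)
  have M: "M \<ge> 0" "norm (edge_exp n v) \<le> M" "norm (exp (v ^ 3 / 3)) \<le> M"
    using edge_exp_bounds[OF n \<eta> h, of t] by (auto simp: M_def v_def)
  have vs: "norm v \<le> s" and s1: "s \<ge> 1" using norm_Complex_line_le[of \<eta> t] \<eta> by (auto simp: v_def s_def)
  have vpow: "norm v ^ i \<le> s ^ j" if "i \<le> j" for i j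
    using power_mono[OF vs, of i] power_increasing[OF that s1] by simp
  have "norm (edge_exp n v - exp (v ^ 3 / 3) * p) \<le> 40 * M * k ^ 3 * s ^ 12"
  proof (cases "k * norm v \<le> 1 / 2")
    case True
    define d where "d = K * v"
    have nd: "norm d = k * norm v" by (simp add: d_def norm_mult k)
    with True have d: "norm d \<le> 1 / 2" by simp
    then have d1: "1 + d \<noteq> 0" using norm_triangle_ineq2[of 1 "- d"] by auto
    \<comment> \<open>The remainder is of order n (h v)^6 = h^3 v^6, which is why the logarithm is
      expanded to fifth order.\<close>
    define \<rho> where "\<rho> = of_nat n * (Ln (1 + d) - (d - d\<^sup>2 / 2 + d ^ 3 / 3 - d ^ 4 / 4 + d ^ 5 / 5))"
    have nK: "of_nat n * K ^ 3 = 1" using k(3) unfolding K_def by (metis of_real_1 of_real_mult of_real_of_nat_eq of_real_power)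
    have \<rho>: "norm \<rho> \<le> 2 * k ^ 3 * norm v ^ 6"
    proof -
      have "norm \<rho> \<le> real n * (2 * norm d ^ 6)"
        unfolding \<rho>_def norm_mult norm_of_nat by (intro mult_left_mono Ln_one_plus_Taylor5 d) auto
      also have "\<dots> = 2 * (real n * k ^ 3) * k ^ 3 * norm v ^ 6" by (simp add: nd power_mult_distrib eval_nat_numeral)
      finally show ?thesis by (simp add: k)
    qed
    define R where "R = K ^ 2 * v ^ 5 / 5 + \<rho>"
    define \<zeta> where "\<zeta> = A + R"
    have ee: "edge_exp n v = exp (v ^ 3 / 3) * exp \<zeta>"
    proof -
      have "edge_exp n v = exp (of_nat n * Ln (1 + d)) * exp (- (of_nat n * d) + of_nat n * d\<^sup>2 / 2)"
        using d1 unfolding edge_exp_def d_def K_def k_def by (simp add: exp_of_nat_mult mult.assoc)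
      also have "\<dots> = exp (of_nat n * Ln (1 + d) + (- (of_nat n * d) + of_nat n * d\<^sup>2 / 2))" by (simp only: exp_add)
      also have "of_nat n * Ln (1 + d) + (- (of_nat n * d) + of_nat n * d\<^sup>2 / 2) = \<rho> + (of_nat n * K ^ 3) * (v ^ 3 / 3 - K * v ^ 4 / 4 + K ^ 2 * v ^ 5 / 5)"
        by (simp add: \<rho>_def d_def field_simps eval_nat_numeral)
      also have "\<dots> = v ^ 3 / 3 + \<zeta>" unfolding nK by (simp add: \<zeta>_def R_def A_def)
      finally show ?thesis by (simp only: exp_add)
    qed
    have nA: "norm A \<le> k * norm v ^ 4 / 4" by (simp add: A_def norm_mult norm_divide norm_power k)
    have nR: "norm R \<le> 2 * k ^ 2 * norm v ^ 5"
    proof -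
      have "norm R \<le> norm (K ^ 2 * v ^ 5 / 5) + norm \<rho>" unfolding R_def by (rule norm_triangle_ineq)
      also have "norm (K ^ 2 * v ^ 5 / 5) = k ^ 2 * norm v ^ 5 / 5" by (simp add: norm_mult norm_divide norm_power k)
      also have "norm \<rho> \<le> 2 * (k * norm v) * (k ^ 2 * norm v ^ 5)" using \<rho> by (simp add: eval_nat_numeral mult_ac)
      also have "\<dots> \<le> 2 * (1 / 2) * (k ^ 2 * norm v ^ 5)" using True k by (intro mult_right_mono mult_left_mono) auto
      finally have "norm R \<le> k ^ 2 * norm v ^ 5 / 5 + k ^ 2 * norm v ^ 5" using k by simp
      moreover have "0 \<le> k ^ 2 * norm v ^ 5" by simp
      ultimately show ?thesis by linarith
    qed
    have n\<zeta>: "norm \<zeta> \<le> 2 * (k * norm v ^ 4)"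
    proof -
      have "norm \<zeta> \<le> k * norm v ^ 4 / 4 + 2 * k ^ 2 * norm v ^ 5" unfolding \<zeta>_def using norm_triangle_le nA nR by (meson add_mono norm_triangle_ineq order_trans)
      also have "2 * k ^ 2 * norm v ^ 5 = 2 * (k * norm v) * (k * norm v ^ 4)" by (simp add: eval_nat_numeral mult_ac)
      also have "\<dots> \<le> 2 * (1 / 2) * (k * norm v ^ 4)" using True k by (intro mult_right_mono mult_left_mono) auto
      finally have "norm \<zeta> \<le> k * norm v ^ 4 / 4 + k * norm v ^ 4" using k by simp
      moreover have "0 \<le> k * norm v ^ 4" using k by simp
      ultimately show ?thesis by linarith
    qed
    \<comment> \<open>As \<open>p\<close> contains 1 + A + A^2 / 2, the defect \<zeta>^2 / 2 - A^2 /
      2 equals R (\<zeta> + A) / 2 and is of order h^3.\<close>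
    have "edge_exp n v - exp (v ^ 3 / 3) * p = exp (v ^ 3 / 3) * (exp \<zeta> - (1 + \<zeta> + \<zeta>\<^sup>2 / 2)) + exp (v ^ 3 / 3) * (\<rho> + R * (\<zeta> + A) / 2)"
    proof -
      have "1 + \<zeta> + \<zeta>\<^sup>2 / 2 = p + (\<rho> + R * (\<zeta> + A) / 2)"
        unfolding p_def \<zeta>_def R_def A_def by (simp add: power2_eq_square field_simps eval_nat_numeral)
      then show ?thesis unfolding ee by (simp add: algebra_simps)
    qed
    also have "norm \<dots> \<le> M * (2 * (k * norm v ^ 4)) ^ 3 + M * (2 * k ^ 3 * norm v ^ 6 + 3 * k ^ 3 * norm v ^ 9)"
    proof (rule norm_triangle_le, rule add_mono)
      have "norm (exp (v ^ 3 / 3) * (exp \<zeta> - (1 + \<zeta> + \<zeta>\<^sup>2 / 2))) \<le> norm (exp (v ^ 3 / 3)) * (max 1 (exp (Re \<zeta>)) * norm \<zeta> ^ 3)"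
        unfolding norm_mult by (intro mult_left_mono norm_exp_Taylor2) auto
      \<comment> \<open>Multiplied by the modulus of exp (v^3 / 3), the factor max 1 (exp (Re
        \<zeta>)) becomes the larger of the two moduli already bounded by \<open>M\<close>.\<close>
      also have "\<dots> = max (norm (exp (v ^ 3 / 3))) (norm (edge_exp n v)) * norm \<zeta> ^ 3"
        unfolding ee norm_mult by (simp add: max_def mult_le_cancel_left1)
      also have "\<dots> \<le> M * (2 * (k * norm v ^ 4)) ^ 3"
        using M n\<zeta> by (intro mult_mono power_mono) auto
      finally show "norm (exp (v ^ 3 / 3) * (exp \<zeta> - (1 + \<zeta> + \<zeta>\<^sup>2 / 2))) \<le> M * (2 * (k * norm v ^ 4)) ^ 3" .
      have "norm (\<rho> + R * (\<zeta> + A) / 2) \<le> norm \<rho> + norm R * (norm \<zeta> + norm A) / 2"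
      proof -
        have "norm (R * (\<zeta> + A) / 2) \<le> norm R * (norm \<zeta> + norm A) / 2"
          unfolding norm_divide norm_mult by (simp add: mult_left_mono norm_triangle_ineq)
        then show ?thesis by (intro norm_triangle_le) auto
      qed
      also have "\<dots> \<le> 2 * k ^ 3 * norm v ^ 6 + (2 * k ^ 2 * norm v ^ 5) * (2 * (k * norm v ^ 4) + k * norm v ^ 4 / 4) / 2"
        using \<rho> nR n\<zeta> nA k by (intro add_mono divide_right_mono mult_mono) auto
      also have "\<dots> = 2 * k ^ 3 * norm v ^ 6 + (9 / 4) * (k ^ 3 * norm v ^ 9)" by (simp add: eval_nat_numeral algebra_simps)
      also have "\<dots> \<le> 2 * k ^ 3 * norm v ^ 6 + 3 * k ^ 3 * norm v ^ 9" using k by simp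
      finally show "norm (exp (v ^ 3 / 3) * (\<rho> + R * (\<zeta> + A) / 2)) \<le> M * (2 * k ^ 3 * norm v ^ 6 + 3 * k ^ 3 * norm v ^ 9)"
        unfolding norm_mult using M by (intro mult_mono) auto
    qed
    also have "\<dots> = M * k ^ 3 * (8 * norm v ^ 12 + 2 * norm v ^ 6 + 3 * norm v ^ 9)"
      by (simp add: eval_nat_numeral algebra_simps)
    also have "\<dots> \<le> M * k ^ 3 * (8 * s ^ 12 + 2 * s ^ 12 + 3 * s ^ 12)"
      using M k by (intro mult_left_mono add_mono vpow) auto
    also have "\<dots> \<le> 40 * M * k ^ 3 * s ^ 12" using M k s1 by simp
    finally show ?thesis .
  next
    case False
    have p: "norm p \<le> 4 * s ^ 8"
    proof -
      have 1: "norm A \<le> s ^ 8"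
      proof -
        have "norm A = k * norm v ^ 4 / 4" by (simp add: A_def norm_mult norm_divide norm_power k)
        also have "\<dots> \<le> 1 * norm v ^ 4 / 1" using k by (intro frac_le mult_right_mono) auto
        also have "\<dots> \<le> s ^ 8" using vpow[of 4 8] by simp
        finally show ?thesis .
      qed
      have 2: "norm (K ^ 2 * (v ^ 8 / 32 + v ^ 5 / 5)) \<le> 1 * (s ^ 8 + s ^ 8)"
        unfolding norm_mult
      proof (intro mult_mono)
        show "norm (K ^ 2) \<le> 1" using k by (simp add: norm_power power_le_one)
        have "norm (v ^ 8 / 32) \<le> s ^ 8" "norm (v ^ 5 / 5) \<le> s ^ 8"
          using vpow[of 8 8] vpow[of 5 8] zero_le_power[OF norm_ge_zero[of v], of 8] zero_le_power[OF norm_ge_zero[of v], of 5]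
          unfolding norm_divide norm_power norm_numeral by linarith+
        then show "norm (v ^ 8 / 32 + v ^ 5 / 5) \<le> s ^ 8 + s ^ 8" by (intro norm_triangle_le add_mono)
      qed auto
      have "norm p \<le> norm (1 + A) + norm (K ^ 2 * (v ^ 8 / 32 + v ^ 5 / 5))" unfolding p_def by (rule norm_triangle_ineq)
      also have "norm (1 + A) \<le> norm (1::complex) + norm A" by (rule norm_triangle_ineq)
      also have "norm (1::complex) \<le> s ^ 8" using s1 by simp
      finally show ?thesis using 1 2 by simp
    qed
    have "norm (edge_exp n v - exp (v ^ 3 / 3) * p) \<le> M + M * (4 * s ^ 8)"
      using M p by (intro order_trans[OF norm_triangle_ineq4] add_mono) (auto simp: norm_mult intro!: mult_mono)
    also have "\<dots> \<le> M * (5 * s ^ 8)"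
    proof -
      have "M * 1 \<le> M * s ^ 8" using M s1 by (intro mult_left_mono) auto
      then show ?thesis by linarith
    qed
    also have "\<dots> \<le> M * (5 * s ^ 8) * (8 * (k * s) ^ 3)"
    proof -
      \<comment> \<open>Outside the expansion regime 8 (k s)^3 \<ge> 1, so the wanted power of h can
        be inserted at the price of s^3.\<close>
      have "1 / 2 \<le> k * s" using False vs k mult_left_mono[OF vs, of k] by linarith
      then have "(1 / 2) ^ 3 \<le> (k * s) ^ 3" by (intro power_mono) auto
      then have "1 \<le> 8 * (k * s) ^ 3" by (simp add: eval_nat_numeral)
      then have "M * (5 * s ^ 8) * 1 \<le> M * (5 * s ^ 8) * (8 * (k * s) ^ 3)" using M s1 by (intro mult_left_mono) auto
      then show ?thesis by (simp only: mult_1_right)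
    qed
    also have "\<dots> = 40 * M * k ^ 3 * s ^ 11" by (simp add: eval_nat_numeral algebra_simps)
    also have "\<dots> \<le> 40 * M * k ^ 3 * s ^ 12" using M k s1 by (intro mult_left_mono power_increasing) auto
    finally show ?thesis .
  qed
  moreover have "p = 1 - K * v ^ 4 / 4 + K ^ 2 * (v ^ 8 / 32 + v ^ 5 / 5)" by (simp add: p_def A_def)
  ultimately show ?thesis unfolding w_def v_def[symmetric] M_def s_def K_def k_def by (simp only: mult_ac)
qed

text \<open>From \<open>n (ln (1 + h w) - h w + h\<^sup>2 w\<^sup>2 / 2) = w\<^sup>3 / 3 - h w\<^sup>4 / 4 + h\<^sup>2 w\<^sup>5 / 5 + O (h\<^sup>3)\<close>.\<close>

definition airy_approx :: "real \<Rightarrow> nat \<Rightarrow> real \<Rightarrow> real \<Rightarrow> complex" where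
  "airy_approx \<eta> k h X = airy_int \<eta> k X - of_real h / 4 * airy_int \<eta> (k + 4) X
     + of_real h ^ 2 * (airy_int \<eta> (k + 8) X / 32 + airy_int \<eta> (k + 5) X / 5)"

lemma edge_int_expansion:
  assumes \<eta>: "\<eta> > 0"
  obtains C where "C \<ge> 0" "\<And>n X. n > 0 \<Longrightarrow> edge_h n * \<eta> \<le> 1 / 2 \<Longrightarrow>
    norm (edge_int \<eta> k n X - airy_approx \<eta> k (edge_h n) X) \<le> C * edge_h n ^ 3 * exp (- (\<eta> * X))"
proof
  let ?I = "\<integral>t. (1 + \<eta> + \<bar>t\<bar>) ^ (12 + k) * exp (- (\<eta> / 2 * t\<^sup>2)) \<partial>lborel"
  have I: "?I \<ge> 0" using \<eta> by (intro integral_nonneg_AE) auto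
  show "40 * exp (\<eta> ^ 3 / 3) * ?I \<ge> 0" using I by simp
  fix n X assume n: "n > 0" and h: "edge_h n * \<eta> \<le> 1 / 2"
  define K where "K = complex_of_real (edge_h n)"
  define w where "w t = Complex \<eta> t" for t
  define ex where "ex t = exp (- (w t * of_real X))" for t
  define g where "g j t = w t ^ j * exp (w t ^ 3 / 3 - w t * of_real X)" for j t
  let ?p = "\<lambda>t. 1 - K * w t ^ 4 / 4 + K ^ 2 * (w t ^ 8 / 32 + w t ^ 5 / 5)"
  let ?R = "\<lambda>t. w t ^ k * ((edge_exp n (w t) - exp (w t ^ 3 / 3) * ?p t) * ex t)"
  have gex: "g j t = w t ^ j * (exp (w t ^ 3 / 3) * ex t)" for j t
    by (simp add: g_def ex_def exp_add[symmetric])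
  have R: "?R t = w t ^ k * (edge_exp n (w t) * ex t) - (g k t - K / 4 * g (k + 4) t + K ^ 2 * (g (k + 8) t / 32 + g (k + 5) t / 5))" for t
    unfolding gex by (simp add: power_add field_simps)
  have ig: "integrable lborel (g j)" for j
    using airy_integrand_integrable[OF \<eta>, of j X] by (simp add: g_def[abs_def] w_def)
  have ie: "integrable lborel (\<lambda>t. w t ^ k * (edge_exp n (w t) * ex t))"
    using edge_integrand_integrable[OF n \<eta>, of k X] by (simp add: w_def ex_def)
  have eq: "edge_int \<eta> k n X - airy_approx \<eta> k (edge_h n) X = 1 / (2 * pi) * (\<integral>t. ?R t \<partial>lborel)"
  proof -
    have IR: "(\<integral>t. ?R t \<partial>lborel) = (\<integral>t. w t ^ k * (edge_exp n (w t) * ex t) \<partial>lborel) - (integral\<^sup>L lborel (g k) - K / 4 * integral\<^sup>L lborel (g (k + 4)) + K ^ 2 * (integral\<^sup>L lborel (g (k + 8)) / 32 + integral\<^sup>L lborel (g (k + 5)) / 5))"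
      unfolding R using ig ie by simp
    have Ia: "airy_int \<eta> j X = 1 / (2 * pi) * integral\<^sup>L lborel (g j)" for j
      by (simp add: airy_int_def g_def[abs_def] w_def)
    have Ie: "edge_int \<eta> k n X = 1 / (2 * pi) * (\<integral>t. w t ^ k * (edge_exp n (w t) * ex t) \<partial>lborel)"
      by (simp add: edge_int_def w_def ex_def)
    show ?thesis unfolding airy_approx_def Ia Ie IR unfolding K_def by (simp add: algebra_simps)
  qed
  have 1: "norm (edge_int \<eta> k n X - airy_approx \<eta> k (edge_h n) X) \<le> norm (\<integral>t. ?R t \<partial>lborel)"
    unfolding eq norm_mult[of "complex_of_real (1 / (2 * pi))"]
    using pi_gt3 by (intro mult_left_le_one_le) (auto simp: norm_divide divide_le_eq norm_mult)
  have 2: "norm (\<integral>t. ?R t \<partial>lborel) \<le> (40 * exp (\<eta> ^ 3 / 3) * edge_h n ^ 3 * exp (- (\<eta> * X))) * ?I"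
  proof (rule norm_integral_gaussian_bound[where c="\<eta> / 2" and a="1 + \<eta>" and k="12 + k" and f="?R"])
    show "\<eta> / 2 > 0" using \<eta> by simp
    show "?R \<in> borel_measurable lborel"
      unfolding R
      by (intro borel_measurable_integrable Bochner_Integration.integrable_diff Bochner_Integration.integrable_add
          integrable_mult_right integrable_divide ig ie)
    fix t
    have 1: "norm (w t ^ k) \<le> (1 + \<eta> + \<bar>t\<bar>) ^ k"
      unfolding norm_power w_def using norm_Complex_line_le[of \<eta> t] \<eta> by (intro power_mono) auto
    have 2: "norm (ex t) = exp (- (\<eta> * X))" by (simp add: ex_def w_def)
    have "norm (?R t) \<le> (1 + \<eta> + \<bar>t\<bar>) ^ k * ((40 * exp (\<eta> ^ 3 / 3) * edge_h n ^ 3 * ((1 + \<eta> + \<bar>t\<bar>) ^ 12 * exp (- (\<eta> / 2 * t\<^sup>2)))) * exp (- (\<eta> * X)))"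
      unfolding norm_mult[of "w t ^ k"] norm_mult[of _ "ex t"] 2
      using edge_exp_expansion[OF n \<eta> h, of t] \<eta> edge_h_pos[OF n]
      by (intro mult_mono mult_right_mono 1) (auto simp: w_def K_def)
    then show "norm (?R t) \<le> (40 * exp (\<eta> ^ 3 / 3) * edge_h n ^ 3 * exp (- (\<eta> * X))) * ((1 + \<eta> + \<bar>t\<bar>) ^ (12 + k) * exp (- (\<eta> / 2 * t\<^sup>2)))"
      unfolding power_add by (simp only: mult_ac)
  qed
  show "norm (edge_int \<eta> k n X - airy_approx \<eta> k (edge_h n) X) \<le> 40 * exp (\<eta> ^ 3 / 3) * ?I * edge_h n ^ 3 * exp (- (\<eta> * X))"
    using order_trans[OF 1 2] by (simp only: mult_ac)
qed

section \<open>Edge asymptotics with exponential decay\<close>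

text \<open>The parameter \<open>p\<close> counts powers of h and \<open>m\<close> is the
  exponential rate on X \<ge> s. The rate is explicit because a power of X can only be absorbed at
  the price of a smaller rate.\<close>

definition decay :: "real \<Rightarrow> nat \<Rightarrow> real \<Rightarrow> (nat \<Rightarrow> real \<Rightarrow> 'b::real_normed_vector) \<Rightarrow> bool" where
  "decay s p m f \<longleftrightarrow>
     (\<exists>C. \<forall>\<^sub>F n in sequentially. \<forall>X\<ge>s. norm (f n X) \<le> C * edge_h n ^ p * exp (- (m * X)))"

lemma decayI:
  assumes "\<And>n X. n \<ge> N \<Longrightarrow> n > 0 \<Longrightarrow> X \<ge> s \<Longrightarrow> norm (f n X) \<le> C * edge_h n ^ p * exp (- (m * X))"
  shows "decay s p m f"
  unfolding decay_def
  by (intro exI[of _ C] eventually_sequentiallyI[of "max 1 N"]) (use assms in auto)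

lemma decayE:
  assumes "decay s p m f"
  obtains C N where "C \<ge> 0" "\<And>n X. n \<ge> N \<Longrightarrow> n > 0 \<Longrightarrow> X \<ge> s \<Longrightarrow> norm (f n X) \<le> C * edge_h n ^ p * exp (- (m * X))"
proof -
  from assms obtain C N where C: "\<And>n X. n \<ge> N \<Longrightarrow> X \<ge> s \<Longrightarrow> norm (f n X) \<le> C * edge_h n ^ p * exp (- (m * X))"
    unfolding decay_def eventually_sequentially by blast
  show ?thesis
  proof (rule that[of "\<bar>C\<bar>" N])
    fix n X assume n: "n \<ge> N" "n > 0" "X \<ge> s"
    have "C * (edge_h n ^ p * exp (- (m * X))) \<le> \<bar>C\<bar> * (edge_h n ^ p * exp (- (m * X)))"
      using edge_h_pos[OF n(2)] by (intro mult_right_mono) auto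
    then show "norm (f n X) \<le> \<bar>C\<bar> * edge_h n ^ p * exp (- (m * X))"
      using C[OF n(1,3)] by (simp only: mult.assoc)
  qed simp
qed

lemma exp_rate_mono:
  fixes m m' X s :: real
  assumes "m' \<le> m" "X \<ge> s"
  shows "exp (- (m * X)) \<le> exp ((m - m') * \<bar>s\<bar>) * exp (- (m' * X))"
proof -
  have "0 \<le> (m - m') * (X + \<bar>s\<bar>)" using assms by (intro mult_nonneg_nonneg) auto
  then show ?thesis by (simp add: exp_add[symmetric] algebra_simps)
qed

lemma power_le_exp:
  fixes z e :: real
  assumes "z \<ge> 0" "e > 0"
  shows "z ^ k \<le> (real k / e) ^ k * exp (e * z)"
proof (cases "k = 0")
  case False
  have "e * z / real k \<le> exp (e * z / real k)" using exp_ge_add_one_self[of "e * z / real k"] by linarith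
  then have "z \<le> real k / e * exp (e * z / real k)" using assms False by (simp add: field_simps)
  then have "z ^ k \<le> (real k / e * exp (e * z / real k)) ^ k" using assms by (intro power_mono)
  also have "\<dots> = (real k / e) ^ k * exp (e * z)"
    using False unfolding power_mult_distrib exp_of_nat_mult[symmetric] by simp
  finally show ?thesis .
qed (use assms in simp)

lemma power_absorb:
  fixes m m' s :: real
  assumes "m' < m"
  obtains C where "C \<ge> 0" "\<And>X. X \<ge> s \<Longrightarrow> (1 + \<bar>X\<bar>) ^ k * exp (- (m * X)) \<le> C * exp (- (m' * X))"
proof
  let ?e = "m - m'"
  let ?C = "(real k / ?e) ^ k * exp ?e * exp (2 * ?e * \<bar>s\<bar>)"
  show "?C \<ge> 0" using assms by simp
  fix X assume X: "X \<ge> s"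
  have "?e * \<bar>X\<bar> \<le> ?e * (X + 2 * \<bar>s\<bar>)" using assms X by (intro mult_left_mono) auto
  then have 1: "exp (?e * (1 + \<bar>X\<bar>)) \<le> exp ?e * exp (2 * ?e * \<bar>s\<bar>) * exp (?e * X)"
    by (simp add: exp_add[symmetric] algebra_simps)
  have "(1 + \<bar>X\<bar>) ^ k \<le> (real k / ?e) ^ k * exp (?e * (1 + \<bar>X\<bar>))"
    using assms by (intro power_le_exp) auto
  also have "\<dots> \<le> (real k / ?e) ^ k * (exp ?e * exp (2 * ?e * \<bar>s\<bar>) * exp (?e * X))"
    using assms by (intro mult_left_mono 1) auto
  finally have "(1 + \<bar>X\<bar>) ^ k * exp (- (m * X)) \<le> (real k / ?e) ^ k * (exp ?e * exp (2 * ?e * \<bar>s\<bar>) * exp (?e * X)) * exp (- (m * X))"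
    by (intro mult_right_mono) auto
  also have "\<dots> = ?C * (exp (?e * X) * exp (- (m * X)))" by (simp only: mult_ac)
  also have "exp (?e * X) * exp (- (m * X)) = exp (- (m' * X))" by (simp add: exp_add[symmetric] algebra_simps)
  finally show "(1 + \<bar>X\<bar>) ^ k * exp (- (m * X)) \<le> ?C * exp (- (m' * X))" .
qed

lemma decay_mono:
  assumes "decay s p m f" "p' \<le> p" "m' \<le> m"
  shows "decay s p' m' f"
proof -
  from assms(1) obtain C N where C: "C \<ge> 0" "\<And>n X. n \<ge> N \<Longrightarrow> n > 0 \<Longrightarrow> X \<ge> s \<Longrightarrow> norm (f n X) \<le> C * edge_h n ^ p * exp (- (m * X))"
    by (rule decayE) blast
  show ?thesis
  proof (rule decayI[where N=N and C="C * exp ((m - m') * \<bar>s\<bar>)"])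
    fix n X assume n: "n \<ge> N" "n > 0" "X \<ge> s"
    have "C * edge_h n ^ p * exp (- (m * X)) \<le> C * edge_h n ^ p' * (exp ((m - m') * \<bar>s\<bar>) * exp (- (m' * X)))"
      using C(1) edge_h_pos[OF n(2)] edge_h_le_1[OF n(2)] assms n
      by (intro mult_mono mult_left_mono power_decreasing exp_rate_mono) auto
    then show "norm (f n X) \<le> C * exp ((m - m') * \<bar>s\<bar>) * edge_h n ^ p' * exp (- (m' * X))"
      using C(2)[OF n] by (simp only: mult_ac)
  qed
qed

lemma decay_cong:
  assumes "\<And>n X. n > 0 \<Longrightarrow> f n X = g n X" "decay s p m f"
  shows "decay s p m g"
proof -
  from assms(2) obtain C N where C: "C \<ge> 0" "\<And>n X. n \<ge> N \<Longrightarrow> n > 0 \<Longrightarrow> X \<ge> s \<Longrightarrow> norm (f n X) \<le> C * edge_h n ^ p * exp (- (m * X))"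
    by (rule decayE) blast
  show ?thesis by (rule decayI[where N=N and C=C]) (use C(2) assms(1) in metis)
qed

lemma decay_add:
  assumes "decay s p m f" "decay s p m g"
  shows "decay s p m (\<lambda>n X. f n X + g n X)"
proof -
  from assms(1) obtain C N where C: "C \<ge> 0" "\<And>n X. n \<ge> N \<Longrightarrow> n > 0 \<Longrightarrow> X \<ge> s \<Longrightarrow> norm (f n X) \<le> C * edge_h n ^ p * exp (- (m * X))"
    by (rule decayE) blast
  from assms(2) obtain D M where D: "D \<ge> 0" "\<And>n X. n \<ge> M \<Longrightarrow> n > 0 \<Longrightarrow> X \<ge> s \<Longrightarrow> norm (g n X) \<le> D * edge_h n ^ p * exp (- (m * X))"
    by (rule decayE) blast
  show ?thesis
  proof (rule decayI[where N="max N M" and C="C + D"])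
    fix n X assume n: "n \<ge> max N M" "n > 0" "X \<ge> s"
    have "norm (f n X + g n X) \<le> C * edge_h n ^ p * exp (- (m * X)) + D * edge_h n ^ p * exp (- (m * X))"
      using n by (intro norm_triangle_le add_mono C D) auto
    then show "norm (f n X + g n X) \<le> (C + D) * edge_h n ^ p * exp (- (m * X))" by (simp add: algebra_simps)
  qed
qed

lemma decay_cmult:
  fixes f :: "nat \<Rightarrow> real \<Rightarrow> 'b::real_normed_div_algebra"
  assumes "decay s p m f"
  shows "decay s p m (\<lambda>n X. c * f n X)"
proof -
  from assms obtain C N where C: "C \<ge> 0" "\<And>n X. n \<ge> N \<Longrightarrow> n > 0 \<Longrightarrow> X \<ge> s \<Longrightarrow> norm (f n X) \<le> C * edge_h n ^ p * exp (- (m * X))"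
    by (rule decayE) blast
  show ?thesis
  proof (rule decayI[where N=N and C="norm c * C"])
    fix n X assume n: "n \<ge> N" "n > 0" "X \<ge> s"
    show "norm (c * f n X) \<le> norm c * C * edge_h n ^ p * exp (- (m * X))"
      using mult_left_mono[OF C(2)[OF n], of "norm c"] by (simp add: norm_mult mult.assoc)
  qed
qed

lemma decay_minus: "decay s p m f \<Longrightarrow> decay s p m (\<lambda>n X. - f n X)"
  by (simp add: decay_def)

lemma decay_diff: "decay s p m f \<Longrightarrow> decay s p m g \<Longrightarrow> decay s p m (\<lambda>n X. f n X - g n X)"
  using decay_add[OF _ decay_minus, of s p m f g] by simp

lemma decay_h:
  fixes f :: "nat \<Rightarrow> real \<Rightarrow> 'b::real_normed_div_algebra"
  assumes "decay s p m f"
  shows "decay s (p + q) m (\<lambda>n X. of_real (edge_h n) ^ q * f n X)"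
proof -
  from assms obtain C N where C: "C \<ge> 0" "\<And>n X. n \<ge> N \<Longrightarrow> n > 0 \<Longrightarrow> X \<ge> s \<Longrightarrow> norm (f n X) \<le> C * edge_h n ^ p * exp (- (m * X))"
    by (rule decayE) blast
  show ?thesis
  proof (rule decayI[where N=N and C=C])
    fix n X assume n: "n \<ge> N" "n > 0" "X \<ge> s"
    show "norm (of_real (edge_h n) ^ q * f n X) \<le> C * edge_h n ^ (p + q) * exp (- (m * X))"
      using mult_left_mono[OF C(2)[OF n], of "edge_h n ^ q"] edge_h_pos[OF n(2)]
      by (simp add: norm_mult norm_power power_add mult_ac)
  qed
qed

lemma decay_power:
  fixes f :: "nat \<Rightarrow> real \<Rightarrow> 'b::real_normed_div_algebra"
  assumes "decay s p m f" "m' < m"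
  shows "decay s p m' (\<lambda>n X. of_real X ^ k * f n X)"
proof -
  from assms(1) obtain C N where C: "C \<ge> 0" "\<And>n X. n \<ge> N \<Longrightarrow> n > 0 \<Longrightarrow> X \<ge> s \<Longrightarrow> norm (f n X) \<le> C * edge_h n ^ p * exp (- (m * X))"
    by (rule decayE) blast
  obtain D where D: "D \<ge> 0" "\<And>X. X \<ge> s \<Longrightarrow> (1 + \<bar>X\<bar>) ^ k * exp (- (m * X)) \<le> D * exp (- (m' * X))"
    using power_absorb[OF assms(2), of s k] by blast
  show ?thesis
  proof (rule decayI[where N=N and C="C * D"])
    fix n X assume n: "n \<ge> N" "n > 0" "X \<ge> s"
    have "norm (of_real X ^ k * f n X) = \<bar>X\<bar> ^ k * norm (f n X)" by (simp add: norm_mult norm_power)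
    also have "\<dots> \<le> (1 + \<bar>X\<bar>) ^ k * (C * edge_h n ^ p * exp (- (m * X)))"
      by (intro mult_mono power_mono C n) auto
    also have "\<dots> = C * edge_h n ^ p * ((1 + \<bar>X\<bar>) ^ k * exp (- (m * X)))" by (simp only: mult_ac)
    also have "\<dots> \<le> C * edge_h n ^ p * (D * exp (- (m' * X)))"
      using C(1) edge_h_pos[OF n(2)] by (intro mult_left_mono D n) auto
    finally show "norm (of_real X ^ k * f n X) \<le> C * D * edge_h n ^ p * exp (- (m' * X))" by (simp only: mult_ac)
  qed
qed

lemma decay_of_real: "decay s p m (\<lambda>n X. of_real (f n X) :: 'b::real_normed_algebra_1) \<longleftrightarrow> decay s p m f"
  by (simp add: decay_def)

lemma decay_airy_int:
  assumes "\<eta> > 0" "m \<le> \<eta>"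
  shows "decay s 0 m (\<lambda>n. airy_int \<eta> k)"
proof -
  obtain C where "\<And>X. norm (airy_int \<eta> k X) \<le> C * exp (- (\<eta> * X))" "C \<ge> 0"
    using airy_int_bound[OF assms(1), of k] by blast
  then have "decay s 0 \<eta> (\<lambda>n. airy_int \<eta> k)" by (intro decayI[where N=0 and C=C]) auto
  then show ?thesis using assms(2) by (rule decay_mono[OF _ order_refl])
qed

text \<open>The contour is free, so \<eta> = max 1 m reaches any prescribed rate.\<close>

lemma decay_Airy: "decay s 0 m (\<lambda>n. Airy)" "decay s 0 m (\<lambda>n. Airy')"
proof -
  have "decay s 0 m (\<lambda>n X. complex_of_real (Airy X))" "decay s 0 m (\<lambda>n X. complex_of_real (Airy' X))"
    using decay_airy_int[of "max 1 m" m s 0] decay_minus[OF decay_airy_int[of "max 1 m" m s 1]]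
    by (simp_all add: Airy_eq_airy_int[of "max 1 m"] deriv_Airy_eq_airy_int[of "max 1 m"] eta_contract_eq)
  then show "decay s 0 m (\<lambda>n. Airy)" "decay s 0 m (\<lambda>n. Airy')" by (simp_all only: decay_of_real)
qed

lemma airy_int_values:
  fixes X :: real
  assumes "\<eta> > 0"
  defines "x \<equiv> complex_of_real X" and "a \<equiv> complex_of_real (Airy X)" and "b \<equiv> complex_of_real (Airy' X)"
  shows "airy_int \<eta> 0 X = a" "airy_int \<eta> 1 X = - b"
    "airy_int \<eta> 4 X = x ^ 2 * a + 2 * b"
    "airy_int \<eta> 5 X = - (x ^ 2 * b) - 4 * x * a"
    "airy_int \<eta> 6 X = x ^ 3 * a + 6 * x * b + 4 * a"
    "airy_int \<eta> 8 X = x ^ 4 * a + 12 * x ^ 2 * b + 28 * x * a"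
    "airy_int \<eta> 9 X = - (x ^ 4 * b) - 16 * x ^ 3 * a - 52 * x * b - 28 * a"
proof -
  have rec: "airy_int \<eta> (k + 2) X = x * airy_int \<eta> k X - of_nat k * airy_int \<eta> (k - 1) X" for k
    using airy_int_rec[OF assms(1)] by (simp add: x_def)
  have 0: "airy_int \<eta> 0 X = a" using Airy_eq_airy_int[OF assms(1)] by (simp add: a_def)
  have 1: "airy_int \<eta> 1 X = - b" using deriv_Airy_eq_airy_int[OF assms(1)] by (simp add: b_def)
  have 2: "airy_int \<eta> 2 X = x * a" using rec[of 0] 0 by (simp add: numeral_2_eq_2)
  have 3: "airy_int \<eta> 3 X = - (x * b) - a" using rec[of 1] 0 1 by (simp add: numeral_3_eq_3)
  have 4: "airy_int \<eta> 4 X = x ^ 2 * a + 2 * b" using rec[of 2] 2 1 by (simp add: power2_eq_square algebra_simps)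
  have 5: "airy_int \<eta> 5 X = - (x ^ 2 * b) - 4 * x * a" using rec[of 3] 3 2 by (simp add: power2_eq_square algebra_simps)
  have 6: "airy_int \<eta> 6 X = x ^ 3 * a + 6 * x * b + 4 * a"
  proof -
    have "airy_int \<eta> 6 X = x * airy_int \<eta> 4 X - of_nat 4 * airy_int \<eta> 3 X" using rec[of 4] by simp
    then show ?thesis unfolding 4 3 by (simp add: eval_nat_numeral algebra_simps)
  qed
  have 7: "airy_int \<eta> 7 X = - (x ^ 3 * b) - 9 * x ^ 2 * a - 10 * b"
  proof -
    have "airy_int \<eta> 7 X = x * airy_int \<eta> 5 X - of_nat 5 * airy_int \<eta> 4 X" using rec[of 5] by simp
    then show ?thesis unfolding 5 4 by (simp add: eval_nat_numeral algebra_simps)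
  qed
  have 8: "airy_int \<eta> 8 X = x ^ 4 * a + 12 * x ^ 2 * b + 28 * x * a"
  proof -
    have "airy_int \<eta> 8 X = x * airy_int \<eta> 6 X - of_nat 6 * airy_int \<eta> 5 X" using rec[of 6] by simp
    then show ?thesis unfolding 6 5 by (simp add: eval_nat_numeral algebra_simps)
  qed
  have 9: "airy_int \<eta> 9 X = - (x ^ 4 * b) - 16 * x ^ 3 * a - 52 * x * b - 28 * a"
  proof -
    have "airy_int \<eta> 9 X = x * airy_int \<eta> 7 X - of_nat 7 * airy_int \<eta> 6 X" using rec[of 7] by simp
    then show ?thesis unfolding 7 6 by (simp add: eval_nat_numeral algebra_simps)
  qed
  show "airy_int \<eta> 0 X = a" "airy_int \<eta> 1 X = - b"
    "airy_int \<eta> 4 X = x ^ 2 * a + 2 * b"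
    "airy_int \<eta> 5 X = - (x ^ 2 * b) - 4 * x * a"
    "airy_int \<eta> 6 X = x ^ 3 * a + 6 * x * b + 4 * a"
    "airy_int \<eta> 8 X = x ^ 4 * a + 12 * x ^ 2 * b + 28 * x * a"
    "airy_int \<eta> 9 X = - (x ^ 4 * b) - 16 * x ^ 3 * a - 52 * x * b - 28 * a"
    by (fact 0 1 4 5 6 8 9)+
qed

text \<open>For \<open>h X\<close> large the contour is moved to \<open>Re w = h X\<close>, where the exponent is at most
  \<open>- h X\<^sup>2 / 2\<close>; this beats the prefactor \<open>exp (h X\<^sup>2 / 4)\<close>.\<close>

lemma edge_int_tail:
  obtains C where "C \<ge> 0" "\<And>n X. n > 0 \<Longrightarrow> edge_h n * X \<ge> 16 \<Longrightarrow>
    norm (edge_int (edge_h n * X) k n X) \<le> C * (1 + X) ^ k * exp (- (edge_h n * X\<^sup>2 / 2))"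
proof
  let ?I = "\<integral>t. (1 + \<bar>t\<bar>) ^ k * exp (- (2 / 5 * t\<^sup>2)) \<partial>(lborel :: real measure)"
  show I: "?I \<ge> 0" by (intro integral_nonneg_AE) auto
  fix n X assume n: "n > 0" and hX: "edge_h n * X \<ge> 16"
  define h where "h = edge_h n"
  define \<eta> where "\<eta> = h * X"
  define a where "a = h * \<eta>"
  have h: "h > 0" "h \<le> 1" "real n * h ^ 3 = 1" using edge_h_pos[OF n] edge_h_le_1[OF n] edge_h_cube[OF n] by (auto simp: h_def)
  have \<eta>: "\<eta> \<ge> 16" using hX by (simp add: \<eta>_def h_def)
  have X: "X \<ge> 16"
  proof -
    have "X > 0" using \<eta> h by (simp add: \<eta>_def zero_less_mult_iff) (smt (verit) mult_nonneg_nonpos)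
    then have "h * X \<le> 1 * X" using h by (intro mult_right_mono) auto
    then show ?thesis using \<eta> by (simp add: \<eta>_def)
  qed
  have \<eta>X: "\<eta> \<le> X" using mult_right_mono[of h 1 X] h X by (simp add: \<eta>_def)
  have a: "a > 0" "a \<le> \<eta>" using h \<eta> mult_right_mono[of h 1 \<eta>] by (auto simp: a_def)
  \<comment> \<open>Since a \<le> \<eta> and \<eta> \<ge> 16, the Gaussian rate stays bounded below
    although the contour moves with X.\<close>
  have rate: "2 / 5 \<le> \<eta> * (2 + a) / (2 * (1 + a)\<^sup>2)"
  proof -
    have "2 / 5 \<le> \<eta> / (2 * (1 + \<eta>))" using \<eta> by (simp add: field_simps)
    also have "\<dots> \<le> \<eta> / (2 * (1 + a))" using \<eta> a by (intro divide_left_mono) auto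
    also have "\<dots> = \<eta> * (1 + a) / (2 * (1 + a)\<^sup>2)" using a by (simp add: power2_eq_square)
    also have "\<dots> \<le> \<eta> * (2 + a) / (2 * (1 + a)\<^sup>2)" using \<eta> a by (intro divide_right_mono mult_left_mono) auto
    finally show ?thesis .
  qed
  \<comment> \<open>With ln (1 + a) \<le> a the growth is at most n a^2 / 2 = h X^2 / 2, against
    \<eta> X = h X^2.\<close>
  have expo: "n * (ln (1 + a) - a + a\<^sup>2 / 2) - \<eta> * X \<le> - (h * X\<^sup>2 / 2)"
  proof -
    have "ln (1 + a) \<le> a" using ln_add_one_self_le_self[of a] a by simp
    then have "real n * (ln (1 + a) - a + a\<^sup>2 / 2) \<le> real n * (a\<^sup>2 / 2)" by (intro mult_left_mono) auto
    also have "\<dots> = (real n * h ^ 3) * (h * X\<^sup>2 / 2)" by (simp add: a_def \<eta>_def eval_nat_numeral)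
    finally show ?thesis unfolding h by (simp add: \<eta>_def power2_eq_square)
  qed
  have "norm (edge_int \<eta> k n X) \<le> norm (\<integral>t. Complex \<eta> t ^ k * (edge_exp n (Complex \<eta> t) * exp (- (Complex \<eta> t * of_real X))) \<partial>lborel)"
    using pi_gt3 unfolding edge_int_def norm_mult[of "complex_of_real (1 / (2 * pi))"]
    by (intro mult_left_le_one_le) (auto simp: norm_divide divide_le_eq norm_mult)
  also have "\<dots> \<le> ((1 + X) ^ k * exp (- (h * X\<^sup>2 / 2))) * ?I"
  proof (rule norm_integral_gaussian_bound[OF _ borel_measurable_continuous_lborel[OF edge_integrand_continuous]])
    fix t
    have pos: "\<eta> + \<bar>t\<bar> \<le> (1 + X) * (1 + \<bar>t\<bar>)"
    proof -
      have "0 \<le> X * \<bar>t\<bar>" using X by simp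
      moreover have "(1 + X) * (1 + \<bar>t\<bar>) = 1 + X + \<bar>t\<bar> + X * \<bar>t\<bar>" by (simp add: algebra_simps)
      ultimately show ?thesis using \<eta>X by linarith
    qed
    have "norm (Complex \<eta> t ^ k * (edge_exp n (Complex \<eta> t) * exp (- (Complex \<eta> t * of_real X))))
       \<le> exp (n * (ln (1 + a) - a + a\<^sup>2 / 2) - \<eta> * X) * ((\<eta> + \<bar>t\<bar>) ^ k * exp (- (\<eta> * (2 + a) / (2 * (1 + a)\<^sup>2) * t\<^sup>2)))"
      using norm_edge_integrand[OF n, of \<eta> t k X] \<eta> by (simp add: a_def h_def)
    also have "\<dots> \<le> exp (- (h * X\<^sup>2 / 2)) * (((1 + X) * (1 + \<bar>t\<bar>)) ^ k * exp (- (2 / 5 * t\<^sup>2)))"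
    proof (intro mult_mono power_mono pos)
      show "exp (- (\<eta> * (2 + a) / (2 * (1 + a)\<^sup>2) * t\<^sup>2)) \<le> exp (- (2 / 5 * t\<^sup>2))"
        using mult_right_mono[OF rate, of "t\<^sup>2"] by simp
    qed (use expo \<eta> X in auto)
    also have "\<dots> = ((1 + X) ^ k * exp (- (h * X\<^sup>2 / 2))) * ((1 + \<bar>t\<bar>) ^ k * exp (- (2 / 5 * t\<^sup>2)))"
      by (simp only: power_mult_distrib mult_ac)
    finally show "norm (Complex \<eta> t ^ k * (edge_exp n (Complex \<eta> t) * exp (- (Complex \<eta> t * of_real X)))) \<le> \<dots>" .
  qed simp
  finally show "norm (edge_int (edge_h n * X) k n X) \<le> ?I * (1 + X) ^ k * exp (- (edge_h n * X\<^sup>2 / 2))"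
    unfolding \<eta>_def h_def by (simp only: mult_ac)
qed

lemma decay_edge_int_diff:
  assumes \<eta>: "\<eta> > 0"
  shows "decay s 3 \<eta> (\<lambda>n X. edge_int \<eta> k n X - airy_approx \<eta> k (edge_h n) X)"
proof -
  obtain C where C: "C \<ge> 0" "\<And>n X. n > 0 \<Longrightarrow> edge_h n * \<eta> \<le> 1 / 2 \<Longrightarrow>
    norm (edge_int \<eta> k n X - airy_approx \<eta> k (edge_h n) X) \<le> C * edge_h n ^ 3 * exp (- (\<eta> * X))"
    using edge_int_expansion[OF \<eta>, of k] by blast
  have "((\<lambda>n. edge_h n * \<eta>) \<longlongrightarrow> 0) sequentially"
    unfolding edge_h_def by real_asymp
  then have "\<forall>\<^sub>F n in sequentially. edge_h n * \<eta> < 1 / 2" by (rule order_tendstoD) simp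
  then obtain N where "\<And>n. n \<ge> N \<Longrightarrow> edge_h n * \<eta> < 1 / 2" by (auto simp: eventually_sequentially)
  then show ?thesis by (intro decayI[where N=N and C=C] C(2)) (auto intro: less_imp_le)
qed

lemma decay_airy_approx:
  assumes "\<eta> > 0" "m \<le> \<eta>"
  shows "decay s 0 m (\<lambda>n X. airy_approx \<eta> k (edge_h n) X)"
proof -
  note A = decay_airy_int[OF assms, of s]
  have "decay s 0 m (\<lambda>n X. airy_int \<eta> k X - of_real (edge_h n) ^ 1 * ((1 / 4) * airy_int \<eta> (k + 4) X)
     + of_real (edge_h n) ^ 2 * ((1 / 32) * airy_int \<eta> (k + 8) X + (1 / 5) * airy_int \<eta> (k + 5) X))"
    by (intro decay_add decay_diff A decay_mono[OF decay_h[of s 0 m]] decay_cmult) simp_all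
  then show ?thesis by (rule decay_cong[rotated]) (simp add: airy_approx_def)
qed

text \<open>Multiplying the expansion of a contour integral by \<open>exp (h X\<^sup>2 / 4)\<close>: for \<open>h X \<le> 16\<close> this
  factor is at most \<open>exp (4 X)\<close>, and for \<open>h X > 16\<close> all terms are already of order \<open>h\<^sup>3\<close>.\<close>

lemma decay_edge_factor:
  fixes V Va :: "nat \<Rightarrow> real \<Rightarrow> complex"
  assumes V: "decay s 3 7 (\<lambda>n X. V n X - Va n X)" and Va: "decay s 0 7 Va"
    and tail: "\<And>n X. n > 0 \<Longrightarrow> edge_h n * X \<ge> 16 \<Longrightarrow> norm (V n X) \<le> D * (1 + X)\<^sup>2 * exp (- (edge_h n * X\<^sup>2 / 2))"
    and D: "D \<ge> 0"
  shows "decay s 3 2 (\<lambda>n X. of_real (stirling_ratio n * exp (edge_h n * X\<^sup>2 / 4)) * V n X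
     - of_real (1 + edge_h n * X\<^sup>2 / 4 + edge_h n ^ 2 * X ^ 4 / 32) * Va n X)"
proof -
  obtain C1 N1 where C1: "C1 \<ge> 0" "\<And>n X. n \<ge> N1 \<Longrightarrow> n > 0 \<Longrightarrow> X \<ge> s \<Longrightarrow> norm (V n X - Va n X) \<le> C1 * edge_h n ^ 3 * exp (- (7 * X))"
    using V by (rule decayE) blast
  obtain C2 N2 where C2: "C2 \<ge> 0" "\<And>n X. n \<ge> N2 \<Longrightarrow> n > 0 \<Longrightarrow> X \<ge> s \<Longrightarrow> norm (Va n X) \<le> C2 * edge_h n ^ 0 * exp (- (7 * X))"
    using Va by (rule decayE) blast
  obtain P where P: "P \<ge> 0" "\<And>X. X \<ge> s \<Longrightarrow> (1 + \<bar>X\<bar>) ^ 7 * exp (- (3 * X)) \<le> P * exp (- (2 * X))"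
    using power_absorb[of 2 3 s 7] by auto
  \<comment> \<open>The constant covers negative X: there h X^2 / 4 is at most s^2 / 4, and exp (8
    |s|) compensates a small exp (4 X).\<close>
  define C3 where "C3 = exp (s\<^sup>2 / 4) * exp (8 * \<bar>s\<bar>)"
  have C3: "C3 \<ge> 1" unfolding C3_def exp_add[symmetric] by simp
  let ?C = "(C3 * (C1 + 2 * C2) + (D + 3 * C2 * exp (4 * \<bar>s\<bar>))) * P"
  show ?thesis
  proof (rule decayI[where N="max N1 N2" and C="?C"])
    fix n X assume n: "n \<ge> max N1 N2" "n > 0" and X: "X \<ge> s"
    define h where "h = edge_h n"
    have h: "0 < h" "h \<le> 1" using edge_h_pos[OF n(2)] edge_h_le_1[OF n(2)] by (auto simp: h_def)
    define E where "E = exp (h * X\<^sup>2 / 4)"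
    define T where "T = 1 + h * X\<^sup>2 / 4 + h ^ 2 * X ^ 4 / 32"
    define \<kappa> where "\<kappa> = stirling_ratio n"
    have \<kappa>: "0 \<le> \<kappa>" "\<kappa> \<le> 1" "1 - \<kappa> \<le> h ^ 3"
    proof -
      have "1 / real n = h ^ 3" using edge_h_cube[OF n(2)] n by (simp add: h_def field_simps)
      then show "0 \<le> \<kappa>" "\<kappa> \<le> 1" "1 - \<kappa> \<le> h ^ 3"
        using stirling_ratio_bounds[OF n(2)] stirling_ratio_pos[OF n(2)] by (auto simp: \<kappa>_def)
    qed
    define x where "x = 1 + \<bar>X\<bar>"
    have x: "x \<ge> 1" "\<bar>X\<bar> \<le> x" by (auto simp: x_def)
    have v: "norm (V n X - Va n X) \<le> C1 * h ^ 3 * exp (- (7 * X))" "norm (Va n X) \<le> C2 * exp (- (7 * X))"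
      using C1(2)[of n X] C2(2)[of n X] n X by (auto simp: h_def)
    have Xp: "\<bar>X\<bar> ^ i \<le> x ^ 7" if "i \<le> 7" for i
      using power_mono[OF x(2), of i] power_increasing[OF that x(1)] by simp
    have main: "norm (of_real (\<kappa> * E) * V n X - of_real T * Va n X)
       \<le> (C3 * (C1 + 2 * C2) + (D + 3 * C2 * exp (4 * \<bar>s\<bar>))) * h ^ 3 * (x ^ 7 * exp (- (3 * X)))"
    proof (cases "h * X \<le> 16")
      case True
      have hX: "h * X\<^sup>2 / 4 \<le> 4 * X + (s\<^sup>2 / 4 + 8 * \<bar>s\<bar>)"
      proof (cases "X \<ge> 0")
        case pos: True
        have "h * X\<^sup>2 = (h * X) * X" by (simp add: power2_eq_square)
        also have "\<dots> \<le> 16 * X" using True pos by (intro mult_right_mono)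
        finally have "h * X\<^sup>2 / 4 \<le> 4 * X" by simp
        moreover have "0 \<le> s\<^sup>2 / 4 + 8 * \<bar>s\<bar>" by simp
        ultimately show ?thesis by linarith
      next
        case False
        have "X\<^sup>2 \<le> s\<^sup>2" using False X by (intro power2_mono) auto
        then have "h * X\<^sup>2 \<le> 1 * s\<^sup>2" using h by (intro mult_mono) auto
        moreover have "4 * X \<ge> - (8 * \<bar>s\<bar>)" using X False by linarith
        ultimately show ?thesis by simp
      qed
      then have E: "E \<le> C3 * exp (4 * X)" unfolding E_def C3_def exp_add[symmetric] by (simp add: algebra_simps)
      have one: "1 \<le> C3 * exp (4 * X)"
      proof -
        have "0 \<le> s\<^sup>2 / 4 + 8 * \<bar>s\<bar> + 4 * X" using X zero_le_power2[of s] by linarith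
        then show ?thesis unfolding C3_def exp_add[symmetric] by simp
      qed
      have E0: "0 \<le> E" by (simp add: E_def)
      have k1: "\<bar>\<kappa> * E\<bar> \<le> 1 * (C3 * exp (4 * X))"
        unfolding abs_mult using \<kappa> E E0 by (intro mult_mono) auto
      have k2: "\<bar>(\<kappa> - 1) * E\<bar> \<le> h ^ 3 * (C3 * exp (4 * X))"
        unfolding abs_mult using \<kappa> E E0 h by (intro mult_mono) auto
      have ET: "\<bar>E - T\<bar> \<le> (C3 * exp (4 * X)) * (h ^ 3 * x ^ 7)"
      proof -
        define z where "z = h * X\<^sup>2 / 4"
        have z0: "z \<ge> 0" using h by (simp add: z_def)
        have eq: "exp (complex_of_real z) - (1 + of_real z + (of_real z)\<^sup>2 / 2) = of_real (E - T)"
          by (simp add: E_def T_def z_def exp_of_real[symmetric] power_divide power_mult_distrib power_mult[symmetric])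
        have "norm (complex_of_real (E - T)) \<le> max 1 (exp (Re (complex_of_real z))) * norm (complex_of_real z) ^ 3"
          using norm_exp_Taylor2[of "complex_of_real z"] unfolding eq .
        then have "\<bar>E - T\<bar> \<le> max 1 E * z ^ 3"
          unfolding norm_of_real Re_complex_of_real abs_of_nonneg[OF z0] by (simp only: E_def z_def)
        also have "\<dots> \<le> (C3 * exp (4 * X)) * (h ^ 3 * x ^ 7)"
        proof (intro mult_mono)
          have "z ^ 3 = h ^ 3 * \<bar>X\<bar> ^ 6 / 64" by (simp add: z_def power_divide power_mult_distrib power_mult[symmetric] power_even_abs)
          also have "\<dots> \<le> h ^ 3 * \<bar>X\<bar> ^ 6" using h by (simp add: divide_le_eq)
          also have "\<dots> \<le> h ^ 3 * x ^ 7" using h by (intro mult_left_mono Xp) auto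
          finally show "z ^ 3 \<le> h ^ 3 * x ^ 7" .
        qed (use E one z0 C3 in auto)
        finally show ?thesis .
      qed
      \<comment> \<open>Three errors of order h^3 are separated: the expansion of the integral, the
        normalisation constant, and the Taylor remainder of exp (h X^2 / 4).\<close>
      have "of_real (\<kappa> * E) * V n X - of_real T * Va n X = of_real (\<kappa> * E) * (V n X - Va n X) + (of_real ((\<kappa> - 1) * E) * Va n X + of_real (E - T) * Va n X)"
        by (simp add: algebra_simps)
      also have "norm \<dots> \<le> (1 * (C3 * exp (4 * X))) * (C1 * h ^ 3 * exp (- (7 * X))) + ((h ^ 3 * (C3 * exp (4 * X))) * (C2 * exp (- (7 * X))) + ((C3 * exp (4 * X)) * (h ^ 3 * x ^ 7)) * (C2 * exp (- (7 * X))))"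
      proof (intro norm_triangle_le add_mono)
        show "norm (of_real (\<kappa> * E) * (V n X - Va n X)) \<le> (1 * (C3 * exp (4 * X))) * (C1 * h ^ 3 * exp (- (7 * X)))"
          unfolding norm_mult[of _ "V n X - Va n X"] norm_of_real using C3 by (intro mult_mono k1 v(1)) auto
        show "norm (of_real ((\<kappa> - 1) * E) * Va n X) \<le> (h ^ 3 * (C3 * exp (4 * X))) * (C2 * exp (- (7 * X)))"
          unfolding norm_mult[of _ "Va n X"] norm_of_real using C3 h by (intro mult_mono k2 v(2)) auto
        show "norm (of_real (E - T) * Va n X) \<le> ((C3 * exp (4 * X)) * (h ^ 3 * x ^ 7)) * (C2 * exp (- (7 * X)))"
          unfolding norm_mult[of _ "Va n X"] norm_of_real using C3 h x by (intro mult_mono ET v(2)) auto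
      qed
      also have "\<dots> = C3 * (C1 + C2 + C2 * x ^ 7) * h ^ 3 * (exp (4 * X) * exp (- (7 * X)))" by (simp add: algebra_simps)
      also have "exp (4 * X) * exp (- (7 * X)) = exp (- (3 * X))" by (simp add: exp_add[symmetric])
      also have "C3 * (C1 + C2 + C2 * x ^ 7) * h ^ 3 * exp (- (3 * X)) \<le> (C3 * ((C1 + 2 * C2) * x ^ 7)) * h ^ 3 * exp (- (3 * X))"
      proof (intro mult_right_mono mult_left_mono)
        have "(C1 + C2) * 1 \<le> (C1 + C2) * x ^ 7" using C1(1) C2(1) x by (intro mult_left_mono one_le_power) auto
        then show "C1 + C2 + C2 * x ^ 7 \<le> (C1 + 2 * C2) * x ^ 7" by (simp add: algebra_simps)
      qed (use C3 h in auto)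
      also have "\<dots> = (C3 * (C1 + 2 * C2)) * h ^ 3 * (x ^ 7 * exp (- (3 * X)))" by (simp only: mult_ac)
      also have "\<dots> \<le> (C3 * (C1 + 2 * C2) + (D + 3 * C2 * exp (4 * \<bar>s\<bar>))) * h ^ 3 * (x ^ 7 * exp (- (3 * X)))"
        using D C2(1) h x by (intro mult_right_mono) auto
      finally show ?thesis .
    next
      case False
      then have hX: "h * X \<ge> 16" by simp
      have X0: "X > 0"
      proof (rule ccontr)
        assume "\<not> X > 0"
        then have "h * X \<le> 0" using h by (intro mult_nonneg_nonpos) auto
        then show False using hX by simp
      qed
      \<comment> \<open>In this range h^3 X^3 \<ge> 1 supplies the missing h^3; the factor X^3 is
        absorbed by the exponential decay.\<close>
      have hX3: "1 \<le> h ^ 3 * X ^ 3" unfolding power_mult_distrib[symmetric] using hX by (intro one_le_power) simp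
      have a: "norm (of_real (\<kappa> * E) * V n X) \<le> D * h ^ 3 * (x ^ 7 * exp (- (3 * X)))"
      proof -
        have "norm (of_real (\<kappa> * E) * V n X) \<le> (1 * E) * (D * (1 + X)\<^sup>2 * exp (- (h * X\<^sup>2 / 2)))"
        proof -
          have "\<bar>\<kappa> * E\<bar> \<le> 1 * E" unfolding abs_mult using \<kappa> by (intro mult_mono) (auto simp: E_def)
          then show ?thesis unfolding norm_mult[of _ "V n X"] norm_of_real
            using tail[OF n(2), of X] hX by (intro mult_mono) (auto simp: E_def h_def)
        qed
        also have "\<dots> = D * x\<^sup>2 * (exp (h * X\<^sup>2 / 4) * exp (- (h * X\<^sup>2 / 2)))" using X0 by (simp add: E_def x_def)
        also have "exp (h * X\<^sup>2 / 4) * exp (- (h * X\<^sup>2 / 2)) = exp (- (h * X\<^sup>2 / 4))" by (simp add: exp_add[symmetric])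
        also have "D * x\<^sup>2 * exp (- (h * X\<^sup>2 / 4)) \<le> D * x\<^sup>2 * exp (- (3 * X))"
        proof -
          have "16 * X \<le> h * X * X" using hX X0 by (intro mult_right_mono) auto
          then have "3 * X \<le> h * X\<^sup>2 / 4" using X0 by (simp add: power2_eq_square)
          then show ?thesis using D by (intro mult_left_mono) auto
        qed
        also have "\<dots> \<le> D * x\<^sup>2 * exp (- (3 * X)) * (h ^ 3 * X ^ 3)"
        proof -
          have "D * x\<^sup>2 * exp (- (3 * X)) * 1 \<le> D * x\<^sup>2 * exp (- (3 * X)) * (h ^ 3 * X ^ 3)"
            using hX3 D by (intro mult_left_mono) auto
          then show ?thesis by (simp only: mult_1_right)
        qed
        also have "\<dots> = D * h ^ 3 * ((x\<^sup>2 * X ^ 3) * exp (- (3 * X)))" by (simp only: mult_ac)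
        also have "\<dots> \<le> D * h ^ 3 * (x ^ 7 * exp (- (3 * X)))"
        proof (intro mult_left_mono mult_right_mono)
          have "x\<^sup>2 * X ^ 3 \<le> x\<^sup>2 * x ^ 3" using X0 x by (intro mult_left_mono power_mono) auto
          also have "\<dots> = x ^ 5" by (simp add: eval_nat_numeral)
          also have "\<dots> \<le> x ^ 7" using x by (intro power_increasing) auto
          finally show "x\<^sup>2 * X ^ 3 \<le> x ^ 7" .
        qed (use D h in auto)
        finally show ?thesis .
      qed
      have b: "norm (of_real T * Va n X) \<le> 3 * C2 * exp (4 * \<bar>s\<bar>) * h ^ 3 * (x ^ 7 * exp (- (3 * X)))"
      proof -
        have T: "\<bar>T\<bar> \<le> 3 * x ^ 4"
        proof -
          have "h * X\<^sup>2 / 4 \<le> 1 * x\<^sup>2 / 1" using h x X0 by (intro frac_le mult_mono power_mono) auto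
          moreover have "h ^ 2 * X ^ 4 / 32 \<le> 1 * x ^ 4 / 1" using h x X0 by (intro frac_le mult_mono power_mono power_le_one) auto
          moreover have "x\<^sup>2 \<le> x ^ 4" "1 \<le> x ^ 4" using x by (auto intro: power_increasing)
          moreover have "T \<ge> 0" using h by (simp add: T_def)
          ultimately show ?thesis unfolding T_def by simp
        qed
        have "norm (of_real T * Va n X) \<le> (3 * x ^ 4) * (C2 * exp (- (7 * X)))"
          unfolding norm_mult norm_of_real using x by (intro mult_mono T v(2)) auto
        also have "\<dots> \<le> (3 * x ^ 4) * (C2 * (exp (4 * \<bar>s\<bar>) * exp (- (3 * X)))) * (h ^ 3 * X ^ 3)"
        proof -
          have "exp (- (7 * X)) \<le> exp (4 * \<bar>s\<bar>) * exp (- (3 * X))" using exp_rate_mono[of 3 7 s X] X by simp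
          then have "(3 * x ^ 4) * (C2 * exp (- (7 * X))) \<le> (3 * x ^ 4) * (C2 * (exp (4 * \<bar>s\<bar>) * exp (- (3 * X))))"
            using x C2(1) by (intro mult_left_mono) auto
          also have "\<dots> * 1 \<le> \<dots> * (h ^ 3 * X ^ 3)" using hX3 x C2(1) by (intro mult_left_mono) auto
          finally show ?thesis by simp
        qed
        also have "\<dots> = 3 * C2 * exp (4 * \<bar>s\<bar>) * h ^ 3 * ((x ^ 4 * X ^ 3) * exp (- (3 * X)))" by (simp only: mult_ac)
        also have "\<dots> \<le> 3 * C2 * exp (4 * \<bar>s\<bar>) * h ^ 3 * (x ^ 7 * exp (- (3 * X)))"
        proof (intro mult_left_mono mult_right_mono)
          have "x ^ 4 * X ^ 3 \<le> x ^ 4 * x ^ 3" using X0 x by (intro mult_left_mono power_mono) auto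
          then show "x ^ 4 * X ^ 3 \<le> x ^ 7" by (simp add: power_add[symmetric])
        qed (use C2(1) h in auto)
        finally show ?thesis .
      qed
      have "norm (of_real (\<kappa> * E) * V n X - of_real T * Va n X) \<le> D * h ^ 3 * (x ^ 7 * exp (- (3 * X))) + 3 * C2 * exp (4 * \<bar>s\<bar>) * h ^ 3 * (x ^ 7 * exp (- (3 * X)))"
        by (rule order_trans[OF norm_triangle_ineq4 add_mono[OF a b]])
      also have "\<dots> = (D + 3 * C2 * exp (4 * \<bar>s\<bar>)) * h ^ 3 * (x ^ 7 * exp (- (3 * X)))" by (simp add: algebra_simps)
      also have "\<dots> \<le> (C3 * (C1 + 2 * C2) + (D + 3 * C2 * exp (4 * \<bar>s\<bar>))) * h ^ 3 * (x ^ 7 * exp (- (3 * X)))"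
        using C1(1) C2(1) C3 h x by (intro mult_right_mono) auto
      finally show ?thesis .
    qed
    also have "(C3 * (C1 + 2 * C2) + (D + 3 * C2 * exp (4 * \<bar>s\<bar>))) * h ^ 3 * (x ^ 7 * exp (- (3 * X)))
       \<le> (C3 * (C1 + 2 * C2) + (D + 3 * C2 * exp (4 * \<bar>s\<bar>))) * h ^ 3 * (P * exp (- (2 * X)))"
      unfolding x_def using C1(1) C2(1) C3 D h X by (intro mult_left_mono P(2)) auto
    finally show "norm (of_real (stirling_ratio n * exp (edge_h n * X\<^sup>2 / 4)) * V n X - of_real (1 + edge_h n * X\<^sup>2 / 4 + edge_h n ^ 2 * X ^ 4 / 32) * Va n X)
       \<le> ?C * edge_h n ^ 3 * exp (- (2 * X))"
      unfolding \<kappa>_def E_def T_def h_def by (simp only: mult_ac)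
  qed
qed

text \<open>The truncated product of 1 + h X^2 / 4 + h^2 X^4 / 32 with \<open>airy_approx\<close>.
  The terms X^2 Ai of order h and X^4 Ai of order h^2 cancel; 1/20 = 3/8 - 1/8 - 1/5 and 3/40 = 7/8
  - 4/5.\<close>

definition edge_fun_approx :: "nat \<Rightarrow> real \<Rightarrow> real" where
  "edge_fun_approx n X = Airy X - edge_h n / 2 * Airy' X
     + edge_h n ^ 2 * (X ^ 2 * Airy' X / 20 + 3 * X * Airy X / 40)"

definition edge_deriv_approx :: "nat \<Rightarrow> real \<Rightarrow> real" where
  "edge_deriv_approx n X = Airy' X - edge_h n / 2 * (X * Airy X)
     + edge_h n ^ 2 * (7 * X * Airy' X / 40 + X ^ 3 * Airy X / 20 + 3 * Airy X / 40)"

lemma decay_Airy_power: "decay s 0 m (\<lambda>n X. X ^ k * Airy X)" "decay s 0 m (\<lambda>n X. X ^ k * Airy' X)"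
  using decay_power[OF decay_Airy(1)[of s "m + 1"], of m k] decay_power[OF decay_Airy(2)[of s "m + 1"], of m k] by simp_all

lemma decay_h_real: "decay s p m f \<Longrightarrow> p' \<le> p + q \<Longrightarrow> decay s p' m (\<lambda>n X. edge_h n ^ q * (f n X :: real))"
  using decay_mono[OF decay_h[of s p m f q], of p' m] by simp

text \<open>The left sides of \<open>edge_fun_contour\<close> do not contain \<eta> and the
  prefactor is nonzero; the case k = 1 follows from the derivative formula once k = 0 is
  known.\<close>

lemma edge_int_contour_independent:
  assumes n: "n > 0" and "\<eta> > 0" "\<eta>' > 0"
  shows "edge_int \<eta> 0 n X = edge_int \<eta>' 0 n X" "edge_int \<eta> 1 n X = edge_int \<eta>' 1 n X"
proof -
  have nz: "complex_of_real (stirling_ratio n * exp (edge_h n * X\<^sup>2 / 4)) \<noteq> 0"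
    using stirling_ratio_pos[OF n] by simp
  show 0: "edge_int \<eta> 0 n X = edge_int \<eta>' 0 n X"
    using edge_fun_contour(1)[OF n assms(2), of X] edge_fun_contour(1)[OF n assms(3), of X] nz
    by (metis mult_left_cancel)
  have "of_real (edge_h n * X / 2) * edge_int \<eta> 0 n X - edge_int \<eta> 1 n X = of_real (edge_h n * X / 2) * edge_int \<eta>' 0 n X - edge_int \<eta>' 1 n X"
    using edge_fun_contour(2)[OF n assms(2), of X] edge_fun_contour(2)[OF n assms(3), of X] nz
    by (metis mult_left_cancel)
  then show "edge_int \<eta> 1 n X = edge_int \<eta>' 1 n X" unfolding 0 by simp
qed

lemma edge_int_tail':
  assumes "k \<le> 1"
  obtains C where "C \<ge> 0" "\<And>n X. n > 0 \<Longrightarrow> edge_h n * X \<ge> 16 \<Longrightarrow>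
    norm (edge_int 8 k n X) \<le> C * (1 + X) ^ k * exp (- (edge_h n * X\<^sup>2 / 2))"
proof -
  obtain C where C: "C \<ge> 0" "\<And>n X. n > 0 \<Longrightarrow> edge_h n * X \<ge> 16 \<Longrightarrow>
    norm (edge_int (edge_h n * X) k n X) \<le> C * (1 + X) ^ k * exp (- (edge_h n * X\<^sup>2 / 2))"
    using edge_int_tail[where k=k] by blast
  show ?thesis
  proof (rule that[OF C(1)])
    fix n X assume n: "n > 0" and hX: "edge_h n * X \<ge> 16"
    have "k = 0 \<or> k = 1" using assms by linarith
    then have "edge_int 8 k n X = edge_int (edge_h n * X) k n X"
      using edge_int_contour_independent[OF n, of 8 "edge_h n * X" X] hX by auto
    then show "norm (edge_int 8 k n X) \<le> C * (1 + X) ^ k * exp (- (edge_h n * X\<^sup>2 / 2))"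
      using C(2)[OF n hX] by simp
  qed
qed

lemma edge_tail_X_pos: "n > 0 \<Longrightarrow> edge_h n * X \<ge> 16 \<Longrightarrow> X > 0"
  using edge_h_pos[of n] mult_nonneg_nonpos[of "edge_h n" X] by (meson not_le order_trans zero_less_numeral less_imp_le leD)

text \<open>The fixed contour Re w = 8 gives the expansion. Its tail bound for h X \<ge> 16 is
  borrowed from the moving contour through contour independence.\<close>

lemma edge_fun_decay: "decay s 3 2 (\<lambda>n X. edge_fun n X - edge_fun_approx n X)"
proof -
  define V where "V = (\<lambda>n X. edge_int 8 0 n X)"
  define Va where "Va = (\<lambda>n X. airy_approx 8 0 (edge_h n) X)"
  define T where "T n X = complex_of_real (1 + edge_h n * X\<^sup>2 / 4 + edge_h n ^ 2 * X ^ 4 / 32)" for n X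
  obtain C where C: "C \<ge> 0" "\<And>n X. n > 0 \<Longrightarrow> edge_h n * X \<ge> 16 \<Longrightarrow>
    norm (edge_int 8 0 n X) \<le> C * (1 + X) ^ 0 * exp (- (edge_h n * X\<^sup>2 / 2))"
    by (rule edge_int_tail'[of 0]) auto
  have main: "decay s 3 2 (\<lambda>n X. of_real (stirling_ratio n * exp (edge_h n * X\<^sup>2 / 4)) * V n X - T n X * Va n X)"
    unfolding T_def
  proof (rule decay_edge_factor[OF _ _ _ C(1)])
    show "decay s 3 7 (\<lambda>n X. V n X - Va n X)"
      unfolding V_def Va_def by (rule decay_mono[OF decay_edge_int_diff]) auto
    show "decay s 0 7 Va" unfolding Va_def by (rule decay_airy_approx) auto
    fix n X assume n: "n > 0" "edge_h n * X \<ge> 16"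
    have "1 \<le> (1 + X)\<^sup>2" using edge_tail_X_pos[OF n] by (intro one_le_power) auto
    then have "C * 1 * exp (- (edge_h n * X\<^sup>2 / 2)) \<le> C * (1 + X)\<^sup>2 * exp (- (edge_h n * X\<^sup>2 / 2))"
      using C(1) by (intro mult_right_mono mult_left_mono) auto
    then show "norm (V n X) \<le> C * (1 + X)\<^sup>2 * exp (- (edge_h n * X\<^sup>2 / 2))"
      using C(2)[OF n] by (simp add: V_def)
  qed
  \<comment> \<open>\<open>B\<close> and \<open>D\<close> are the Airy forms of the w^8, w^5 and w^4
    corrections of \<open>airy_approx\<close>; \<open>rest\<close> is what the product with
    \<open>T\<close> leaves at orders h^3 and h^4.\<close>
  define B where "B X = X ^ 4 * Airy X / 32 + 3 / 8 * (X\<^sup>2 * Airy' X) + 7 / 8 * (X * Airy X) - (X\<^sup>2 * Airy' X + 4 * (X * Airy X)) / 5" for X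
  define D where "D X = X\<^sup>2 * Airy X + 2 * Airy' X" for X
  have rest: "decay s 3 2 (\<lambda>n X. edge_h n ^ 3 * (X\<^sup>2 * B X / 4 - X ^ 4 * D X / 128) + edge_h n ^ 4 * (X ^ 4 * B X / 32))"
  proof -
    have eq1: "X\<^sup>2 * B X / 4 - X ^ 4 * D X / 128 = (7 / 8 - 4 / 5) / 4 * (X ^ 3 * Airy X) + ((3 / 8 - 1 / 5) / 4 - 1 / 64) * (X ^ 4 * Airy' X)" for X
      by (simp add: B_def D_def eval_nat_numeral field_simps)
    have eq2: "X ^ 4 * B X / 32 = 1 / 1024 * (X ^ 8 * Airy X) + (3 / 8 - 1 / 5) / 32 * (X ^ 6 * Airy' X) + (7 / 8 - 4 / 5) / 32 * (X ^ 5 * Airy X)" for X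
      by (simp add: B_def eval_nat_numeral field_simps)
    show ?thesis unfolding eq1 eq2
      by (intro decay_add decay_h_real[where p=0] decay_cmult decay_Airy_power) simp_all
  qed
  have "decay s 3 2 (\<lambda>n X. (of_real (stirling_ratio n * exp (edge_h n * X\<^sup>2 / 4)) * V n X - T n X * Va n X)
     + complex_of_real (edge_h n ^ 3 * (X\<^sup>2 * B X / 4 - X ^ 4 * D X / 128) + edge_h n ^ 4 * (X ^ 4 * B X / 32)))"
    by (intro decay_add main) (use rest in \<open>simp only: decay_of_real\<close>)
  then have "decay s 3 2 (\<lambda>n X. complex_of_real (edge_fun n X - edge_fun_approx n X))"
  proof (rule decay_cong[rotated])
    fix n :: nat and X assume n: "n > 0"
    have Va': "Va n X = of_real (Airy X - edge_h n / 4 * D X + edge_h n ^ 2 * B X)"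
      unfolding Va_def airy_approx_def by (simp add: airy_int_values B_def D_def field_simps)
    have T': "T n X * Va n X = of_real (edge_fun_approx n X + (edge_h n ^ 3 * (X\<^sup>2 * B X / 4 - X ^ 4 * D X / 128) + edge_h n ^ 4 * (X ^ 4 * B X / 32)))"
      unfolding T_def Va' of_real_mult[symmetric] of_real_eq_iff edge_fun_approx_def B_def D_def
      by (simp add: eval_nat_numeral field_simps)
    show "of_real (stirling_ratio n * exp (edge_h n * X\<^sup>2 / 4)) * V n X - T n X * Va n X
       + complex_of_real (edge_h n ^ 3 * (X\<^sup>2 * B X / 4 - X ^ 4 * D X / 128) + edge_h n ^ 4 * (X ^ 4 * B X / 32)) = complex_of_real (edge_fun n X - edge_fun_approx n X)"
      unfolding T' using edge_fun_contour(1)[OF n, of 8 X] by (simp add: V_def)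
  qed
  then show ?thesis by (simp only: decay_of_real)
qed

lemma edge_fun_deriv_decay: "decay s 3 2 (\<lambda>n X. edge_fun_deriv n X - edge_deriv_approx n X)"
proof -
  define V where "V = (\<lambda>n X. of_real (edge_h n * X / 2) * edge_int 8 0 n X - edge_int 8 1 n X)"
  define Va where "Va = (\<lambda>n X. of_real (edge_h n * X / 2) * airy_approx 8 0 (edge_h n) X - airy_approx 8 1 (edge_h n) X)"
  define T where "T n X = complex_of_real (1 + edge_h n * X\<^sup>2 / 4 + edge_h n ^ 2 * X ^ 4 / 32)" for n X
  obtain C where C: "C \<ge> 0" "\<And>n X. n > 0 \<Longrightarrow> edge_h n * X \<ge> 16 \<Longrightarrow>
    norm (edge_int 8 0 n X) \<le> C * (1 + X) ^ 0 * exp (- (edge_h n * X\<^sup>2 / 2))"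
    by (rule edge_int_tail'[of 0]) auto
  obtain C' where C': "C' \<ge> 0" "\<And>n X. n > 0 \<Longrightarrow> edge_h n * X \<ge> 16 \<Longrightarrow>
    norm (edge_int 8 1 n X) \<le> C' * (1 + X) ^ 1 * exp (- (edge_h n * X\<^sup>2 / 2))"
    by (rule edge_int_tail'[of 1]) auto
  have X: "decay s (p + 1) 7 (\<lambda>n X. of_real (edge_h n * X / 2) * f n X)" if "decay s p 8 f" for p and f :: "nat \<Rightarrow> real \<Rightarrow> complex"
  proof -
    have "decay s (p + 1) 7 (\<lambda>n X. of_real (edge_h n) ^ 1 * ((1 / 2) * (of_real X ^ 1 * f n X)))"
      by (intro decay_h decay_cmult decay_power[OF that]) simp
    then show ?thesis by (rule decay_cong[rotated]) simp
  qed
  have main: "decay s 3 2 (\<lambda>n X. of_real (stirling_ratio n * exp (edge_h n * X\<^sup>2 / 4)) * V n X - T n X * Va n X)"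
    unfolding T_def
  proof (rule decay_edge_factor)
    have "decay s 3 7 (\<lambda>n X. of_real (edge_h n * X / 2) * (edge_int 8 0 n X - airy_approx 8 0 (edge_h n) X) - (edge_int 8 1 n X - airy_approx 8 1 (edge_h n) X))"
      by (intro decay_diff decay_mono[OF X[OF decay_edge_int_diff]] decay_mono[OF decay_edge_int_diff[of 8]]) auto
    then show "decay s 3 7 (\<lambda>n X. V n X - Va n X)"
      by (rule decay_cong[rotated]) (simp add: V_def Va_def algebra_simps)
    show "decay s 0 7 Va" unfolding Va_def
      by (intro decay_diff decay_mono[OF X[OF decay_airy_approx]] decay_airy_approx) auto
    show "C + C' \<ge> 0" using C(1) C'(1) by simp
    fix n X assume n: "n > 0" "edge_h n * X \<ge> 16"
    have X0: "X > 0" by (rule edge_tail_X_pos[OF n])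
    define e where "e = exp (- (edge_h n * X\<^sup>2 / 2))"
    have half: "\<bar>edge_h n * X / 2\<bar> \<le> 1 + X"
    proof -
      have "edge_h n * X \<le> 1 * X" "0 \<le> edge_h n * X"
        using X0 edge_h_pos[OF n(1)] edge_h_le_1[OF n(1)] by (intro mult_right_mono mult_nonneg_nonneg; simp)+
      then show ?thesis using X0 by linarith
    qed
    have "norm (V n X) \<le> (1 + X) * (C * 1 * e) + C' * (1 + X) * e"
    proof -
      have "norm (of_real (edge_h n * X / 2) * edge_int 8 0 n X) \<le> (1 + X) * (C * 1 * e)"
        unfolding norm_mult[of _ "edge_int 8 0 n X"] norm_of_real
        using C(2)[OF n] X0 half by (intro mult_mono) (auto simp: e_def)
      moreover have "norm (edge_int 8 1 n X) \<le> C' * (1 + X) * e" using C'(2)[OF n] by (simp add: e_def)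
      ultimately show ?thesis unfolding V_def by (rule order_trans[OF norm_triangle_ineq4 add_mono])
    qed
    also have "\<dots> = (C + C') * (1 + X) * e" by (simp add: algebra_simps)
    also have "\<dots> \<le> (C + C') * (1 + X)\<^sup>2 * e"
      using X0 C(1) C'(1) by (intro mult_right_mono mult_left_mono) (auto simp: e_def power2_eq_square mult_le_cancel_left1)
    finally show "norm (V n X) \<le> (C + C') * (1 + X)\<^sup>2 * exp (- (edge_h n * X\<^sup>2 / 2))" by (simp only: e_def)
  qed
  define a where "a = Airy"
  define b where "b = Airy'"
  \<comment> \<open>Here \<open>v1\<close>, \<open>v2\<close>, \<open>v3\<close> are the
    coefficients of h, h^2, h^3 in \<open>Va\<close>, and \<open>r3\<close>, \<open>r4\<close>,
    \<open>r5\<close> those of h^3, h^4, h^5 left over in its product with \<open>T\<close>.\<close>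
  define v1 where "v1 X = X * a X / 2 - (X\<^sup>2 * b X + 4 * (X * a X)) / 4" for X
  define v2 where "v2 X = - (X ^ 3 * a X + 2 * (X * b X)) / 8 + (X ^ 4 * b X + 16 * (X ^ 3 * a X) + 52 * (X * b X) + 28 * a X) / 32
      - (X ^ 3 * a X + 6 * (X * b X) + 4 * a X) / 5" for X
  define v3 where "v3 X = X / 2 * ((X ^ 4 * a X + 12 * (X\<^sup>2 * b X) + 28 * (X * a X)) / 32 - (X\<^sup>2 * b X + 4 * (X * a X)) / 5)" for X
  define r3 where "r3 X = v3 X + X\<^sup>2 * v2 X / 4 + X ^ 4 * v1 X / 32" for X
  define r4 where "r4 X = X\<^sup>2 * v3 X / 4 + X ^ 4 * v2 X / 32" for X
  define r5 where "r5 X = X ^ 4 * v3 X / 32" for X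
  have ab: "decay s 0 2 (\<lambda>n X. X ^ k * a X)" "decay s 0 2 (\<lambda>n X. X ^ k * b X)" for k
    unfolding a_def b_def by (rule decay_Airy_power)+
  have rest: "decay s 3 2 (\<lambda>n X. edge_h n ^ 3 * r3 X + edge_h n ^ 4 * r4 X + edge_h n ^ 5 * r5 X)"
  proof -
    have e3: "r3 X = (7 / 16 - 2 / 5) * (X ^ 2 * a X) + (3 / 16 - 1 / 10) * (X ^ 3 * b X)
       + 1 / 4 * ((- 1 / 8 + 1 / 2 - 1 / 5) * (X ^ 5 * a X) + (- 1 / 4 + 13 / 8 - 6 / 5) * (X ^ 3 * b X) + (7 / 8 - 4 / 5) * (X ^ 2 * a X) + 1 / 32 * (X ^ 6 * b X))
       + 1 / 32 * (- 1 / 2 * (X ^ 5 * a X) - 1 / 4 * (X ^ 6 * b X)) + 1 / 64 * (X ^ 5 * a X)" for X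
      by (simp add: r3_def v3_def v2_def v1_def eval_nat_numeral field_simps)
    have 3: "decay s 0 2 (\<lambda>n. r3)"
      by (rule decay_cong[where g="\<lambda>n. r3", OF e3[symmetric]]) (intro decay_add decay_diff decay_cmult ab)
    have e4: "r4 X = 1 / 256 * (X ^ 7 * a X) + (3 / 64 - 1 / 40) * (X ^ 5 * b X) + (7 / 64 - 1 / 10) * (X ^ 4 * a X)
       + 1 / 32 * ((- 1 / 8 + 1 / 2 - 1 / 5) * (X ^ 7 * a X) + (- 1 / 4 + 13 / 8 - 6 / 5) * (X ^ 5 * b X) + (7 / 8 - 4 / 5) * (X ^ 4 * a X) + 1 / 32 * (X ^ 8 * b X))" for X
      by (simp add: r4_def v3_def v2_def eval_nat_numeral field_simps)
    have 4: "decay s 0 2 (\<lambda>n. r4)"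
      by (rule decay_cong[where g="\<lambda>n. r4", OF e4[symmetric]]) (intro decay_add decay_diff decay_cmult ab)
    have e5: "r5 X = 1 / 64 * (1 / 32 * (X ^ 9 * a X) + (3 / 8 - 1 / 5) * (X ^ 7 * b X) + (7 / 8 - 4 / 5) * (X ^ 6 * a X))" for X
      by (simp add: r5_def v3_def eval_nat_numeral field_simps)
    have 5: "decay s 0 2 (\<lambda>n. r5)"
      by (rule decay_cong[where g="\<lambda>n. r5", OF e5[symmetric]]) (intro decay_add decay_diff decay_cmult ab)
    show ?thesis
      by (intro decay_add decay_h_real[OF 3] decay_h_real[OF 4] decay_h_real[OF 5]) simp_all
  qed
  have "decay s 3 2 (\<lambda>n X. (of_real (stirling_ratio n * exp (edge_h n * X\<^sup>2 / 4)) * V n X - T n X * Va n X)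
     + complex_of_real (edge_h n ^ 3 * r3 X + edge_h n ^ 4 * r4 X + edge_h n ^ 5 * r5 X))"
    by (intro decay_add[OF main]) (use rest in \<open>simp only: decay_of_real\<close>)
  then have "decay s 3 2 (\<lambda>n X. complex_of_real (edge_fun_deriv n X - edge_deriv_approx n X))"
  proof (rule decay_cong[rotated])
    fix n :: nat and X assume n: "n > 0"
    have Va': "Va n X = of_real (b X + edge_h n * v1 X + edge_h n ^ 2 * v2 X + edge_h n ^ 3 * v3 X)"
    proof -
      have i0: "airy_approx 8 0 (edge_h n) X = airy_int 8 0 X - of_real (edge_h n) / 4 * airy_int 8 4 X
          + of_real (edge_h n) ^ 2 * (airy_int 8 8 X / 32 + airy_int 8 5 X / 5)" by (simp add: airy_approx_def)
      have i1: "airy_approx 8 1 (edge_h n) X = airy_int 8 1 X - of_real (edge_h n) / 4 * airy_int 8 5 X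
          + of_real (edge_h n) ^ 2 * (airy_int 8 9 X / 32 + airy_int 8 6 X / 5)" by (simp add: airy_approx_def)
      have pos: "(8::real) > 0" by simp
      show ?thesis unfolding Va_def i0 i1 airy_int_values[OF pos]
        by (simp add: v1_def v2_def v3_def a_def b_def eval_nat_numeral field_simps)
    qed
    have T': "T n X * Va n X = of_real (edge_deriv_approx n X + (edge_h n ^ 3 * r3 X + edge_h n ^ 4 * r4 X + edge_h n ^ 5 * r5 X))"
      unfolding T_def Va' of_real_mult[symmetric] of_real_eq_iff edge_deriv_approx_def r3_def r4_def r5_def b_def[symmetric] unfolding a_def[symmetric]
      by (simp add: v1_def v2_def eval_nat_numeral field_simps)
    show "of_real (stirling_ratio n * exp (edge_h n * X\<^sup>2 / 4)) * V n X - T n X * Va n X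
       + complex_of_real (edge_h n ^ 3 * r3 X + edge_h n ^ 4 * r4 X + edge_h n ^ 5 * r5 X) = complex_of_real (edge_fun_deriv n X - edge_deriv_approx n X)"
      unfolding T' using edge_fun_contour(2)[OF n, of 8 X] by (simp add: V_def)
  qed
  then show ?thesis by (simp only: decay_of_real)
qed

section \<open>Second order corrections and the companion function\<close>

definition airy_u :: "real \<Rightarrow> real" where "airy_u X = X ^ 2 * Airy' X / 20 + 3 * X * Airy X / 40"

definition airy_u' :: "real \<Rightarrow> real" where
  "airy_u' X = 7 * X * Airy' X / 40 + X ^ 3 * Airy X / 20 + 3 * Airy X / 40"

definition airy_u'' :: "real \<Rightarrow> real" where
  "airy_u'' X = Airy' X / 4 + 13 * X ^ 2 * Airy X / 40 + X ^ 3 * Airy' X / 20"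

definition airy_d2 :: "real \<Rightarrow> real" where "airy_d2 X = X * Airy X"

definition airy_d3 :: "real \<Rightarrow> real" where "airy_d3 X = Airy X + X * Airy' X"

definition airy_d4 :: "real \<Rightarrow> real" where "airy_d4 X = 2 * Airy' X + X ^ 2 * Airy X"

lemmas airy_derivs = Airy_DERIV deriv_Airy_DERIV

lemma airy_d_DERIV:
  "(Airy' has_real_derivative airy_d2 X) (at X)"
  "(airy_d2 has_real_derivative airy_d3 X) (at X)"
  "(airy_d3 has_real_derivative airy_d4 X) (at X)"
  "(airy_u has_real_derivative airy_u' X) (at X)"
  "(airy_u' has_real_derivative airy_u'' X) (at X)"
  unfolding airy_d2_def[abs_def] airy_d3_def[abs_def] airy_d4_def airy_u_def[abs_def] airy_u'_def[abs_def] airy_u''_def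
  by (auto intro!: derivative_eq_intros airy_derivs simp: eval_nat_numeral field_simps)

lemma decay_airy_terms:
  "decay s 0 m (\<lambda>n. airy_u)" "decay s 0 m (\<lambda>n. airy_u')" "decay s 0 m (\<lambda>n. airy_u'')"
  "decay s 0 m (\<lambda>n. airy_d2)" "decay s 0 m (\<lambda>n. airy_d3)" "decay s 0 m (\<lambda>n. airy_d4)"
proof -
  have 0: "decay s 0 m (\<lambda>n X. Airy X)" "decay s 0 m (\<lambda>n X. Airy' X)"
    using decay_Airy[of s m] by simp_all
  have 1: "decay s 0 m (\<lambda>n X. X * Airy X)" "decay s 0 m (\<lambda>n X. X * Airy' X)"
    using decay_Airy_power[of s m 1] by simp_all
  note A = 0 1 decay_Airy_power[of s m]
  have "decay s 0 m (\<lambda>n X. 1 / 20 * (X ^ 2 * Airy' X) + 3 / 40 * (X * Airy X))"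
    by (intro decay_add decay_cmult A)
  then show "decay s 0 m (\<lambda>n. airy_u)" by (rule decay_cong[rotated]) (simp add: airy_u_def)
  have "decay s 0 m (\<lambda>n X. 7 / 40 * (X * Airy' X) + 1 / 20 * (X ^ 3 * Airy X) + 3 / 40 * Airy X)"
    by (intro decay_add decay_cmult A)
  then show "decay s 0 m (\<lambda>n. airy_u')" by (rule decay_cong[rotated]) (simp add: airy_u'_def)
  have "decay s 0 m (\<lambda>n X. 1 / 4 * Airy' X + 13 / 40 * (X ^ 2 * Airy X) + 1 / 20 * (X ^ 3 * Airy' X))"
    by (intro decay_add decay_cmult A)
  then show "decay s 0 m (\<lambda>n. airy_u'')" by (rule decay_cong[rotated]) (simp add: airy_u''_def)
  show "decay s 0 m (\<lambda>n. airy_d2)" using A(3) by (rule decay_cong[rotated]) (simp add: airy_d2_def)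
  have "decay s 0 m (\<lambda>n X. Airy X + X * Airy' X)" by (intro decay_add A)
  then show "decay s 0 m (\<lambda>n. airy_d3)" by (rule decay_cong[rotated]) (simp add: airy_d3_def)
  have "decay s 0 m (\<lambda>n X. 2 * Airy' X + X ^ 2 * Airy X)" by (intro decay_add decay_cmult A)
  then show "decay s 0 m (\<lambda>n. airy_d4)" by (rule decay_cong[rotated]) (simp add: airy_d4_def)
qed

text \<open>The companion function is \<open>\<phi>\<^sub>n\<^sub>-\<^sub>1\<close> in edge scaling, normalised like \<open>edge_fun\<close>.\<close>

definition edge_comp :: "nat \<Rightarrow> real \<Rightarrow> real" where
  "edge_comp n X = (1 + edge_h n ^ 2 * X / 2) * edge_fun n X + edge_h n * edge_fun_deriv n X"

definition edge_comp_deriv :: "nat \<Rightarrow> real \<Rightarrow> real" where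
  "edge_comp_deriv n X = (1 + edge_h n ^ 2 * X / 2) * edge_fun_deriv n X
     + (edge_h n * X + edge_h n ^ 3 * X ^ 2 / 4) * edge_fun n X"

lemma edge_source_eq:
  "edge_source n X Y = (edge_fun n X * edge_comp n Y + edge_comp n X * edge_fun n Y) / 2"
  unfolding edge_source_def edge_comp_def by (simp add: power2_eq_square algebra_simps)

lemma edge_comp_DERIV:
  assumes "n > 0"
  shows "(edge_comp n has_real_derivative edge_comp_deriv n X) (at X)"
  unfolding edge_comp_def[abs_def] edge_comp_deriv_def
  by (auto intro!: derivative_eq_intros edge_fun_DERIV edge_fun_deriv_DERIV[OF assms] simp: eval_nat_numeral field_simps)

text \<open>To second order \<open>edge_fun\<close> is \<open>p - q\<close> and \<open>edge_comp\<close> is \<open>p + q\<close>, so that the mixed terms cancel in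
  \<open>edge_source\<close>.\<close>

definition edge_p where "edge_p n X = Airy X + edge_h n ^ 2 * airy_u X"
definition edge_q where "edge_q n X = edge_h n / 2 * Airy' X"
definition edge_p' where "edge_p' n X = Airy' X + edge_h n ^ 2 * airy_u' X"
definition edge_q' where "edge_q' n X = edge_h n / 2 * airy_d2 X"

lemma decay_X_real: "decay s p 2 f \<Longrightarrow> decay s p 1 (\<lambda>n X. X ^ k * (f n X :: real))"
  using decay_power[of s p 2 f 1 k] by simp

text \<open>Adding h times the derivative flips the sign of the first order term - h Ai' / 2. At
  order h^2 its contribution - X Ai / 2 cancels the explicit X Ai / 2, so the companion has the same
  second order term \<open>airy_u\<close>. Multiplication by X lowers the rate from 2 to 1.\<close>

lemma edge_pair_decay:
  "decay s 3 1 (\<lambda>n X. edge_fun n X - (edge_p n X - edge_q n X))"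
  "decay s 3 1 (\<lambda>n X. edge_comp n X - (edge_p n X + edge_q n X))"
  "decay s 3 1 (\<lambda>n X. edge_fun_deriv n X - (edge_p' n X - edge_q' n X))"
  "decay s 3 1 (\<lambda>n X. edge_comp_deriv n X - (edge_p' n X + edge_q' n X))"
proof -
  define e where "e n X = edge_fun n X - edge_fun_approx n X" for n X
  define e' where "e' n X = edge_fun_deriv n X - edge_deriv_approx n X" for n X
  have e2: "decay s 3 2 e" "decay s 3 2 e'" using edge_fun_decay[of s] edge_fun_deriv_decay[of s]
    by (simp_all add: e_def[abs_def] e'_def[abs_def])
  have e1: "decay s 3 1 (\<lambda>n X. e n X)" "decay s 3 1 (\<lambda>n X. e' n X)"
    using decay_mono[OF e2(1), of 3 1] decay_mono[OF e2(2), of 3 1] by simp_all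
  have fa: "edge_fun_approx n X = edge_p n X - edge_q n X" for n X
    by (simp add: edge_fun_approx_def edge_p_def edge_q_def airy_u_def)
  have fa': "edge_deriv_approx n X = edge_p' n X - edge_q' n X" for n X
    by (simp add: edge_deriv_approx_def edge_p'_def edge_q'_def airy_u'_def airy_d2_def)
  show "decay s 3 1 (\<lambda>n X. edge_fun n X - (edge_p n X - edge_q n X))"
    using e1(1) by (simp only: e_def fa)
  show "decay s 3 1 (\<lambda>n X. edge_fun_deriv n X - (edge_p' n X - edge_q' n X))"
    using e1(2) by (simp only: e'_def fa')
  have U: "decay s 0 1 (\<lambda>n X. airy_u' X)" "decay s 0 1 (\<lambda>n X. X ^ k * airy_u X)" "decay s 0 1 (\<lambda>n X. X ^ k * airy_u' X)" "decay s 0 1 (\<lambda>n X. X ^ k * Airy' X)" for k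
    using decay_airy_terms(2)[of s 1] decay_X_real[OF decay_airy_terms(1)] decay_X_real[OF decay_airy_terms(2)] decay_Airy_power(2)[of s 1] by simp_all
  have "decay s 3 1 (\<lambda>n X. (e n X + edge_h n ^ 2 * (1 / 2 * (X ^ 1 * e n X)) + edge_h n ^ 1 * e' n X)
      + (edge_h n ^ 3 * (airy_u' X - 1 / 4 * (X ^ 1 * Airy' X)) + edge_h n ^ 4 * (1 / 2 * (X ^ 1 * airy_u X))))"
    by (intro decay_add decay_diff e1 decay_h_real[OF decay_cmult[OF decay_X_real[OF e2(1)]]] decay_h_real[OF e1(2)]
        decay_h_real[OF decay_diff[OF U(1) decay_cmult[OF U(4)]]] decay_h_real[OF decay_cmult[OF U(2)]]) simp_all
  then show "decay s 3 1 (\<lambda>n X. edge_comp n X - (edge_p n X + edge_q n X))"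
    by (rule decay_cong[rotated])
       (simp add: e_def e'_def fa fa' edge_comp_def edge_p_def edge_q_def edge_p'_def edge_q'_def airy_d2_def eval_nat_numeral field_simps)
  have "decay s 3 1 (\<lambda>n X. (e' n X + edge_h n ^ 2 * (1 / 2 * (X ^ 1 * e' n X)) + edge_h n ^ 1 * (X ^ 1 * e n X) + edge_h n ^ 3 * (1 / 4 * (X ^ 2 * e n X)))
      + (edge_h n ^ 3 * (X ^ 1 * airy_u X) + edge_h n ^ 4 * (1 / 2 * (X ^ 1 * airy_u' X) - 1 / 8 * (X ^ 2 * Airy' X)) + edge_h n ^ 5 * (1 / 4 * (X ^ 2 * airy_u X))))"
    by (intro decay_add decay_diff e1 decay_h_real[OF decay_cmult[OF decay_X_real[OF e2(2)]]] decay_h_real[OF decay_X_real[OF e2(1)]] decay_h_real[OF decay_cmult[OF decay_X_real[OF e2(1)]]]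
        decay_h_real[OF U(2)] decay_h_real[OF decay_diff[OF decay_cmult[OF U(3)] decay_cmult[OF U(4)]]] decay_h_real[OF decay_cmult[OF U(2)]]) simp_all
  then show "decay s 3 1 (\<lambda>n X. edge_comp_deriv n X - (edge_p' n X + edge_q' n X))"
    by (rule decay_cong[rotated])
       (simp add: e_def e'_def fa fa' edge_comp_deriv_def edge_p_def edge_q_def edge_p'_def edge_q'_def airy_d2_def eval_nat_numeral field_simps)
qed

section \<open>The parameter c as a translation in X\<close>

definition edge_shift :: "nat \<Rightarrow> real \<Rightarrow> real" where
  "edge_shift n c = (sqrt (2 * (real n + c)) - sqrt (2 * real n)) / edge_jacobian n"

lemma edge_point_shift: "n > 0 \<Longrightarrow> edge_point c n X = edge_point 0 n (X + edge_shift n c)"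
  using edge_jacobian_pos[of n] by (simp add: edge_point_def edge_shift_def field_simps)

text \<open>Rationalising the difference of roots twice gives the exact error 2 c^2 h / (q' + q)^2,
  and q^2 = 2 n with 1/n = h^3 turns it into order h^4.\<close>

lemma edge_shift_approx:
  assumes n: "n > 0" and c: "real n + c \<ge> 0"
  shows "\<bar>edge_shift n c - c * edge_h n\<bar> \<le> c\<^sup>2 * edge_h n ^ 4"
proof -
  define h where "h = edge_h n"
  define j where "j = edge_jacobian n"
  define q where "q = sqrt (2 * real n)"
  define q' where "q' = sqrt (2 * (real n + c))"
  have r: "h * j * q = 1" "h > 0" "j > 0" "real n * h ^ 3 = 1"
    using edge_jacobian_sqrt[OF n] edge_h_pos[OF n] edge_jacobian_pos[OF n] edge_h_cube[OF n] by (auto simp: h_def j_def q_def)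
  have q: "q > 0" "q' \<ge> 0" "q\<^sup>2 = 2 * real n" "q'\<^sup>2 = 2 * (real n + c)" using n c by (auto simp: q_def q'_def)
  have d: "q' - q = 2 * c / (q' + q)"
  proof -
    have "(q' - q) * (q' + q) = q'\<^sup>2 - q\<^sup>2" by (simp add: power2_eq_square algebra_simps)
    then show ?thesis using q by (simp add: field_simps)
  qed
  have j1: "1 / j = h * q" using r by (simp add: field_simps)
  have "edge_shift n c = (q' - q) * (1 / j)" by (simp add: edge_shift_def q_def q'_def j_def)
  then have "edge_shift n c - c * h = h * q * (2 * c / (q' + q)) - c * h" unfolding d j1 by simp
  also have "\<dots> = - (c * h * (q' - q) / (q' + q))" using q by (simp add: field_simps)
  also have "\<dots> = - (2 * c\<^sup>2 * h / (q' + q)\<^sup>2)" unfolding d by (simp add: power2_eq_square)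
  finally have "\<bar>edge_shift n c - c * h\<bar> = 2 * c\<^sup>2 * h / (q' + q)\<^sup>2" using r by (simp add: abs_mult)
  also have "\<dots> \<le> 2 * c\<^sup>2 * h / q\<^sup>2"
    using q r n by (intro divide_left_mono power_mono mult_nonneg_nonneg mult_pos_pos zero_less_power) auto
  also have "\<dots> = c\<^sup>2 * h * (1 / real n)" using q by simp
  also have "1 / real n = h ^ 3" using r n by (simp add: field_simps)
  also have "c\<^sup>2 * h * h ^ 3 = c\<^sup>2 * h ^ 4" by (simp add: eval_nat_numeral)
  finally show ?thesis by (simp only: h_def)
qed

lemma edge_shift_bounds:
  assumes "B \<ge> 0"
  obtains N where "\<And>n c. n \<ge> N \<Longrightarrow> n > 0 \<Longrightarrow> \<bar>c\<bar> \<le> B \<Longrightarrow> real n + c \<ge> 0"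
    "\<And>n c. n \<ge> N \<Longrightarrow> n > 0 \<Longrightarrow> \<bar>c\<bar> \<le> B \<Longrightarrow> \<bar>edge_shift n c\<bar> \<le> 1"
    "\<And>n c. n \<ge> N \<Longrightarrow> n > 0 \<Longrightarrow> \<bar>c\<bar> \<le> B \<Longrightarrow> \<bar>edge_shift n c\<bar> \<le> (B + B\<^sup>2) * edge_h n"
    "\<And>n c. n \<ge> N \<Longrightarrow> n > 0 \<Longrightarrow> \<bar>c\<bar> \<le> B \<Longrightarrow> \<bar>edge_shift n c - c * edge_h n\<bar> \<le> B\<^sup>2 * edge_h n ^ 3"
proof -
  have "((\<lambda>n. (B + B\<^sup>2) * edge_h n) \<longlongrightarrow> 0) sequentially" unfolding edge_h_def by real_asymp
  then have "\<forall>\<^sub>F n in sequentially. (B + B\<^sup>2) * edge_h n < 1" by (rule order_tendstoD) simp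
  then obtain N0 where N0: "\<And>n. n \<ge> N0 \<Longrightarrow> (B + B\<^sup>2) * edge_h n < 1" by (auto simp: eventually_sequentially)
  define N where "N = max N0 (nat \<lceil>B\<rceil>)"
  have 1: "real n + c \<ge> 0" if "n \<ge> N" "\<bar>c\<bar> \<le> B" for n c
  proof -
    have "B \<le> real n" using that(1) by (simp add: N_def nat_ceiling_le_eq)
    then show ?thesis using that(2) by linarith
  qed
  have 4: "\<bar>edge_shift n c - c * edge_h n\<bar> \<le> B\<^sup>2 * edge_h n ^ 3" if "n \<ge> N" "n > 0" "\<bar>c\<bar> \<le> B" for n c
  proof -
    have "c\<^sup>2 \<le> B\<^sup>2" using power_mono[OF that(3), of 2] by simp
    then have "c\<^sup>2 * edge_h n ^ 4 \<le> B\<^sup>2 * edge_h n ^ 3"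
      using edge_h_pos[OF that(2)] edge_h_le_1[OF that(2)] by (intro mult_mono power_decreasing) auto
    then show ?thesis using edge_shift_approx[OF that(2) 1[OF that(1,3)]] by linarith
  qed
  have 3: "\<bar>edge_shift n c\<bar> \<le> (B + B\<^sup>2) * edge_h n" if "n \<ge> N" "n > 0" "\<bar>c\<bar> \<le> B" for n c
  proof -
    have "B\<^sup>2 * edge_h n ^ 3 \<le> B\<^sup>2 * edge_h n ^ 1"
      using edge_h_pos[OF that(2)] edge_h_le_1[OF that(2)] by (intro mult_left_mono power_decreasing) auto
    moreover have "\<bar>c * edge_h n\<bar> \<le> B * edge_h n" using that edge_h_pos[OF that(2)] by (simp add: abs_mult)
    ultimately show ?thesis using 4[OF that] by (simp add: distrib_right)
  qed
  have 2: "\<bar>edge_shift n c\<bar> \<le> 1" if "n \<ge> N" "n > 0" "\<bar>c\<bar> \<le> B" for n c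
    using 3[OF that] N0[of n] that(1) by (simp add: N_def)
  show ?thesis by (rule that[of N]) (use 1 2 3 4 in blast)+
qed

section \<open>Asymptotics uniform in the shift parameter\<close>

text \<open>The threshold and the constant may depend on B and s but not on c, which gives the
  uniformity in c. The exponential rate is fixed at 1 from here on.\<close>

definition decayc :: "real \<Rightarrow> real \<Rightarrow> nat \<Rightarrow> (nat \<Rightarrow> real \<Rightarrow> real \<Rightarrow> real) \<Rightarrow> bool" where
  "decayc B s p f \<longleftrightarrow> (\<exists>C N. C \<ge> 0 \<and> (\<forall>n c X. n \<ge> N \<longrightarrow> n > 0 \<longrightarrow> \<bar>c\<bar> \<le> B \<longrightarrow> X \<ge> s \<longrightarrow>
     \<bar>f n c X\<bar> \<le> C * edge_h n ^ p * exp (- X)))"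

definition decay2 :: "real \<Rightarrow> real \<Rightarrow> nat \<Rightarrow> (nat \<Rightarrow> real \<Rightarrow> real \<Rightarrow> real \<Rightarrow> real) \<Rightarrow> bool" where
  "decay2 B s p f \<longleftrightarrow> (\<exists>C N. C \<ge> 0 \<and> (\<forall>n c X Y. n \<ge> N \<longrightarrow> n > 0 \<longrightarrow> \<bar>c\<bar> \<le> B \<longrightarrow> X \<ge> s \<longrightarrow> Y \<ge> s \<longrightarrow>
     \<bar>f n c X Y\<bar> \<le> C * edge_h n ^ p * exp (- X - Y)))"

lemma decaycI:
  assumes "C \<ge> 0" "\<And>n c X. n \<ge> N \<Longrightarrow> n > 0 \<Longrightarrow> \<bar>c\<bar> \<le> B \<Longrightarrow> X \<ge> s \<Longrightarrow> \<bar>f n c X\<bar> \<le> C * edge_h n ^ p * exp (- X)"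
  shows "decayc B s p f"
  unfolding decayc_def using assms by blast

lemma decaycE:
  assumes "decayc B s p f"
  obtains C N where "C \<ge> 0" "\<And>n c X. n \<ge> N \<Longrightarrow> n > 0 \<Longrightarrow> \<bar>c\<bar> \<le> B \<Longrightarrow> X \<ge> s \<Longrightarrow> \<bar>f n c X\<bar> \<le> C * edge_h n ^ p * exp (- X)"
  using assms unfolding decayc_def by blast

lemma decay2I:
  assumes "C \<ge> 0" "\<And>n c X Y. n \<ge> N \<Longrightarrow> n > 0 \<Longrightarrow> \<bar>c\<bar> \<le> B \<Longrightarrow> X \<ge> s \<Longrightarrow> Y \<ge> s \<Longrightarrow> \<bar>f n c X Y\<bar> \<le> C * edge_h n ^ p * exp (- X - Y)"
  shows "decay2 B s p f"
  unfolding decay2_def using assms by blast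

lemma decay2E:
  assumes "decay2 B s p f"
  obtains C N where "C \<ge> 0" "\<And>n c X Y. n \<ge> N \<Longrightarrow> n > 0 \<Longrightarrow> \<bar>c\<bar> \<le> B \<Longrightarrow> X \<ge> s \<Longrightarrow> Y \<ge> s \<Longrightarrow> \<bar>f n c X Y\<bar> \<le> C * edge_h n ^ p * exp (- X - Y)"
  using assms unfolding decay2_def by blast

lemma decayc_of_decay:
  assumes "decay s p m f" "m \<ge> 1"
  shows "decayc B s p (\<lambda>n c X. f n X)"
proof -
  obtain C N where C: "C \<ge> 0" "\<And>n X. n \<ge> N \<Longrightarrow> n > 0 \<Longrightarrow> X \<ge> s \<Longrightarrow> norm (f n X) \<le> C * edge_h n ^ p * exp (- (1 * X))"
    using decay_mono[OF assms(1) order_refl assms(2)] by (rule decayE) blast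
  show ?thesis by (rule decaycI[OF C(1), of N]) (use C(2) in simp)
qed

text \<open>Eventually the shift is at most 1 in modulus, so the half line is widened to s - 1 and a
  factor e is lost.\<close>

lemma decayc_shift:
  assumes "decay (s - 1) p m f" "m \<ge> 1" "B \<ge> 0"
  shows "decayc B s p (\<lambda>n c X. f n (X + edge_shift n c))"
proof -
  obtain C N where C: "C \<ge> 0" "\<And>n X. n \<ge> N \<Longrightarrow> n > 0 \<Longrightarrow> X \<ge> s - 1 \<Longrightarrow> norm (f n X) \<le> C * edge_h n ^ p * exp (- (1 * X))"
    using decay_mono[OF assms(1) order_refl assms(2)] by (rule decayE) blast
  obtain M where M: "\<And>n c. n \<ge> M \<Longrightarrow> n > 0 \<Longrightarrow> \<bar>c\<bar> \<le> B \<Longrightarrow> \<bar>edge_shift n c\<bar> \<le> 1"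
    using edge_shift_bounds[OF assms(3)] by metis
  show ?thesis
  proof (rule decaycI[of "C * exp 1" "max N M"])
    fix n c X assume n: "n \<ge> max N M" "n > 0" "\<bar>c\<bar> \<le> B" "X \<ge> s"
    have t: "\<bar>edge_shift n c\<bar> \<le> 1" using M n by simp
    have "\<bar>f n (X + edge_shift n c)\<bar> \<le> C * edge_h n ^ p * exp (- (1 * (X + edge_shift n c)))"
      using C(2)[of n "X + edge_shift n c"] n t by (simp add: abs_le_iff)
    also have "\<dots> \<le> C * edge_h n ^ p * (exp 1 * exp (- X))"
      using C(1) edge_h_pos[OF n(2)] t unfolding exp_add[symmetric] by (intro mult_left_mono) auto
    finally show "\<bar>f n (X + edge_shift n c)\<bar> \<le> C * exp 1 * edge_h n ^ p * exp (- X)" by (simp only: mult_ac)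
  qed (use C in simp)
qed

lemma decayc_cong:
  assumes "\<And>n c X. n > 0 \<Longrightarrow> f n c X = g n c X" "decayc B s p f"
  shows "decayc B s p g"
  using assms unfolding decayc_def by metis

lemma decayc_add:
  assumes "decayc B s p f" "decayc B s p g"
  shows "decayc B s p (\<lambda>n c X. f n c X + g n c X)"
proof -
  obtain C N where C: "C \<ge> 0" "\<And>n c X. n \<ge> N \<Longrightarrow> n > 0 \<Longrightarrow> \<bar>c\<bar> \<le> B \<Longrightarrow> X \<ge> s \<Longrightarrow> \<bar>f n c X\<bar> \<le> C * edge_h n ^ p * exp (- X)"
    using assms(1) by (rule decaycE) blast
  obtain D M where D: "D \<ge> 0" "\<And>n c X. n \<ge> M \<Longrightarrow> n > 0 \<Longrightarrow> \<bar>c\<bar> \<le> B \<Longrightarrow> X \<ge> s \<Longrightarrow> \<bar>g n c X\<bar> \<le> D * edge_h n ^ p * exp (- X)"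
    using assms(2) by (rule decaycE) blast
  show ?thesis
  proof (rule decaycI[of "C + D" "max N M"])
    fix n c X assume n: "n \<ge> max N M" "n > 0" "\<bar>c\<bar> \<le> B" "X \<ge> s"
    have "\<bar>f n c X + g n c X\<bar> \<le> C * edge_h n ^ p * exp (- X) + D * edge_h n ^ p * exp (- X)"
      using n by (intro order_trans[OF abs_triangle_ineq] add_mono C D) auto
    then show "\<bar>f n c X + g n c X\<bar> \<le> (C + D) * edge_h n ^ p * exp (- X)" by (simp add: algebra_simps)
  qed (use C D in simp)
qed

lemma decayc_scalar:
  assumes f: "decayc B s p f"
    and k: "K \<ge> 0" "\<And>n c. n \<ge> M \<Longrightarrow> n > 0 \<Longrightarrow> \<bar>c\<bar> \<le> B \<Longrightarrow> \<bar>k n c\<bar> \<le> K * edge_h n ^ q"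
    and p': "p' \<le> p + q"
  shows "decayc B s p' (\<lambda>n c X. k n c * f n c X)"
proof -
  obtain C N where C: "C \<ge> 0" "\<And>n c X. n \<ge> N \<Longrightarrow> n > 0 \<Longrightarrow> \<bar>c\<bar> \<le> B \<Longrightarrow> X \<ge> s \<Longrightarrow> \<bar>f n c X\<bar> \<le> C * edge_h n ^ p * exp (- X)"
    using f by (rule decaycE) blast
  show ?thesis
  proof (rule decaycI[of "K * C" "max N M"])
    fix n c X assume n: "n \<ge> max N M" "n > 0" "\<bar>c\<bar> \<le> B" "X \<ge> s"
    have h: "0 < edge_h n" "edge_h n \<le> 1" using edge_h_pos[OF n(2)] edge_h_le_1[OF n(2)] by auto
    have "\<bar>k n c * f n c X\<bar> \<le> (K * edge_h n ^ q) * (C * edge_h n ^ p * exp (- X))"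
      unfolding abs_mult using n k(1) h by (intro mult_mono k C(2)) auto
    also have "\<dots> = K * C * edge_h n ^ (p + q) * exp (- X)" by (simp add: power_add mult_ac)
    also have "\<dots> \<le> K * C * edge_h n ^ p' * exp (- X)"
      using k(1) C(1) h p' by (intro mult_right_mono mult_left_mono power_decreasing) auto
    finally show "\<bar>k n c * f n c X\<bar> \<le> K * C * edge_h n ^ p' * exp (- X)" .
  qed (use C k in simp)
qed

lemma decayc_const: "decayc B s p f \<Longrightarrow> decayc B s p (\<lambda>n c X. k * f n c X)"
  by (rule decayc_scalar[where K="\<bar>k\<bar>" and M=0 and q=0]) auto

lemma decayc_h: "decayc B s p f \<Longrightarrow> p' \<le> p + q \<Longrightarrow> decayc B s p' (\<lambda>n c X. edge_h n ^ q * f n c X)"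
  by (rule decayc_scalar[where K=1 and M=0 and q=q]) (auto simp: abs_of_nonneg edge_h_def)

lemma decayc_c: "B \<ge> 0 \<Longrightarrow> decayc B s p f \<Longrightarrow> decayc B s p (\<lambda>n c X. c ^ k * f n c X)"
  by (rule decayc_scalar[where K="B ^ k" and M=0 and q=0]) (auto simp: power_abs intro: power_mono)

lemma decayc_mono: "decayc B s p f \<Longrightarrow> p' \<le> p \<Longrightarrow> decayc B s p' f"
  using decayc_scalar[where K=1 and M=0 and q=0 and k="\<lambda>_ _. 1" and p=p and p'=p'] by simp

lemma decayc_diff: "decayc B s p f \<Longrightarrow> decayc B s p g \<Longrightarrow> decayc B s p (\<lambda>n c X. f n c X - g n c X)"
  using decayc_add[OF _ decayc_const[where k="-1"], of B s p f g] by simp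

lemma decay2_cong:
  assumes "\<And>n c X Y. n > 0 \<Longrightarrow> f n c X Y = g n c X Y" "decay2 B s p f"
  shows "decay2 B s p g"
  using assms unfolding decay2_def by metis

lemma decay2_add:
  assumes "decay2 B s p f" "decay2 B s p g"
  shows "decay2 B s p (\<lambda>n c X Y. f n c X Y + g n c X Y)"
proof -
  obtain C N where C: "C \<ge> 0" "\<And>n c X Y. n \<ge> N \<Longrightarrow> n > 0 \<Longrightarrow> \<bar>c\<bar> \<le> B \<Longrightarrow> X \<ge> s \<Longrightarrow> Y \<ge> s \<Longrightarrow> \<bar>f n c X Y\<bar> \<le> C * edge_h n ^ p * exp (- X - Y)"
    using assms(1) by (rule decay2E) blast
  obtain D M where D: "D \<ge> 0" "\<And>n c X Y. n \<ge> M \<Longrightarrow> n > 0 \<Longrightarrow> \<bar>c\<bar> \<le> B \<Longrightarrow> X \<ge> s \<Longrightarrow> Y \<ge> s \<Longrightarrow> \<bar>g n c X Y\<bar> \<le> D * edge_h n ^ p * exp (- X - Y)"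
    using assms(2) by (rule decay2E) blast
  show ?thesis
  proof (rule decay2I[of "C + D" "max N M"])
    fix n c X Y assume n: "n \<ge> max N M" "n > 0" "\<bar>c\<bar> \<le> B" "X \<ge> s" "Y \<ge> s"
    have "\<bar>f n c X Y + g n c X Y\<bar> \<le> C * edge_h n ^ p * exp (- X - Y) + D * edge_h n ^ p * exp (- X - Y)"
      using n by (intro order_trans[OF abs_triangle_ineq] add_mono C D) auto
    then show "\<bar>f n c X Y + g n c X Y\<bar> \<le> (C + D) * edge_h n ^ p * exp (- X - Y)" by (simp add: algebra_simps)
  qed (use C D in simp)
qed

lemma decay2_const:
  assumes "decay2 B s p f"
  shows "decay2 B s p (\<lambda>n c X Y. k * f n c X Y)"
proof -
  obtain C N where C: "C \<ge> 0" "\<And>n c X Y. n \<ge> N \<Longrightarrow> n > 0 \<Longrightarrow> \<bar>c\<bar> \<le> B \<Longrightarrow> X \<ge> s \<Longrightarrow> Y \<ge> s \<Longrightarrow> \<bar>f n c X Y\<bar> \<le> C * edge_h n ^ p * exp (- X - Y)"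
    using assms(1) by (rule decay2E) blast
  show ?thesis
  proof (rule decay2I[of "\<bar>k\<bar> * C" N])
    fix n c X Y assume n: "n \<ge> N" "n > 0" "\<bar>c\<bar> \<le> B" "X \<ge> s" "Y \<ge> s"
    show "\<bar>k * f n c X Y\<bar> \<le> \<bar>k\<bar> * C * edge_h n ^ p * exp (- X - Y)"
      using mult_left_mono[OF C(2)[OF n], of "\<bar>k\<bar>"] by (simp add: abs_mult mult.assoc)
  qed (use C in simp)
qed

lemma decay2_diff: "decay2 B s p f \<Longrightarrow> decay2 B s p g \<Longrightarrow> decay2 B s p (\<lambda>n c X Y. f n c X Y - g n c X Y)"
  using decay2_add[OF _ decay2_const[where k="-1"], of B s p f g] by simp

lemma decay2_mult:
  assumes "decayc B s p f" "decayc B s q g" "r \<le> p + q"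
  shows "decay2 B s r (\<lambda>n c X Y. f n c X * g n c Y)"
proof -
  obtain C N where C: "C \<ge> 0" "\<And>n c X. n \<ge> N \<Longrightarrow> n > 0 \<Longrightarrow> \<bar>c\<bar> \<le> B \<Longrightarrow> X \<ge> s \<Longrightarrow> \<bar>f n c X\<bar> \<le> C * edge_h n ^ p * exp (- X)"
    using assms(1) by (rule decaycE) blast
  obtain D M where D: "D \<ge> 0" "\<And>n c X. n \<ge> M \<Longrightarrow> n > 0 \<Longrightarrow> \<bar>c\<bar> \<le> B \<Longrightarrow> X \<ge> s \<Longrightarrow> \<bar>g n c X\<bar> \<le> D * edge_h n ^ q * exp (- X)"
    using assms(2) by (rule decaycE) blast
  show ?thesis
  proof (rule decay2I[of "C * D" "max N M"])
    fix n c X Y assume n: "n \<ge> max N M" "n > 0" "\<bar>c\<bar> \<le> B" "X \<ge> s" "Y \<ge> s"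
    have h: "0 < edge_h n" "edge_h n \<le> 1" using edge_h_pos[OF n(2)] edge_h_le_1[OF n(2)] by auto
    have "\<bar>f n c X * g n c Y\<bar> \<le> (C * edge_h n ^ p * exp (- X)) * (D * edge_h n ^ q * exp (- Y))"
      unfolding abs_mult using n C(1) h by (intro mult_mono C(2) D(2)) auto
    also have "\<dots> = C * D * edge_h n ^ (p + q) * exp (- X - Y)" by (simp add: power_add exp_diff exp_minus divide_inverse mult_ac)
    also have "\<dots> \<le> C * D * edge_h n ^ r * exp (- X - Y)"
      using C(1) D(1) h assms(3) by (intro mult_right_mono mult_left_mono power_decreasing) auto
    finally show "\<bar>f n c X * g n c Y\<bar> \<le> C * D * edge_h n ^ r * exp (- X - Y)" .
  qed (use C D in simp)
qed

lemma decay2_mult_diff: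
  assumes "decayc B s 3 (\<lambda>n c X. f n c X - f' n c X)" "decayc B s 3 (\<lambda>n c X. g n c X - g' n c X)"
    "decayc B s 0 g" "decayc B s 0 f'"
  shows "decay2 B s 3 (\<lambda>n c X Y. f n c X * g n c Y - f' n c X * g' n c Y)"
proof -
  have "decay2 B s 3 (\<lambda>n c X Y. (f n c X - f' n c X) * g n c Y + f' n c X * (g n c Y - g' n c Y))"
    by (intro decay2_add decay2_mult[OF assms(1,3)] decay2_mult[OF assms(4,2)]) auto
  then show ?thesis by (rule decay2_cong[rotated]) (simp add: algebra_simps)
qed

text \<open>Products of two quadratic polynomials in h are truncated after h^2; the dropped terms
  carry h^3 or h^4.\<close>

lemma decay2_quadratic:
  assumes "decayc B s 0 x0" "decayc B s 0 x1" "decayc B s 0 x2" "decayc B s 0 y0" "decayc B s 0 y1" "decayc B s 0 y2"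
  shows "decay2 B s 3 (\<lambda>n c X Y. (x0 n c X + edge_h n ^ 1 * x1 n c X + edge_h n ^ 2 * x2 n c X) * (y0 n c Y + edge_h n ^ 1 * y1 n c Y + edge_h n ^ 2 * y2 n c Y)
     - (x0 n c X * y0 n c Y + edge_h n * (x1 n c X * y0 n c Y + x0 n c X * y1 n c Y)
        + edge_h n ^ 2 * (x2 n c X * y0 n c Y + x1 n c X * y1 n c Y + x0 n c X * y2 n c Y)))"
proof -
  have "decay2 B s 3 (\<lambda>n c X Y. (edge_h n ^ 2 * x2 n c X) * (edge_h n ^ 1 * y1 n c Y) + (edge_h n ^ 1 * x1 n c X) * (edge_h n ^ 2 * y2 n c Y) + (edge_h n ^ 2 * x2 n c X) * (edge_h n ^ 2 * y2 n c Y))"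
    by (intro decay2_add decay2_mult[where p=2 and q=1] decay2_mult[where p=1 and q=2] decay2_mult[where p=2 and q=2] decayc_h[where p=0] assms) auto
  then show ?thesis by (rule decay2_cong[rotated]) (simp add: power2_eq_square algebra_simps)
qed

text \<open>The remainder is the shift to the power k + 1, of order h^(k + 1), times the supremum of
  the next derivative over [X - 1, X + 1], which decays like exp (- X).\<close>

lemma Taylor_shift:
  fixes f :: "nat \<Rightarrow> real \<Rightarrow> real"
  assumes der: "\<And>i x. i \<le> k \<Longrightarrow> (f i has_real_derivative f (Suc i) x) (at x)"
    and dec: "\<And>m. decay (s - 1) 0 m (\<lambda>n. f (Suc k))" and B: "B \<ge> 0"
  shows "decayc B s (Suc k) (\<lambda>n c X. f 0 (X + edge_shift n c) - (\<Sum>i\<le>k. f i X * edge_shift n c ^ i / fact i))"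
proof -
  obtain C N where C: "C \<ge> 0" "\<And>n X. n \<ge> N \<Longrightarrow> n > 0 \<Longrightarrow> X \<ge> s - 1 \<Longrightarrow> norm (f (Suc k) X) \<le> C * edge_h n ^ 0 * exp (- (1 * X))"
    using dec[of 1] by (rule decayE) blast
  have C': "\<bar>f (Suc k) X\<bar> \<le> C * exp (- X)" if "X \<ge> s - 1" for X
    using C(2)[of "max 1 N" X] that by simp
  obtain M where M: "\<And>n c. n \<ge> M \<Longrightarrow> n > 0 \<Longrightarrow> \<bar>c\<bar> \<le> B \<Longrightarrow> \<bar>edge_shift n c\<bar> \<le> 1"
    "\<And>n c. n \<ge> M \<Longrightarrow> n > 0 \<Longrightarrow> \<bar>c\<bar> \<le> B \<Longrightarrow> \<bar>edge_shift n c\<bar> \<le> (B + B\<^sup>2) * edge_h n"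
    using edge_shift_bounds[OF B] by metis
  show ?thesis
  proof (rule decaycI[of "C * exp 1 * (B + B\<^sup>2) ^ Suc k" M])
    fix n c X assume n: "n \<ge> M" "n > 0" "\<bar>c\<bar> \<le> B" "X \<ge> s"
    define t where "t = edge_shift n c"
    have t: "\<bar>t\<bar> \<le> 1" "\<bar>t\<bar> \<le> (B + B\<^sup>2) * edge_h n" using M[OF n(1-3)] by (auto simp: t_def)
    have "norm (f 0 (X + t) - (\<Sum>i\<le>k. f i X * (X + t - X) ^ i / fact i)) \<le> (C * (exp 1 * exp (- X))) * norm (X + t - X) ^ Suc k / fact k"
    proof (rule field_Taylor[of "{X - 1..X + 1}" k f "C * (exp 1 * exp (- X))" X "X + t"])
      show "(f i has_field_derivative f (Suc i) x) (at x within {X - 1..X + 1})" if "i \<le> k" for x i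
        using der[OF that] by (rule has_field_derivative_at_within)
      fix x assume x: "x \<in> {X - 1..X + 1}"
      have "\<bar>f (Suc k) x\<bar> \<le> C * exp (- x)" using x n by (intro C') auto
      also have "\<dots> \<le> C * (exp 1 * exp (- X))"
        using C(1) x unfolding exp_add[symmetric] by (intro mult_left_mono) auto
      finally show "norm (f (Suc k) x) \<le> C * (exp 1 * exp (- X))" by simp
    qed (use t in \<open>auto simp: abs_le_iff\<close>)
    also have "\<dots> \<le> (C * (exp 1 * exp (- X))) * ((B + B\<^sup>2) * edge_h n) ^ Suc k / 1"
      using C(1) t edge_h_pos[OF n(2)] B by (intro frac_le mult_left_mono power_mono) auto
    finally show "\<bar>f 0 (X + edge_shift n c) - (\<Sum>i\<le>k. f i X * edge_shift n c ^ i / fact i)\<bar> \<le> C * exp 1 * (B + B\<^sup>2) ^ Suc k * edge_h n ^ Suc k * exp (- X)"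
      by (simp add: t_def[symmetric] power_mult_distrib mult_ac del: power_Suc)
  qed (use C B in simp)
qed

lemma decayc_shift_error:
  assumes "B \<ge> 0" "decayc B s 0 f"
  shows "decayc B s 3 (\<lambda>n c X. (edge_shift n c - c * edge_h n) * f n c X)"
    "decayc B s 3 (\<lambda>n c X. (edge_shift n c ^ 2 - (c * edge_h n) ^ 2) * f n c X)"
proof -
  obtain M where M: "\<And>n c. n \<ge> M \<Longrightarrow> n > 0 \<Longrightarrow> \<bar>c\<bar> \<le> B \<Longrightarrow> \<bar>edge_shift n c\<bar> \<le> 1"
    "\<And>n c. n \<ge> M \<Longrightarrow> n > 0 \<Longrightarrow> \<bar>c\<bar> \<le> B \<Longrightarrow> \<bar>edge_shift n c - c * edge_h n\<bar> \<le> B\<^sup>2 * edge_h n ^ 3"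
    using edge_shift_bounds[OF assms(1)] by metis
  show "decayc B s 3 (\<lambda>n c X. (edge_shift n c - c * edge_h n) * f n c X)"
    by (rule decayc_scalar[OF assms(2), of "B\<^sup>2" M _ 3]) (use M in auto)
  show "decayc B s 3 (\<lambda>n c X. (edge_shift n c ^ 2 - (c * edge_h n) ^ 2) * f n c X)"
  proof (rule decayc_scalar[OF assms(2), of "B\<^sup>2 * (1 + B)" M _ 3])
    fix n c assume n: "n \<ge> M" "n > 0" "\<bar>c\<bar> \<le> B"
    have "\<bar>c * edge_h n\<bar> \<le> B * 1" unfolding abs_mult
      using n edge_h_pos[OF n(2)] edge_h_le_1[OF n(2)] by (intro mult_mono) auto
    then have "\<bar>edge_shift n c + c * edge_h n\<bar> \<le> 1 + B" using M(1)[OF n] by linarith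
    moreover have "edge_shift n c ^ 2 - (c * edge_h n) ^ 2 = (edge_shift n c - c * edge_h n) * (edge_shift n c + c * edge_h n)"
      by (simp add: power2_eq_square algebra_simps)
    ultimately have "\<bar>edge_shift n c ^ 2 - (c * edge_h n) ^ 2\<bar> \<le> (B\<^sup>2 * edge_h n ^ 3) * (1 + B)"
      unfolding abs_mult using M(2)[OF n] assms(1) by (auto simp: abs_mult intro!: mult_mono)
    then show "\<bar>edge_shift n c ^ 2 - (c * edge_h n) ^ 2\<bar> \<le> B\<^sup>2 * (1 + B) * edge_h n ^ 3" by (simp only: mult_ac)
  qed (use assms in auto)
qed

lemma decayc_plain: "(\<And>m. decay s 0 m (\<lambda>n. f)) \<Longrightarrow> decayc B s 0 (\<lambda>n c X. f X)"
  by (rule decayc_of_decay[of s 0 1 "\<lambda>n. f"]) auto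

text \<open>Used for the terms without a power of h. Terms with a factor h or h^2 need one or two
  Taylor orders fewer, hence \<open>shift_expansion_1\<close> and
  \<open>shift_expansion_0\<close>.\<close>

lemma shift_expansion_2:
  assumes B: "B \<ge> 0"
    and d: "\<And>x. (f0 has_real_derivative f1 x) (at x)" "\<And>x. (f1 has_real_derivative f2 x) (at x)" "\<And>x. (f2 has_real_derivative f3 x) (at x)"
    and dec: "\<And>s m. decay s 0 m (\<lambda>n. f1)" "\<And>s m. decay s 0 m (\<lambda>n. f2)" "\<And>s m. decay s 0 m (\<lambda>n. f3)"
  shows "decayc B s 3 (\<lambda>n c X. f0 (X + edge_shift n c) - (f0 X + edge_h n ^ 1 * (c * f1 X) + edge_h n ^ 2 * (c\<^sup>2 / 2 * f2 X)))"
proof -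
  define f where "f i = (if i = 0 then f0 else if i = 1 then f1 else if i = 2 then f2 else f3)" for i :: nat
  have der: "(f i has_real_derivative f (Suc i) x) (at x)" if "i \<le> 2" for i x
  proof -
    from that have "i = 0 \<or> i = 1 \<or> i = 2" by linarith
    then show ?thesis using d by (auto simp: f_def)
  qed
  have "decayc B s (Suc 2) (\<lambda>n c X. f 0 (X + edge_shift n c) - (\<Sum>i\<le>2. f i X * edge_shift n c ^ i / fact i))"
    by (rule Taylor_shift[where f=f and s=s, OF der _ B]) (simp_all add: f_def dec)
  then have 1: "decayc B s 3 (\<lambda>n c X. f0 (X + edge_shift n c) - (f0 X + f1 X * edge_shift n c + f2 X * edge_shift n c ^ 2 / 2))"
    by (simp add: f_def eval_nat_numeral add.assoc)
  have "decayc B s 3 (\<lambda>n c X. (f0 (X + edge_shift n c) - (f0 X + f1 X * edge_shift n c + f2 X * edge_shift n c ^ 2 / 2))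
      + ((edge_shift n c - c * edge_h n) * f1 X + 1 / 2 * ((edge_shift n c ^ 2 - (c * edge_h n) ^ 2) * f2 X)))"
    by (intro decayc_add decayc_const 1 decayc_shift_error[OF B] decayc_plain dec)
  then show ?thesis by (rule decayc_cong[rotated]) (simp add: power_mult_distrib field_simps)
qed

lemma shift_expansion_1:
  assumes B: "B \<ge> 0"
    and d: "\<And>x. (f0 has_real_derivative f1 x) (at x)" "\<And>x. (f1 has_real_derivative f2 x) (at x)"
    and dec: "\<And>s m. decay s 0 m (\<lambda>n. f1)" "\<And>s m. decay s 0 m (\<lambda>n. f2)"
  shows "decayc B s 2 (\<lambda>n c X. f0 (X + edge_shift n c) - (f0 X + edge_h n * (c * f1 X)))"
proof -
  define f where "f i = (if i = 0 then f0 else if i = 1 then f1 else f2)" for i :: nat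
  have der: "(f i has_real_derivative f (Suc i) x) (at x)" if "i \<le> 1" for i x
  proof -
    from that have "i = 0 \<or> i = 1" by linarith
    then show ?thesis using d by (auto simp: f_def)
  qed
  have "decayc B s (Suc 1) (\<lambda>n c X. f 0 (X + edge_shift n c) - (\<Sum>i\<le>1. f i X * edge_shift n c ^ i / fact i))"
    by (rule Taylor_shift[where f=f and s=s, OF der _ B]) (simp_all add: f_def dec)
  then have 1: "decayc B s 2 (\<lambda>n c X. f0 (X + edge_shift n c) - (f0 X + f1 X * edge_shift n c))"
    by (simp add: f_def eval_nat_numeral)
  have "decayc B s 2 (\<lambda>n c X. (f0 (X + edge_shift n c) - (f0 X + f1 X * edge_shift n c))
      + (edge_shift n c - c * edge_h n) * f1 X)"
    by (intro decayc_add 1 decayc_mono[OF decayc_shift_error(1)[OF B]] decayc_plain dec) simp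
  then show ?thesis by (rule decayc_cong[rotated]) (simp add: algebra_simps)
qed

lemma shift_expansion_0:
  assumes B: "B \<ge> 0"
    and d: "\<And>x. (f0 has_real_derivative f1 x) (at x)" and dec: "\<And>s m. decay s 0 m (\<lambda>n. f1)"
  shows "decayc B s 1 (\<lambda>n c X. f0 (X + edge_shift n c) - f0 X)"
proof -
  define f where "f i = (if i = 0 then f0 else f1)" for i :: nat
  have "decayc B s (Suc 0) (\<lambda>n c X. f 0 (X + edge_shift n c) - (\<Sum>i\<le>0. f i X * edge_shift n c ^ i / fact i))"
    by (rule Taylor_shift[where f=f and s=s, OF _ _ B]) (auto simp: f_def dec d)
  then show ?thesis by (simp add: f_def)
qed

text \<open>The expansions of \<open>p\<close> and \<open>q\<close> at \<open>X + edge_shift n c\<close> up to \<open>O (h\<^sup>3)\<close>. The redundant powers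
  and zeros give all of them the shape \<open>a + h b + h\<^sup>2 d\<close> of \<open>decay2_quadratic\<close>.\<close>

definition edge_P where
  "edge_P n c X = Airy X + edge_h n ^ 1 * (c * Airy' X) + edge_h n ^ 2 * (airy_u X + c\<^sup>2 / 2 * airy_d2 X)"
definition edge_Q where
  "edge_Q n c X = 0 + edge_h n ^ 1 * (1 / 2 * Airy' X) + edge_h n ^ 2 * (1 / 2 * (c * airy_d2 X))"
definition edge_P' where
  "edge_P' n c X = Airy' X + edge_h n ^ 1 * (c * airy_d2 X) + edge_h n ^ 2 * (airy_u' X + c\<^sup>2 / 2 * airy_d3 X)"
definition edge_Q' where
  "edge_Q' n c X = 0 + edge_h n ^ 1 * (1 / 2 * airy_d2 X) + edge_h n ^ 2 * (1 / 2 * (c * airy_d3 X))"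

text \<open>The product of \<open>edge_P\<close> at X and Y minus that of \<open>edge_Q\<close>,
  truncated after h^2. It is also minus the diagonal derivative of \<open>edge_main\<close>, which
  ties the Hermite side to the claimed expansion.\<close>

definition edge_target :: "nat \<Rightarrow> real \<Rightarrow> real \<Rightarrow> real \<Rightarrow> real" where
  "edge_target n c X Y = (Airy X * Airy Y + edge_h n * ((c * Airy' X) * Airy Y + Airy X * (c * Airy' Y))
     + edge_h n ^ 2 * ((airy_u X + c\<^sup>2 / 2 * airy_d2 X) * Airy Y + (c * Airy' X) * (c * Airy' Y) + Airy X * (airy_u Y + c\<^sup>2 / 2 * airy_d2 Y)))
     - edge_h n ^ 2 * ((1 / 2 * Airy' X) * (1 / 2 * Airy' Y))"

definition edge_target_deriv :: "nat \<Rightarrow> real \<Rightarrow> real \<Rightarrow> real \<Rightarrow> real" where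
  "edge_target_deriv n c X Y = (Airy' X * Airy Y + edge_h n * ((c * airy_d2 X) * Airy Y + Airy' X * (c * Airy' Y))
     + edge_h n ^ 2 * ((airy_u' X + c\<^sup>2 / 2 * airy_d3 X) * Airy Y + (c * airy_d2 X) * (c * Airy' Y) + Airy' X * (airy_u Y + c\<^sup>2 / 2 * airy_d2 Y)))
     - edge_h n ^ 2 * ((1 / 2 * airy_d2 X) * (1 / 2 * Airy' Y))"

definition edge_source_deriv :: "nat \<Rightarrow> real \<Rightarrow> real \<Rightarrow> real" where
  "edge_source_deriv n X Y = (edge_fun_deriv n X * edge_comp n Y + edge_comp_deriv n X * edge_fun n Y) / 2"

context
  fixes B s :: real
  assumes B: "B \<ge> 0"
begin

lemma decayc_airy:
  "decayc B s 0 (\<lambda>n c X. Airy X)" "decayc B s 0 (\<lambda>n c X. Airy' X)" "decayc B s 0 (\<lambda>n c X. airy_u X)"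
  "decayc B s 0 (\<lambda>n c X. airy_u' X)" "decayc B s 0 (\<lambda>n c X. airy_d2 X)" "decayc B s 0 (\<lambda>n c X. airy_d3 X)"
  by (rule decayc_plain decay_Airy decay_airy_terms)+

lemma decayc_c1: "decayc B s p f \<Longrightarrow> decayc B s p (\<lambda>n c X. c * f n c X)"
  using decayc_c[OF B, of s p f 1] by simp

lemma decayc_c2: "decayc B s p f \<Longrightarrow> decayc B s p (\<lambda>n c X. c\<^sup>2 / 2 * f n c X)"
  by (rule decayc_cong[OF _ decayc_const[OF decayc_c[OF B, of s p f 2], of "1 / 2"]]) simp_all

lemma decayc_0: "decayc B s p (\<lambda>n c X. 0)"
  by (rule decaycI[of 0]) auto

lemma decayc_PQ:
  "decayc B s 0 (edge_P)" "decayc B s 0 (edge_Q)" "decayc B s 0 (edge_P')" "decayc B s 0 (edge_Q')"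
  unfolding edge_P_def[abs_def] edge_Q_def[abs_def] edge_P'_def[abs_def] edge_Q'_def[abs_def]
  by (intro decayc_add decayc_h[where p=0] decayc_c1 decayc_c2 decayc_const decayc_0 decayc_airy le0)+

lemma edge_p_shift: "decayc B s 3 (\<lambda>n c X. edge_p n (X + edge_shift n c) - edge_P n c X)"
proof -
  have "decayc B s 3 (\<lambda>n c X. (Airy (X + edge_shift n c) - (Airy X + edge_h n ^ 1 * (c * Airy' X) + edge_h n ^ 2 * (c\<^sup>2 / 2 * airy_d2 X)))
     + edge_h n ^ 2 * (airy_u (X + edge_shift n c) - airy_u X))"
    by (intro decayc_add shift_expansion_2[OF B Airy_DERIV airy_d_DERIV(1,2)] decay_Airy decay_airy_terms decayc_h[OF shift_expansion_0[OF B airy_d_DERIV(4)]]) simp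
  then show ?thesis by (rule decayc_cong[rotated]) (simp add: edge_p_def edge_P_def algebra_simps)
qed

lemma edge_p'_shift: "decayc B s 3 (\<lambda>n c X. edge_p' n (X + edge_shift n c) - edge_P' n c X)"
proof -
  have "decayc B s 3 (\<lambda>n c X. (Airy' (X + edge_shift n c) - (Airy' X + edge_h n ^ 1 * (c * airy_d2 X) + edge_h n ^ 2 * (c\<^sup>2 / 2 * airy_d3 X)))
     + edge_h n ^ 2 * (airy_u' (X + edge_shift n c) - airy_u' X))"
    by (intro decayc_add shift_expansion_2[OF B airy_d_DERIV(1,2,3)] decay_Airy decay_airy_terms decayc_h[OF shift_expansion_0[OF B airy_d_DERIV(5)]]) simp
  then show ?thesis by (rule decayc_cong[rotated]) (simp add: edge_p'_def edge_P'_def algebra_simps)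
qed

lemma edge_q_shift: "decayc B s 3 (\<lambda>n c X. edge_q n (X + edge_shift n c) - edge_Q n c X)"
proof -
  have "decayc B s 3 (\<lambda>n c X. edge_h n ^ 1 * (1 / 2 * (Airy' (X + edge_shift n c) - (Airy' X + edge_h n * (c * airy_d2 X)))))"
    by (intro decayc_h[OF decayc_const[OF shift_expansion_1[OF B airy_d_DERIV(1,2)]]] decay_airy_terms) simp
  then show ?thesis by (rule decayc_cong[rotated]) (simp add: edge_q_def edge_Q_def power2_eq_square algebra_simps)
qed

lemma edge_q'_shift: "decayc B s 3 (\<lambda>n c X. edge_q' n (X + edge_shift n c) - edge_Q' n c X)"
proof -
  have "decayc B s 3 (\<lambda>n c X. edge_h n ^ 1 * (1 / 2 * (airy_d2 (X + edge_shift n c) - (airy_d2 X + edge_h n * (c * airy_d3 X)))))"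
    by (intro decayc_h[OF decayc_const[OF shift_expansion_1[OF B airy_d_DERIV(2,3)]]] decay_airy_terms) simp
  then show ?thesis by (rule decayc_cong[rotated]) (simp add: edge_q'_def edge_Q'_def power2_eq_square algebra_simps)
qed

lemma edge_shift_pairs:
  "decayc B s 3 (\<lambda>n c X. edge_fun n (X + edge_shift n c) - (edge_P n c X - edge_Q n c X))"
  "decayc B s 3 (\<lambda>n c X. edge_comp n (X + edge_shift n c) - (edge_P n c X + edge_Q n c X))"
  "decayc B s 3 (\<lambda>n c X. edge_fun_deriv n (X + edge_shift n c) - (edge_P' n c X - edge_Q' n c X))"
  "decayc B s 3 (\<lambda>n c X. edge_comp_deriv n (X + edge_shift n c) - (edge_P' n c X + edge_Q' n c X))"
  by (rule decayc_cong[OF _ decayc_add[OF decayc_shift[OF edge_pair_decay(1) order_refl B] decayc_diff[OF edge_p_shift edge_q_shift]]], simp)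
     (rule decayc_cong[OF _ decayc_add[OF decayc_shift[OF edge_pair_decay(2) order_refl B] decayc_add[OF edge_p_shift edge_q_shift]]], simp,
      rule decayc_cong[OF _ decayc_add[OF decayc_shift[OF edge_pair_decay(3) order_refl B] decayc_diff[OF edge_p'_shift edge_q'_shift]]], simp,
      rule decayc_cong[OF _ decayc_add[OF decayc_shift[OF edge_pair_decay(4) order_refl B] decayc_add[OF edge_p'_shift edge_q'_shift]]], simp)

lemma decayc_of_approx:
  assumes "decayc B s 3 (\<lambda>n c X. f n c X - g n c X)" "decayc B s 0 (\<lambda>n c X. g n c X)"
  shows "decayc B s 0 (\<lambda>n c X. f n c X)"
  by (rule decayc_cong[OF _ decayc_add[OF decayc_mono[OF assms(1) le0] assms(2)]]) simp

lemma PP_quadratic: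
  "decay2 B s 3 (\<lambda>n c X Y. edge_P n c X * edge_P n c Y - (Airy X * Airy Y + edge_h n * ((c * Airy' X) * Airy Y + Airy X * (c * Airy' Y))
     + edge_h n ^ 2 * ((airy_u X + c\<^sup>2 / 2 * airy_d2 X) * Airy Y + (c * Airy' X) * (c * Airy' Y) + Airy X * (airy_u Y + c\<^sup>2 / 2 * airy_d2 Y))))"
  unfolding edge_P_def by (rule decay2_quadratic; intro decayc_add decayc_c1 decayc_c2 decayc_airy)

lemma P'P_quadratic:
  "decay2 B s 3 (\<lambda>n c X Y. edge_P' n c X * edge_P n c Y - (Airy' X * Airy Y + edge_h n * ((c * airy_d2 X) * Airy Y + Airy' X * (c * Airy' Y))
     + edge_h n ^ 2 * ((airy_u' X + c\<^sup>2 / 2 * airy_d3 X) * Airy Y + (c * airy_d2 X) * (c * Airy' Y) + Airy' X * (airy_u Y + c\<^sup>2 / 2 * airy_d2 Y))))"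
  unfolding edge_P_def edge_P'_def by (rule decay2_quadratic; intro decayc_add decayc_c1 decayc_c2 decayc_airy)

lemma QQ_quadratic:
  "decay2 B s 3 (\<lambda>n c X Y. edge_Q n c X * edge_Q n c Y - (0 * 0 + edge_h n * ((1 / 2 * Airy' X) * 0 + 0 * (1 / 2 * Airy' Y))
     + edge_h n ^ 2 * ((1 / 2 * (c * airy_d2 X)) * 0 + (1 / 2 * Airy' X) * (1 / 2 * Airy' Y) + 0 * (1 / 2 * (c * airy_d2 Y)))))"
  unfolding edge_Q_def by (rule decay2_quadratic; intro decayc_add decayc_c1 decayc_c2 decayc_airy decayc_0 decayc_const)

lemma Q'Q_quadratic:
  "decay2 B s 3 (\<lambda>n c X Y. edge_Q' n c X * edge_Q n c Y - (0 * 0 + edge_h n * ((1 / 2 * airy_d2 X) * 0 + 0 * (1 / 2 * Airy' Y))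
     + edge_h n ^ 2 * ((1 / 2 * (c * airy_d3 X)) * 0 + (1 / 2 * airy_d2 X) * (1 / 2 * Airy' Y) + 0 * (1 / 2 * (c * airy_d2 Y)))))"
  unfolding edge_Q_def edge_Q'_def by (rule decay2_quadratic; intro decayc_add decayc_c1 decayc_c2 decayc_airy decayc_0 decayc_const)

text \<open>Symmetrising (P - Q)(X) (P + Q)(Y) leaves P(X) P(Y) - Q(X) Q(Y). Since Q starts at order
  h, its product contributes a single term of order h^2.\<close>

lemma edge_source_decay:
  "decay2 B s 3 (\<lambda>n c X Y. edge_source n (X + edge_shift n c) (Y + edge_shift n c) - edge_target n c X Y)"
proof -
  note PmQ = decayc_diff[OF decayc_PQ(1,2)] and PpQ = decayc_add[OF decayc_PQ(1,2)]
  note F = edge_shift_pairs(1) and G = edge_shift_pairs(2)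
  have "decay2 B s 3 (\<lambda>n c X Y. (1 / 2 * (edge_fun n (X + edge_shift n c) * edge_comp n (Y + edge_shift n c) - (edge_P n c X - edge_Q n c X) * (edge_P n c Y + edge_Q n c Y))
      + 1 / 2 * (edge_comp n (X + edge_shift n c) * edge_fun n (Y + edge_shift n c) - (edge_P n c X + edge_Q n c X) * (edge_P n c Y - edge_Q n c Y)))
      + ((edge_P n c X * edge_P n c Y - (Airy X * Airy Y + edge_h n * ((c * Airy' X) * Airy Y + Airy X * (c * Airy' Y))
     + edge_h n ^ 2 * ((airy_u X + c\<^sup>2 / 2 * airy_d2 X) * Airy Y + (c * Airy' X) * (c * Airy' Y) + Airy X * (airy_u Y + c\<^sup>2 / 2 * airy_d2 Y))))
       - (edge_Q n c X * edge_Q n c Y - (0 * 0 + edge_h n * ((1 / 2 * Airy' X) * 0 + 0 * (1 / 2 * Airy' Y))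
     + edge_h n ^ 2 * ((1 / 2 * (c * airy_d2 X)) * 0 + (1 / 2 * Airy' X) * (1 / 2 * Airy' Y) + 0 * (1 / 2 * (c * airy_d2 Y)))))))"
    by (intro decay2_add decay2_diff[OF PP_quadratic QQ_quadratic] decay2_const
        decay2_mult_diff[OF F G decayc_of_approx[OF G PpQ] PmQ] decay2_mult_diff[OF G F decayc_of_approx[OF F PmQ] PpQ])
  then show ?thesis
    by (rule decay2_cong[rotated]) (simp add: edge_source_eq edge_target_def field_simps)
qed

lemma edge_source_deriv_decay:
  "decay2 B s 3 (\<lambda>n c X Y. edge_source_deriv n (X + edge_shift n c) (Y + edge_shift n c) - edge_target_deriv n c X Y)"
proof -
  note PmQ = decayc_diff[OF decayc_PQ(1,2)] and PpQ = decayc_add[OF decayc_PQ(1,2)]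
    and PmQ' = decayc_diff[OF decayc_PQ(3,4)] and PpQ' = decayc_add[OF decayc_PQ(3,4)]
  note F = edge_shift_pairs(1) and G = edge_shift_pairs(2) and F' = edge_shift_pairs(3) and G' = edge_shift_pairs(4)
  have "decay2 B s 3 (\<lambda>n c X Y. (1 / 2 * (edge_fun_deriv n (X + edge_shift n c) * edge_comp n (Y + edge_shift n c) - (edge_P' n c X - edge_Q' n c X) * (edge_P n c Y + edge_Q n c Y))
      + 1 / 2 * (edge_comp_deriv n (X + edge_shift n c) * edge_fun n (Y + edge_shift n c) - (edge_P' n c X + edge_Q' n c X) * (edge_P n c Y - edge_Q n c Y)))
      + ((edge_P' n c X * edge_P n c Y - (Airy' X * Airy Y + edge_h n * ((c * airy_d2 X) * Airy Y + Airy' X * (c * Airy' Y))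
     + edge_h n ^ 2 * ((airy_u' X + c\<^sup>2 / 2 * airy_d3 X) * Airy Y + (c * airy_d2 X) * (c * Airy' Y) + Airy' X * (airy_u Y + c\<^sup>2 / 2 * airy_d2 Y))))
       - (edge_Q' n c X * edge_Q n c Y - (0 * 0 + edge_h n * ((1 / 2 * airy_d2 X) * 0 + 0 * (1 / 2 * Airy' Y))
     + edge_h n ^ 2 * ((1 / 2 * (c * airy_d3 X)) * 0 + (1 / 2 * airy_d2 X) * (1 / 2 * Airy' Y) + 0 * (1 / 2 * (c * airy_d2 Y)))))))"
    by (intro decay2_add decay2_diff[OF P'P_quadratic Q'Q_quadratic] decay2_const
        decay2_mult_diff[OF F' G decayc_of_approx[OF G PpQ] PmQ'] decay2_mult_diff[OF G' F decayc_of_approx[OF F PmQ] PpQ'])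
  then show ?thesis
    by (rule decay2_cong[rotated]) (simp add: edge_source_deriv_def edge_target_deriv_def field_simps)
qed

end

section \<open>From diagonal derivatives back to values\<close>

lemma edge_source_DERIV:
  assumes "n > 0"
  shows "((\<lambda>X. edge_source n (X + t) (Y + t)) has_real_derivative edge_source_deriv n (X + t) (Y + t)) (at X)"
proof -
  have sh: "((\<lambda>X. X + t) has_real_derivative 1) (at X)" by (auto intro!: derivative_eq_intros)
  have F: "((\<lambda>X. edge_fun n (X + t)) has_real_derivative edge_fun_deriv n (X + t)) (at X)"
    using DERIV_chain2[OF edge_fun_DERIV sh] by simp
  have G: "((\<lambda>X. edge_comp n (X + t)) has_real_derivative edge_comp_deriv n (X + t)) (at X)"
    using DERIV_chain2[OF edge_comp_DERIV[OF assms] sh] by simp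
  show ?thesis unfolding edge_source_eq[abs_def] edge_source_deriv_def
    by (auto intro!: derivative_eq_intros F G)
qed

lemma edge_target_DERIV:
  "((\<lambda>X. edge_target n c X Y) has_real_derivative edge_target_deriv n c X Y) (at X)"
  unfolding edge_target_def[abs_def] edge_target_deriv_def
  by (auto intro!: derivative_eq_intros Airy_DERIV airy_d_DERIV simp: algebra_simps)

text \<open>Adding M / 2 exp (- 2 z) makes the function nonincreasing with limit 0, hence
  nonnegative at 0; the same holds for - e. The comparison replaces integration of e', so its
  integrability never has to be discussed.\<close>

lemma integral_decay_bound:
  fixes e e' :: "real \<Rightarrow> real"
  assumes der: "\<And>z. z \<ge> 0 \<Longrightarrow> (e has_real_derivative e' z) (at z)"
    and bd: "\<And>z. z \<ge> 0 \<Longrightarrow> \<bar>e' z\<bar> \<le> M * exp (- (2 * z))" and lim: "(e \<longlongrightarrow> 0) at_top"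
  shows "\<bar>e 0\<bar> \<le> M"
proof -
  have M: "M \<ge> 0" using bd[of 0] by simp
  have *: "f 0 \<ge> - (M / 2)" if f: "\<And>z. z \<ge> 0 \<Longrightarrow> (f has_real_derivative f' z) (at z)" "\<And>z. z \<ge> 0 \<Longrightarrow> \<bar>f' z\<bar> \<le> M * exp (- (2 * z))" "(f \<longlongrightarrow> 0) at_top" for f f' :: "real \<Rightarrow> real"
  proof -
    define g where "g z = f z + M / 2 * exp (- (2 * z))" for z
    have "g z \<le> g 0" if z: "z \<ge> 0" for z
    proof (rule DERIV_nonpos_imp_nonincreasing[OF z])
      fix x :: real assume x: "0 \<le> x" "x \<le> z"
      have "(g has_real_derivative f' x - M * exp (- (2 * x))) (at x)"
        unfolding g_def using x by (auto intro!: derivative_eq_intros f(1))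
      moreover have "f' x - M * exp (- (2 * x)) \<le> 0" using f(2)[OF x(1)] by linarith
      ultimately show "\<exists>y. (g has_real_derivative y) (at x) \<and> y \<le> 0" by blast
    qed
    then have ev: "\<forall>\<^sub>F z in at_top. g z \<le> g 0" unfolding eventually_at_top_linorder by blast
    have "((\<lambda>z. M / 2 * exp (- (2 * z))) \<longlongrightarrow> 0) at_top" by real_asymp
    then have "(g \<longlongrightarrow> 0 + 0) at_top" unfolding g_def by (intro tendsto_add f(3))
    then have "0 \<le> g 0" using tendsto_upperbound[OF _ ev] by simp
    then show ?thesis by (simp add: g_def)
  qed
  have "e 0 \<ge> - (M / 2)" by (rule *[OF der bd lim])
  moreover have "- e 0 \<ge> - (M / 2)"
    by (rule *[of "\<lambda>z. - e z" "\<lambda>z. - e' z"]) (use der bd lim in \<open>auto intro: DERIV_minus tendsto_minus_cancel\<close>)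
  ultimately show ?thesis using M by (simp add: abs_le_iff)
qed

lemma decay_pointwise:
  fixes f :: "real \<Rightarrow> real"
  assumes "decay s 0 m (\<lambda>n. f)"
  obtains C where "C \<ge> 0" "\<And>X. X \<ge> s \<Longrightarrow> \<bar>f X\<bar> \<le> C * exp (- (m * X))"
proof -
  obtain C N where C: "C \<ge> 0" "\<And>n X. n \<ge> N \<Longrightarrow> n > 0 \<Longrightarrow> X \<ge> s \<Longrightarrow> norm (f X) \<le> C * edge_h n ^ 0 * exp (- (m * X))"
    using assms by (rule decayE) blast
  show ?thesis by (rule that[OF C(1)]) (use C(2)[of "max 1 N"] in simp)
qed

lemma tendsto_0_decay:
  fixes f :: "real \<Rightarrow> real"
  assumes "decay s 0 1 (\<lambda>n. f)"
  shows "((\<lambda>z. f (X + z)) \<longlongrightarrow> 0) at_top"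
proof -
  obtain C where C: "C \<ge> 0" "\<And>X. X \<ge> s \<Longrightarrow> \<bar>f X\<bar> \<le> C * exp (- (1 * X))"
    using assms by (rule decay_pointwise) blast
  have ev: "\<forall>\<^sub>F z in at_top. norm (f z) \<le> C * exp (- z)"
    using eventually_ge_at_top[of s] by eventually_elim (use C(2) in simp)
  have "((\<lambda>z. C * exp (- z)) \<longlongrightarrow> 0) at_top" by real_asymp
  then have f0: "(f \<longlongrightarrow> 0) at_top" by (rule Lim_null_comparison[OF ev])
  have "filterlim (\<lambda>z. X + z) at_top at_top" by real_asymp
  from filterlim_compose[OF f0 this] show ?thesis .
qed

section \<open>The Airy kernel along the diagonal\<close>

lemma Airy_continuous: "continuous_on A Airy" "continuous_on A Airy'"
  by (auto intro!: DERIV_continuous_on DERIV_subset[OF Airy_DERIV] DERIV_subset[OF deriv_Airy_DERIV])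

lemma Airy_product_integrable: "set_integrable lborel {T..} (\<lambda>z. Airy (X + z) * Airy (Y + z))"
proof -
  define s where "s = min X Y + T"
  obtain C where C: "C \<ge> 0" "\<And>X. X \<ge> s \<Longrightarrow> \<bar>Airy X\<bar> \<le> C * exp (- (1 * X))"
    using decay_Airy(1) by (rule decay_pointwise) blast
  have lim: "((\<lambda>z. - exp (- (2 * z)) / 2) \<longlongrightarrow> (0::real)) at_top" by real_asymp
  have "set_integrable lborel {T..} (\<lambda>z. exp (- (2 * z)))"
    unfolding set_integrable_def
  proof (rule integrableI_nn_integral_finite[where x="0 - (- exp (- (2 * T)) / 2)"])
    have "(\<integral>\<^sup>+ z. ennreal (exp (- (2 * z))) * indicator {T..} z \<partial>lborel) = ennreal (0 - (- exp (- (2 * T)) / 2))"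
      by (rule nn_integral_FTC_atLeast[where F="\<lambda>z. - exp (- (2 * z)) / 2"])
         (use lim in \<open>auto intro!: derivative_eq_intros\<close>)
    moreover have "(\<integral>\<^sup>+ z. ennreal (indicat_real {T..} z *\<^sub>R exp (- (2 * z))) \<partial>lborel) = (\<integral>\<^sup>+ z. ennreal (exp (- (2 * z))) * indicator {T..} z \<partial>lborel)"
      by (intro nn_integral_cong) (auto split: split_indicator)
    ultimately show "(\<integral>\<^sup>+ z. ennreal (indicat_real {T..} z *\<^sub>R exp (- (2 * z))) \<partial>lborel) = ennreal (0 - (- exp (- (2 * T)) / 2))"
      by (simp only:)
  qed auto
  then have "set_integrable lborel {T..} (\<lambda>z. (C * exp (- X) * (C * exp (- Y))) * exp (- (2 * z)))"
    by (intro set_integrable_mult_right)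
  then show ?thesis
  proof (rule set_integrable_bound)
    show "set_borel_measurable lborel {T..} (\<lambda>z. Airy (X + z) * Airy (Y + z))"
      unfolding set_borel_measurable_def
      by (intro borel_measurable_scaleR borel_measurable_indicator borel_measurable_continuous_lborel continuous_on_mult
          continuous_on_compose2[OF Airy_continuous(1)[of UNIV]] continuous_intros) auto
    have "norm (Airy (X + z) * Airy (Y + z)) \<le> norm ((C * exp (- X) * (C * exp (- Y))) * exp (- (2 * z)))" if "z \<ge> T" for z
    proof -
      have "\<bar>Airy (X + z) * Airy (Y + z)\<bar> \<le> (C * exp (- (1 * (X + z)))) * (C * exp (- (1 * (Y + z))))"
        unfolding abs_mult using that C(1) by (intro mult_mono C(2)) (auto simp: s_def)
      also have "\<dots> = (C * exp (- X) * (C * exp (- Y))) * exp (- (2 * z))"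
      proof -
        have "exp (- (1 * (X + z))) * exp (- (1 * (Y + z))) = exp (- X) * exp (- Y) * exp (- (2 * z))"
          unfolding exp_add[symmetric] by (intro arg_cong[of _ _ exp]) simp
        then show ?thesis by (simp only: mult_ac)
      qed
      finally show ?thesis using C(1) by (simp add: abs_mult)
    qed
    then show "AE x in lborel. x \<in> {T..} \<longrightarrow> norm (Airy (X + x) * Airy (Y + x)) \<le> norm ((C * exp (- X) * (C * exp (- Y))) * exp (- (2 * x)))"
      by (intro AE_I2) auto
  qed
qed

lemma Airy_kernel_shift: "Airy_kernel (X + t) (Y + t) = (LBINT z:{t..}. Airy (X + z) * Airy (Y + z))"
  unfolding Airy_kernel_def set_lebesgue_integral_def
  by (subst (2) lborel_integral_real_affine[of 1 _ t])
     (auto intro!: Bochner_Integration.integral_cong simp: add.assoc indicator_def)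

lemma Airy_kernel_eq:
  assumes "T \<le> t"
  shows "Airy_kernel (X + t) (Y + t) = Airy_kernel (X + T) (Y + T) - integral {T..t} (\<lambda>z. Airy (X + z) * Airy (Y + z))"
proof -
  let ?f = "\<lambda>z. Airy (X + z) * Airy (Y + z)"
  have hk: "(?f has_integral Airy_kernel (X + t) (Y + t)) {t..}" for t
    unfolding Airy_kernel_shift
    using set_borel_integral_eq_integral[OF Airy_product_integrable[of t X Y]] by (simp add: has_integral_integral)
  have cont: "?f integrable_on {T..t}"
    by (intro integrable_continuous_real continuous_on_mult continuous_on_compose2[OF Airy_continuous(1)[of UNIV]] continuous_intros) auto
  have "(?f has_integral (integral {T..t} ?f + Airy_kernel (X + t) (Y + t))) ({T..t} \<union> {t..})"
    using assms by (intro has_integral_Un integrable_integral cont hk negligible_subset[OF negligible_sing[of t]]) auto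
  moreover have "{T..t} \<union> {t..} = {T..}" using assms by auto
  ultimately show ?thesis using has_integral_unique[OF hk[of T]] by fastforce
qed

text \<open>Moving both arguments by t only moves the lower limit of the integral, so this is the
  fundamental theorem of calculus. Starting at t - 1 makes t an interior point.\<close>

lemma Airy_kernel_diagonal_DERIV:
  "((\<lambda>t. Airy_kernel (X + t) (Y + t)) has_real_derivative - (Airy (X + t) * Airy (Y + t))) (at t)"
proof -
  let ?f = "\<lambda>z. Airy (X + z) * Airy (Y + z)"
  have "continuous_on {t - 1..t + 1} ?f"
    by (intro continuous_on_mult continuous_on_compose2[OF Airy_continuous(1)[of UNIV]] continuous_intros) auto
  then have "((\<lambda>u. integral {t - 1..u} ?f) has_real_derivative ?f t) (at t within {t - 1..t + 1})"
    by (rule integral_has_real_derivative) auto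
  then have "((\<lambda>u. integral {t - 1..u} ?f) has_real_derivative ?f t) (at t)"
    by (subst (asm) at_within_Icc_at) auto
  then have "((\<lambda>u. Airy_kernel (X + (t - 1)) (Y + (t - 1)) - integral {t - 1..u} ?f) has_real_derivative 0 - ?f t) (at t)"
    by (intro DERIV_diff DERIV_const)
  then have "((\<lambda>u. Airy_kernel (X + (t - 1)) (Y + (t - 1)) - integral {t - 1..u} ?f) has_real_derivative - ?f t) (at t)"
    by simp
  then show ?thesis
  proof (rule has_field_derivative_transform_within[where d=1])
    fix u assume "dist u t < 1"
    then show "Airy_kernel (X + (t - 1)) (Y + (t - 1)) - integral {t - 1..u} ?f = Airy_kernel (X + u) (Y + u)"
      using Airy_kernel_eq[of "t - 1" u X Y] by (auto simp: dist_real_def)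
  qed auto
qed

lemma Airy_kernel_tendsto_0: "((\<lambda>t. Airy_kernel (X + t) (Y + t)) \<longlongrightarrow> 0) at_top"
proof -
  let ?f = "\<lambda>z. Airy (X + z) * Airy (Y + z)"
  have lim: "((\<lambda>t. LBINT z:{0..t}. ?f z) \<longlongrightarrow> (LBINT z:{0..}. ?f z)) at_top"
    by (rule tendsto_set_lebesgue_integral_at_top[OF _ Airy_product_integrable]) auto
  have "((\<lambda>t. (LBINT z:{0..}. ?f z) - (LBINT z:{0..t}. ?f z)) \<longlongrightarrow> (LBINT z:{0..}. ?f z) - (LBINT z:{0..}. ?f z)) at_top"
    by (intro tendsto_diff tendsto_const lim)
  then have "((\<lambda>t. (LBINT z:{0..}. ?f z) - (LBINT z:{0..t}. ?f z)) \<longlongrightarrow> 0) at_top" by (simp only: diff_self)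
  moreover have "\<forall>\<^sub>F t in at_top. (LBINT z:{0..}. ?f z) - (LBINT z:{0..t}. ?f z) = Airy_kernel (X + t) (Y + t)"
    using eventually_ge_at_top[of 0]
  proof eventually_elim
    case (elim t)
    have "(LBINT z:{0..t}. ?f z) = integral {0..t} ?f"
      by (intro set_borel_integral_eq_integral(2) set_integrable_subset[OF Airy_product_integrable[of 0]]) auto
    then show ?case using Airy_kernel_eq[OF elim, of X Y] Airy_kernel_shift[of X 0 Y] by simp
  qed
  ultimately show ?thesis by (rule Lim_transform_eventually)
qed

section \<open>The error term\<close>

definition edge_main :: "nat \<Rightarrow> real \<Rightarrow> real \<Rightarrow> real \<Rightarrow> real" where
  "edge_main n c X Y = Airy_kernel X Y - c * Airy X * Airy Y * edge_h n
     + 1 / 20 * ((X + Y) * Airy' X * Airy' Y - (X\<^sup>2 + X * Y + Y\<^sup>2) * Airy X * Airy Y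
         + (- 20 * c\<^sup>2 + 3) / 2 * (Airy' X * Airy Y + Airy X * Airy' Y)) * edge_h n ^ 2"

text \<open>The exact remainder multiplied by n. The expansion thus holds by definition, and the
  content lies in the bounds on this function.\<close>

definition edge_err :: "nat \<Rightarrow> real \<Rightarrow> real \<Rightarrow> real \<Rightarrow> real" where
  "edge_err n c X Y =
     real n * (edge_jacobian n * hermite_kernel n (edge_point c n X) (edge_point c n Y) - edge_main n c X Y)"

definition edge_err_deriv :: "nat \<Rightarrow> real \<Rightarrow> real \<Rightarrow> real \<Rightarrow> real" where
  "edge_err_deriv n c X Y =
     - real n * (edge_source n (X + edge_shift n c) (Y + edge_shift n c) - edge_target n c X Y)"

text \<open>Here the coefficients of the claimed expansion are confirmed: only the Airy equation and
  the product rule are needed to match them with \<open>edge_target\<close>.\<close>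

lemma edge_main_diagonal_DERIV:
  "((\<lambda>z. edge_main n c (X + z) (Y + z)) has_real_derivative - edge_target n c (X + z) (Y + z)) (at z)"
proof -
  have sh: "((\<lambda>z. X + z) has_real_derivative 1) (at z)" for X :: real by (auto intro!: derivative_eq_intros)
  have A: "((\<lambda>z. Airy (X + z)) has_real_derivative Airy' (X + z)) (at z)" for X
    using DERIV_chain2[OF Airy_DERIV sh] by simp
  have A': "((\<lambda>z. Airy' (X + z)) has_real_derivative (X + z) * Airy (X + z)) (at z)" for X
    using DERIV_chain2[OF deriv_Airy_DERIV sh] by simp
  show ?thesis unfolding edge_main_def
    by (rule derivative_eq_intros Airy_kernel_diagonal_DERIV A A' refl)+
      (simp add: edge_target_def airy_u_def airy_d2_def field_simps power2_eq_square)
qed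

lemma edge_err_diagonal_DERIV:
  assumes n: "n > 0"
  shows "((\<lambda>z. edge_err n c (X + z) (Y + z)) has_real_derivative edge_err_deriv n c (X + z) (Y + z)) (at z)"
proof -
  have "((\<lambda>t. edge_jacobian n * hermite_kernel n (edge_point c n (X + t)) (edge_point c n (Y + t)))
      has_real_derivative - edge_source n (X + z + edge_shift n c) (Y + z + edge_shift n c)) (at z)"
    using edge_kernel_DERIV[OF n, of "X + edge_shift n c" "Y + edge_shift n c" z]
    by (simp add: edge_point_shift[OF n, of c] add_ac)
  from DERIV_cmult[OF DERIV_diff[OF this edge_main_diagonal_DERIV[of n c X Y z]], of "real n"]
  show ?thesis unfolding edge_err_def edge_err_deriv_def by (simp add: algebra_simps)
qed

lemma hermite_fun_tendsto_0: "(hermite_fun k \<longlongrightarrow> 0) at_top"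
proof -
  define A where "A = (\<Sum>i\<le>degree (hermite_rec k). \<bar>coeff (hermite_rec k) i\<bar>)"
  define d where "d = degree (hermite_rec k)"
  have 1: "norm (hermite_fun k x) \<le> hermite_norm k * (A * ((1 + \<bar>x\<bar>) ^ d * exp (- (1 / 2 * x\<^sup>2))))" for x
  proof -
    have "norm (poly (hermite_rec k) x * exp (- (1 / 2 * x\<^sup>2))) \<le> A * ((1 + \<bar>x\<bar>) ^ d * exp (- (1 / 2 * x\<^sup>2)))"
      unfolding A_def d_def by (rule poly_gauss_norm_bound) simp
    from mult_left_mono[OF this, of "hermite_norm k"] show ?thesis
      using hermite_norm_pos[of k] by (simp add: hermite_fun_eq abs_mult mult.assoc)
  qed
  have 2: "((\<lambda>x::real. hermite_norm k * (A * ((1 + \<bar>x\<bar>) ^ d * exp (- (1 / 2 * x\<^sup>2))))) \<longlongrightarrow> 0) at_top"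
    by real_asymp
  show ?thesis by (rule Lim_null_comparison[OF always_eventually 2]) (use 1 in blast)
qed

text \<open>For fixed n the Hermite functions decay like Gaussians and all Airy terms vanish; no
  rate or uniformity in n enters.\<close>

lemma edge_err_tendsto_0:
  assumes n: "n > 0"
  shows "((\<lambda>z. edge_err n c (X + z) (Y + z)) \<longlongrightarrow> 0) at_top"
proof -
  have pt: "filterlim (\<lambda>z. edge_point c n (X + z)) at_top at_top" for X
    using edge_jacobian_pos[OF n] unfolding edge_point_def by real_asymp
  have "((\<lambda>z. edge_jacobian n * (\<Sum>k<n. hermite_fun k (edge_point c n (X + z)) * hermite_fun k (edge_point c n (Y + z))))
      \<longlongrightarrow> edge_jacobian n * (\<Sum>k<n. 0 * 0)) at_top"
    by (intro tendsto_intros filterlim_compose[OF hermite_fun_tendsto_0 pt])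
  then have H: "((\<lambda>z. edge_jacobian n * hermite_kernel n (edge_point c n (X + z)) (edge_point c n (Y + z))) \<longlongrightarrow> 0) at_top"
    by (simp add: hermite_kernel_def)
  have p: "((\<lambda>z. (X + z) ^ k * Airy (X + z)) \<longlongrightarrow> 0) at_top" "((\<lambda>z. (X + z) ^ k * Airy' (X + z)) \<longlongrightarrow> 0) at_top" for k X
    by (rule tendsto_0_decay[OF decay_Airy_power(1)[of 0 1 k]] tendsto_0_decay[OF decay_Airy_power(2)[of 0 1 k]])+
  note q = p[of _ 0, simplified] p[of _ 1, simplified] p[of _ 2]
  have "((\<lambda>z. Airy_kernel (X + z) (Y + z) - c * (Airy (X + z) * Airy (Y + z)) * edge_h n
     + 1 / 20 * (((X + z) * Airy' (X + z)) * Airy' (Y + z) + Airy' (X + z) * ((Y + z) * Airy' (Y + z))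
         - (((X + z)^2 * Airy (X + z)) * Airy (Y + z) + ((X + z) * Airy (X + z)) * ((Y + z) * Airy (Y + z)) + Airy (X + z) * ((Y + z)^2 * Airy (Y + z)))
         + (- 20 * c\<^sup>2 + 3) / 2 * (Airy' (X + z) * Airy (Y + z) + Airy (X + z) * Airy' (Y + z))) * edge_h n ^ 2)
     \<longlongrightarrow> 0 - c * (0 * 0) * edge_h n + 1 / 20 * (0 * 0 + 0 * 0 - (0 * 0 + 0 * 0 + 0 * 0) + (- 20 * c\<^sup>2 + 3) / 2 * (0 * 0 + 0 * 0)) * edge_h n ^ 2) at_top"
    by (intro tendsto_add tendsto_diff tendsto_mult tendsto_const Airy_kernel_tendsto_0 q)
  then have "((\<lambda>z. edge_main n c (X + z) (Y + z)) \<longlongrightarrow> 0) at_top"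
    by (simp add: edge_main_def algebra_simps)
  from tendsto_mult[OF tendsto_const tendsto_diff[OF H this], of "real n"]
  show ?thesis by (simp add: edge_err_def)
qed

text \<open>The diagonal derivative is n times an O(h^3) quantity. Since n h^3 = 1 it is bounded by
  a constant times exp (- X - Y - 2 z), and integrating over z keeps the factor exp (- X -
  Y).\<close>

lemma edge_err_bound:
  assumes B: "B \<ge> 0"
  obtains C N where "C \<ge> 0" "\<And>n c X Y. n \<ge> N \<Longrightarrow> n > 0 \<Longrightarrow> \<bar>c\<bar> \<le> B \<Longrightarrow> X \<ge> s \<Longrightarrow> Y \<ge> s \<Longrightarrow> \<bar>edge_err n c X Y\<bar> \<le> C * exp (- X - Y)"
proof -
  obtain C N where C: "C \<ge> 0" "\<And>n c X Y. n \<ge> N \<Longrightarrow> n > 0 \<Longrightarrow> \<bar>c\<bar> \<le> B \<Longrightarrow> X \<ge> s \<Longrightarrow> Y \<ge> s \<Longrightarrow>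
     \<bar>edge_source n (X + edge_shift n c) (Y + edge_shift n c) - edge_target n c X Y\<bar> \<le> C * edge_h n ^ 3 * exp (- X - Y)"
    using edge_source_decay[OF B, of s] by (rule decay2E) blast
  show ?thesis
  proof (rule that[OF C(1), of N])
    fix n c X Y assume a: "n \<ge> N" "n > 0" "\<bar>c\<bar> \<le> B" "X \<ge> s" "Y \<ge> s"
    have "\<bar>edge_err n c (X + 0) (Y + 0)\<bar> \<le> C * exp (- X - Y)"
    proof (rule integral_decay_bound[OF edge_err_diagonal_DERIV[OF a(2)] _ edge_err_tendsto_0[OF a(2)]])
      fix z :: real assume z: "z \<ge> 0"
      have "\<bar>edge_err_deriv n c (X + z) (Y + z)\<bar> = real n * \<bar>edge_source n (X + z + edge_shift n c) (Y + z + edge_shift n c) - edge_target n c (X + z) (Y + z)\<bar>"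
        by (simp add: edge_err_deriv_def abs_mult)
      also have "\<dots> \<le> real n * (C * edge_h n ^ 3 * exp (- (X + z) - (Y + z)))"
        using z a by (intro mult_left_mono C) auto
      also have "\<dots> = (real n * edge_h n ^ 3) * C * exp ((- X - Y) + - (2 * z))" by (simp add: algebra_simps)
      also have "\<dots> = C * exp (- X - Y) * exp (- (2 * z))" unfolding exp_add edge_h_cube[OF a(2)] by simp
      finally show "\<bar>edge_err_deriv n c (X + z) (Y + z)\<bar> \<le> C * exp (- X - Y) * exp (- (2 * z))" .
    qed
    then show "\<bar>edge_err n c X Y\<bar> \<le> C * exp (- X - Y)" by simp
  qed
qed

text \<open>Only the explicit diagonal derivative is differentiated in X, never the kernels. The
  mean value theorem bounds its increment, and integration along the diagonal carries this bound
  over to the error.\<close>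

lemma edge_err_Lipschitz:
  assumes B: "B \<ge> 0"
  obtains C N where "C \<ge> 0" "\<And>n c X X' Y. n \<ge> N \<Longrightarrow> n > 0 \<Longrightarrow> \<bar>c\<bar> \<le> B \<Longrightarrow> s \<le> X \<Longrightarrow> X \<le> X' \<Longrightarrow> s \<le> Y \<Longrightarrow>
     \<bar>edge_err n c X' Y - edge_err n c X Y\<bar> \<le> C * (X' - X) * exp (- X - Y)"
proof -
  obtain C N where C: "C \<ge> 0" "\<And>n c X Y. n \<ge> N \<Longrightarrow> n > 0 \<Longrightarrow> \<bar>c\<bar> \<le> B \<Longrightarrow> X \<ge> s \<Longrightarrow> Y \<ge> s \<Longrightarrow>
     \<bar>edge_source_deriv n (X + edge_shift n c) (Y + edge_shift n c) - edge_target_deriv n c X Y\<bar> \<le> C * edge_h n ^ 3 * exp (- X - Y)"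
    using edge_source_deriv_decay[OF B, of s] by (rule decay2E) blast
  show ?thesis
  proof (rule that[OF C(1), of N])
    fix n c X X' Y assume a: "n \<ge> N" "n > 0" "\<bar>c\<bar> \<le> B" "s \<le> X" "X \<le> X'" "s \<le> Y"
    let ?g = "\<lambda>X Y. edge_source n (X + edge_shift n c) (Y + edge_shift n c) - edge_target n c X Y"
    let ?g' = "\<lambda>X Y. edge_source_deriv n (X + edge_shift n c) (Y + edge_shift n c) - edge_target_deriv n c X Y"
    have g: "\<bar>?g U' V - ?g U V\<bar> \<le> C * edge_h n ^ 3 * exp (- U - V) * (U' - U)"
      if u: "s \<le> U" "U \<le> U'" "s \<le> V" for U U' V
    proof -
      have "norm (?g U' V - ?g U V) \<le> C * edge_h n ^ 3 * exp (- U - V) * norm (U' - U)"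
      proof (rule field_differentiable_bound[of "{U..U'}" _ "\<lambda>U. ?g' U V"])
        show "((\<lambda>U. ?g U V) has_field_derivative ?g' z V) (at z within {U..U'})" for z
          by (intro DERIV_diff has_field_derivative_at_within[OF edge_source_DERIV[OF a(2)]]
              has_field_derivative_at_within[OF edge_target_DERIV])
        fix z assume z: "z \<in> {U..U'}"
        have "norm (?g' z V) \<le> C * edge_h n ^ 3 * exp (- z - V)"
          using C(2)[of n c z V] a z u by simp
        also have "\<dots> \<le> C * edge_h n ^ 3 * exp (- U - V)"
          using z C(1) edge_h_pos[OF a(2)] by (intro mult_left_mono) auto
        finally show "norm (?g' z V) \<le> C * edge_h n ^ 3 * exp (- U - V)" .
      qed (use u in auto)
      then show ?thesis using u by simp
    qed
    have "\<bar>edge_err n c (X' + 0) (Y + 0) - edge_err n c (X + 0) (Y + 0)\<bar> \<le> C * (X' - X) * exp (- X - Y)"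
    proof (rule integral_decay_bound[OF DERIV_diff[OF edge_err_diagonal_DERIV[OF a(2)] edge_err_diagonal_DERIV[OF a(2)]]])
      show "((\<lambda>z. edge_err n c (X' + z) (Y + z) - edge_err n c (X + z) (Y + z)) \<longlongrightarrow> 0) at_top"
        using tendsto_diff[OF edge_err_tendsto_0[OF a(2), of c X' Y] edge_err_tendsto_0[OF a(2), of c X Y]] by simp
      fix z :: real assume z: "z \<ge> 0"
      have "edge_err_deriv n c (X' + z) (Y + z) - edge_err_deriv n c (X + z) (Y + z) = - (real n * (?g (X' + z) (Y + z) - ?g (X + z) (Y + z)))"
        unfolding edge_err_deriv_def by (simp add: right_diff_distrib)
      then have "\<bar>edge_err_deriv n c (X' + z) (Y + z) - edge_err_deriv n c (X + z) (Y + z)\<bar> = real n * \<bar>?g (X' + z) (Y + z) - ?g (X + z) (Y + z)\<bar>"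
        by (simp only: abs_minus_cancel abs_mult abs_of_nat)
      also have "\<dots> \<le> real n * (C * edge_h n ^ 3 * exp (- (X + z) - (Y + z)) * ((X' + z) - (X + z)))"
        using z a by (intro mult_left_mono g) auto
      also have "\<dots> = (real n * edge_h n ^ 3) * (C * (X' - X)) * exp ((- X - Y) + - (2 * z))" by (simp add: algebra_simps)
      also have "\<dots> = C * (X' - X) * exp (- X - Y) * exp (- (2 * z))" unfolding exp_add edge_h_cube[OF a(2)] by simp
      finally show "\<bar>edge_err_deriv n c (X' + z) (Y + z) - edge_err_deriv n c (X + z) (Y + z)\<bar> \<le> C * (X' - X) * exp (- X - Y) * exp (- (2 * z))" .
    qed
    then show "\<bar>edge_err n c X' Y - edge_err n c X Y\<bar> \<le> C * (X' - X) * exp (- X - Y)" by simp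
  qed
qed

lemma edge_err_measurable: "edge_err n c X \<in> borel_measurable borel"
proof -
  have A [measurable]: "Airy \<in> borel_measurable borel" "Airy' \<in> borel_measurable borel"
    by (intro borel_measurable_continuous_onI Airy_continuous)+
  have H [measurable]: "hermite_fun k \<in> borel_measurable borel" for k
    by (intro borel_measurable_continuous_onI continuous_at_imp_continuous_on ballI DERIV_isCont[OF hermite_fun_DERIV])
  have "(\<lambda>Y. LINT z|lborel. indicat_real {0..} z *\<^sub>R (Airy (X + z) * Airy (Y + z))) \<in> borel_measurable borel"
    by measurable
  then have K [measurable]: "Airy_kernel X \<in> borel_measurable borel"
    unfolding Airy_kernel_def[abs_def] set_lebesgue_integral_def .
  show ?thesis unfolding edge_err_def[abs_def] edge_main_def hermite_kernel_def edge_point_def by measurable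
qed

theorem theorem1p2:
  shows "\<exists>E :: nat \<Rightarrow> real \<Rightarrow> real \<Rightarrow> real \<Rightarrow> real.
    (\<forall>n::nat. \<forall>c X Y :: real. n > 0 \<and> real n + c \<ge> 0 \<longrightarrow>
       hermite_kernel n (edge_point c n X) (edge_point c n Y) * edge_jacobian n
       = Airy_kernel X Y
         - c * Airy X * Airy Y * real n powr (- 1 / 3)
         + 1 / 20 * ((X + Y) * Airy' X * Airy' Y
                     - (X\<^sup>2 + X * Y + Y\<^sup>2) * Airy X * Airy Y
                     + (- 20 * c\<^sup>2 + 3) / 2 * (Airy' X * Airy Y + Airy X * Airy' Y))
                  * real n powr (- 2 / 3)
         + 1 / real n * E n c X Y)
    \<and> (\<forall>B::real. \<exists>C. \<forall>\<^sub>F n in sequentially. \<forall>c X Y.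
         \<bar>c\<bar> \<le> B \<and> \<bar>X\<bar> \<le> B \<and> \<bar>Y\<bar> \<le> B \<longrightarrow> \<bar>E n c X Y\<bar> \<le> C)
    \<and> (\<forall>J \<in> sets (borel :: real measure). bdd_below J \<longrightarrow>
         (\<forall>B::real. \<exists>C. \<forall>\<^sub>F n in sequentially. \<forall>c. \<bar>c\<bar> \<le> B \<longrightarrow>
            L2_operator_kernel (restrict_space lborel J) (E n c)
            \<and> trace_class_operator (restrict_space lborel J)
                 (integral_operator (restrict_space lborel J) (E n c))
            \<and> trace_norm (restrict_space lborel J)
                 (integral_operator (restrict_space lborel J) (E n c)) \<le> C))"
proof (intro exI[of _ edge_err] conjI allI ballI impI)
  fix n :: nat and c X Y :: real assume "n > 0 \<and> real n + c \<ge> 0"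
  then have n: "n > 0" by simp
  have "1 / real n * edge_err n c X Y = edge_jacobian n * hermite_kernel n (edge_point c n X) (edge_point c n Y) - edge_main n c X Y"
    using n by (simp add: edge_err_def)
  moreover have "edge_h n ^ 2 = real n powr (- 2 / 3)" using edge_h_power[OF n, of 2] by simp
  ultimately show "hermite_kernel n (edge_point c n X) (edge_point c n Y) * edge_jacobian n
       = Airy_kernel X Y
         - c * Airy X * Airy Y * real n powr (- 1 / 3)
         + 1 / 20 * ((X + Y) * Airy' X * Airy' Y
                     - (X\<^sup>2 + X * Y + Y\<^sup>2) * Airy X * Airy Y
                     + (- 20 * c\<^sup>2 + 3) / 2 * (Airy' X * Airy Y + Airy X * Airy' Y))
                  * real n powr (- 2 / 3)
         + 1 / real n * edge_err n c X Y"
    by (simp add: edge_main_def edge_h_def mult.commute)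
next
  fix B :: real
  \<comment> \<open>The bound B is an arbitrary real; passing to |B| provides the sign condition and
    the half line from - |B|.\<close>
  obtain C N where C: "C \<ge> 0" "\<And>n c X Y. n \<ge> N \<Longrightarrow> n > 0 \<Longrightarrow> \<bar>c\<bar> \<le> \<bar>B\<bar> \<Longrightarrow> X \<ge> - \<bar>B\<bar> \<Longrightarrow> Y \<ge> - \<bar>B\<bar> \<Longrightarrow> \<bar>edge_err n c X Y\<bar> \<le> C * exp (- X - Y)"
    by (rule edge_err_bound[of "\<bar>B\<bar>" "- \<bar>B\<bar>"]) auto
  have "\<bar>edge_err n c X Y\<bar> \<le> C * exp (2 * \<bar>B\<bar>)"
    if "n \<ge> max 1 N" "\<bar>c\<bar> \<le> B \<and> \<bar>X\<bar> \<le> B \<and> \<bar>Y\<bar> \<le> B" for n c X Y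
  proof -
    have "\<bar>edge_err n c X Y\<bar> \<le> C * exp (- X - Y)" using that by (intro C) auto
    also have "\<dots> \<le> C * exp (2 * \<bar>B\<bar>)" using that C(1) by (intro mult_left_mono) auto
    finally show ?thesis .
  qed
  then have "\<forall>\<^sub>F n in sequentially. \<forall>c X Y. \<bar>c\<bar> \<le> B \<and> \<bar>X\<bar> \<le> B \<and> \<bar>Y\<bar> \<le> B \<longrightarrow> \<bar>edge_err n c X Y\<bar> \<le> C * exp (2 * \<bar>B\<bar>)"
    by (intro eventually_sequentiallyI[of "max 1 N"]) blast
  then show "\<exists>C. \<forall>\<^sub>F n in sequentially. \<forall>c X Y. \<bar>c\<bar> \<le> B \<and> \<bar>X\<bar> \<le> B \<and> \<bar>Y\<bar> \<le> B \<longrightarrow> \<bar>edge_err n c X Y\<bar> \<le> C" ..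
next
  fix J :: "real set" and B :: real assume J: "J \<in> sets borel" "bdd_below J"
  then obtain s where s: "J \<subseteq> {s..}" by (auto simp: bdd_below_def)
  obtain C N where C: "C \<ge> 0" "\<And>n c X Y. n \<ge> N \<Longrightarrow> n > 0 \<Longrightarrow> \<bar>c\<bar> \<le> \<bar>B\<bar> \<Longrightarrow> X \<ge> s \<Longrightarrow> Y \<ge> s \<Longrightarrow> \<bar>edge_err n c X Y\<bar> \<le> C * exp (- X - Y)"
    by (rule edge_err_bound[of "\<bar>B\<bar>" s]) auto
  obtain D M where D: "D \<ge> 0" "\<And>n c X X' Y. n \<ge> M \<Longrightarrow> n > 0 \<Longrightarrow> \<bar>c\<bar> \<le> \<bar>B\<bar> \<Longrightarrow> s \<le> X \<Longrightarrow> X \<le> X' \<Longrightarrow> s \<le> Y \<Longrightarrow>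
     \<bar>edge_err n c X' Y - edge_err n c X Y\<bar> \<le> D * (X' - X) * exp (- X - Y)"
    by (rule edge_err_Lipschitz[of "\<bar>B\<bar>" s]) auto
  \<comment> \<open>One constant for the size and the Lipschitz bound. It depends on B and s only,
    so the trace norm bound is uniform in n and c.\<close>
  define A where "A = max C D"
  let ?M = "restrict_space lborel J"
  have "L2_operator_kernel ?M (edge_err n c) \<and> trace_class_operator ?M (integral_operator ?M (edge_err n c))
      \<and> trace_norm ?M (integral_operator ?M (edge_err n c)) \<le> A * exp (- 2 * s) * (2 * exp 1 / (1 - sqrt (1 / 2)))"
    if n: "n \<ge> max 1 (max N M)" and c: "\<bar>c\<bar> \<le> B" for n c
  proof -
    have A: "A \<ge> 0" using C(1) by (simp add: A_def)
    have 1: "\<bar>edge_err n c x y\<bar> \<le> A * exp (- x - y)" if "s \<le> x" "s \<le> y" for x y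
      by (rule order_trans[OF C(2) mult_right_mono]) (use n c that in \<open>auto simp: A_def\<close>)
    have 2: "\<bar>edge_err n c x' y - edge_err n c x y\<bar> \<le> A * (x' - x) * exp (- x - y)" if "s \<le> x" "x \<le> x'" "s \<le> y" for x x' y
      by (rule order_trans[OF D(2) mult_right_mono[OF mult_right_mono]]) (use n c that in \<open>auto simp: A_def\<close>)
    show ?thesis
      by (intro conjI trace_class_exp_Lipschitz_kernel[OF J(1) s A 1 2 edge_err_measurable])
  qed
  then show "\<exists>C. \<forall>\<^sub>F n in sequentially. \<forall>c. \<bar>c\<bar> \<le> B \<longrightarrow> L2_operator_kernel ?M (edge_err n c)
      \<and> trace_class_operator ?M (integral_operator ?M (edge_err n c))
      \<and> trace_norm ?M (integral_operator ?M (edge_err n c)) \<le> C"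
    by (intro exI[of _ "A * exp (- 2 * s) * (2 * exp 1 / (1 - sqrt (1 / 2)))"] eventually_sequentiallyI[of "max 1 (max N M)"]) blast
qed

end
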